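(* Let $\sigma>0$ be fixed, $C_\sigma=\{\lambda\in\mathbb{C}:\operatorname{Re}\lambda=\sigma\}$, and let $k\not\equiv 0$, $u$, $g=k\ast u$, the noisy data $g_\delta$ (with $|g_\delta(t)-g(t)|\le\delta$ for all $t\ge0$), the Laplace transforms $K,G,G_\delta$, and the approximation $u_\delta$ (depending on a positive integer $m$ and a parameter $N>0$) be as in the context. Assume that there are constants $c>0$ and $a\in\mathbb{R}$ with $$|K(\lambda)|\ge c|\lambda|^{-a}\quad\text{for all }\lambda\in C_\sigma.\qquad(\ast)$$ (i) If $m>a+\tfrac12$, then there exists $N=N(\delta)\to\infty$ as $\delta\to0$ such that, with this choice of $N$, $\eta(\delta):=\|u_\delta-u\|\to0$ as $\delta\to0$, where $\|\cdot\|$ is the norm of $L^2(0,\infty;e^{-2\sigma t})$. (ii) If $K^{-1}(\lambda)G(\lambda)\in L^1(C_\sigma)$ and $m>a+1$, then there exists $N=N(\delta)\to\infty$ as $\delta\to 0$ such that $\eta(\delta):=\|u_\delta-u\|\to0$ as $\delta\to0$, where $\|\cdot\|$ is the norm of $L^\infty(0,T)$, $0<T<\infty$. (iii) Suppose $m>a+1$ and there are constants $c>0$ and $d>0$ with $$|K^{-1}(\lambda)G(\lambda)|\le\frac{c}{1+|\lambda|^{1+d}}\quad\text{for all }\lambda\in C_\sigma.$$ Then one can choose $N=N(\delta)\to\infty$ so that, with $\|\cdot\|$ the norm of $L^\infty(0,T)$, $0<T<\infty$, and $\eta(\delta):=\|u_\delta-u\|$, the following hold as $\delta\to0$: - if $0<d<1$: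 $N(\delta)=O\big(\delta^{-1/q}\big)$ and $\eta(\delta)=O\big(\delta^{d/q}\big)$, where $q=a+d+1$; - if $d>1$: $N(\delta)=O\big(\delta^{-1/(a+2)}\big)$ and $\eta(\delta)=O\big(\delta^{1/(a+2)}\big)$; - if $d=1$: $N(\delta)=O\Big(\exp\big[\tfrac{|\log\delta|}{a+2}(1+o(1))\big]\Big)$ and $\eta(\delta)=O\Big(|\log\delta|\,\exp\big[-\tfrac{|\log\delta|}{a+2}(1+o(1))\big]\Big)$.
   Context: The problem is the Volterra convolution equation $\int_0^t k(t-s)u(s)\,ds=(k\ast u)(t)=g(t)$. The functions $k,u$ vanish for $t<0$; $k\not\equiv0$ and $\int_0^\infty e^{-\sigma t}|k(t)|\,dt<\infty$. The case of a finite interval $[0,T]$ is reduced to $(0,\infty)$ by setting $u(t)=0$ for $t>T$ and defining $g(t):=(k\ast u)(t)$ for $t>T$. The exact solution $u$ is assumed to belong to the space in whose norm convergence is asserted, and to have a Laplace transform on $C_\sigma$. $L^2(0,\infty;e^{-2\sigma t})$ is the space with norm $\left(\int_0^\infty|f(t)|^2e^{-2\sigma t}dt\right)^{1/2}$. Capital letters denote Laplace transforms: $K(\lambda)=\int_0^\infty e^{-\lambda t}k(t)\,dt$, $G(\lambda)=\int_0^\infty e^{-\lambda t}g(t)\,dt$, $G_\delta(\lambda)=\int_0^\infty e^{-\lambda t}g_\delta(t)\,dt$. $K^{-1}(\lambda)$ means $1/K(\lambda)$. The noise $w=g_\delta-g$ satisfies $|w(t)|\le\delta$, hence $|G_\delta(\lambda)-G(\lambda)|\le\delta/\sigma$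 on $C_\sigma$. The approximation is $$u_\delta(t):=\frac1{2\pi i}\int_{\sigma-i\infty}^{\sigma+i\infty}e^{\lambda t}K^{-1}(\lambda)G_\delta(\lambda)\frac{1}{\left(\frac{\lambda}{N}+1\right)^m}\,d\lambda,$$ where $m$ is a positive integer and $N>0$ (the integral is understood in the $L^2$ (Plancherel) sense when it is not absolutely convergent). Constants in $O(\cdot)$ do not depend on $\delta$. *)

theory Defs
  imports "HOL-Probability.Probability" "HOL-Library.Landau_Symbols"
begin

text \<open>The vertical line of the complex plane on which all Laplace transforms are evaluated.\<close>

definition Cline :: "real \<Rightarrow> complex set" where
  "Cline \<sigma> = {z. Re z = \<sigma>}"

definition causal :: "(real \<Rightarrow> complex) \<Rightarrow> bool" where
  "causal f \<longleftrightarrow> (\<forall>t<0. f t = 0)"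

text \<open>For integrable kernels the integral below exists for almost every \<open>t\<close> only; on the
  exceptional null set it has the library's default value 0.\<close>

definition volterra_conv :: "(real \<Rightarrow> complex) \<Rightarrow> (real \<Rightarrow> complex) \<Rightarrow> real \<Rightarrow> complex" where
  "volterra_conv k u t = (LINT s:{0..t}|lborel. k (t - s) * u s)"

definition laplace :: "(real \<Rightarrow> complex) \<Rightarrow> complex \<Rightarrow> complex" where
  "laplace f z = (LINT t:{0..}|lborel. exp (- z * of_real t) * f t)"

definition has_laplace_at :: "(real \<Rightarrow> complex) \<Rightarrow> complex \<Rightarrow> bool" where
  "has_laplace_at f z \<longleftrightarrow> set_integrable lborel {0..} (\<lambda>t. exp (- z * of_real t) * f t)"

text \<open>A family of noisy data, one function for each noise level \<open>\<delta> > 0\<close>.\<close>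

definition noisy_data :: "(real \<Rightarrow> complex) \<Rightarrow> (real \<Rightarrow> real \<Rightarrow> complex) \<Rightarrow> bool" where
  "noisy_data g gd \<longleftrightarrow> (\<forall>\<delta>>0. set_borel_measurable lborel {0..} (gd \<delta>) \<and>
      (\<forall>t\<ge>0. norm (gd \<delta> t - g t) \<le> \<delta>))"

text \<open>Integrability of a function on \<open>Cline \<sigma>\<close> with respect to arc length, i.e. membership
  in \<open>L\<^sup>1\<close> of that line.\<close>

definition integrable_Cline :: "real \<Rightarrow> (complex \<Rightarrow> complex) \<Rightarrow> bool" where
  "integrable_Cline \<sigma> F \<longleftrightarrow> integrable lborel (\<lambda>y. F (Complex \<sigma> y))"

text \<open>The inversion integral of \<open>exp (z t) F(z) / (2 \<pi> i)\<close> along \<open>z = \<sigma> + i y\<close>,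
  with \<open>dz = i dy\<close>, over \<open>-R \<le> y \<le> R\<close> and over the whole line.\<close>

definition inv_trunc :: "real \<Rightarrow> (complex \<Rightarrow> complex) \<Rightarrow> real \<Rightarrow> real \<Rightarrow> complex" where
  "inv_trunc \<sigma> F R t = 1 / (2 * of_real pi * \<i>) *
     (LINT y:{-R..R}|lborel. exp (Complex \<sigma> y * of_real t) * F (Complex \<sigma> y) * \<i>)"

definition inv_full :: "real \<Rightarrow> (complex \<Rightarrow> complex) \<Rightarrow> real \<Rightarrow> complex" where
  "inv_full \<sigma> F t = 1 / (2 * of_real pi * \<i>) *
     (LINT y|lborel. exp (Complex \<sigma> y * of_real t) * F (Complex \<sigma> y) * \<i>)"

text \<open>Plancherel reading of the integral: \<open>v\<close> is the limit of the truncated integrals in the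
  \<open>L\<^sup>2\<close> space on the whole real line with weight \<open>exp (-2 \<sigma> t)\<close>.\<close>

definition is_L2_inversion :: "real \<Rightarrow> (complex \<Rightarrow> complex) \<Rightarrow> (real \<Rightarrow> complex) \<Rightarrow> bool" where
  "is_L2_inversion \<sigma> F v \<longleftrightarrow> v \<in> borel_measurable lborel \<and>
     ((\<lambda>R. \<integral>\<^sup>+t. ennreal ((norm (v t - inv_trunc \<sigma> F R t))\<^sup>2 * exp (-2 * \<sigma> * t)) \<partial>lborel)
        \<longlongrightarrow> 0) at_top"

text \<open>Since \<open>|exp (z t)| = exp (\<sigma> t)\<close> on the line, absolute convergence does not depend on
  \<open>t\<close>. Otherwise a representative of the \<open>L\<^sup>2\<close> limit, unique up to null sets, is chosen.\<close>

definition inversion :: "real \<Rightarrow> (complex \<Rightarrow> complex) \<Rightarrow> real \<Rightarrow> complex" where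
  "inversion \<sigma> F = (if integrable_Cline \<sigma> F then inv_full \<sigma> F
                       else (SOME v. is_L2_inversion \<sigma> F v))"

definition u_approx ::
  "real \<Rightarrow> (real \<Rightarrow> complex) \<Rightarrow> nat \<Rightarrow> real \<Rightarrow> (real \<Rightarrow> complex) \<Rightarrow> real \<Rightarrow> complex" where
  "u_approx \<sigma> k m N gd =
     inversion \<sigma> (\<lambda>z. inverse (laplace k z) * laplace gd z * (1 / (z / of_real N + 1) ^ m))"

text \<open>The weighted space \<open>L\<^sup>2(0,\<infinity>; exp (-2 \<sigma> t))\<close> and \<open>L\<^sup>\<infinity>(0,T)\<close>. The norms are real
  valued and only meaningful for members of the respective space.\<close>

definition in_L2w :: "real \<Rightarrow> (real \<Rightarrow> complex) \<Rightarrow> bool" where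
  "in_L2w \<sigma> f \<longleftrightarrow> set_borel_measurable lborel {0..} f \<and>
     set_integrable lborel {0..} (\<lambda>t. (norm (f t))\<^sup>2 * exp (-2 * \<sigma> * t))"

definition norm_L2w :: "real \<Rightarrow> (real \<Rightarrow> complex) \<Rightarrow> real" where
  "norm_L2w \<sigma> f = sqrt (LINT t:{0..}|lborel. (norm (f t))\<^sup>2 * exp (-2 * \<sigma> * t))"

definition esssup_norm :: "real \<Rightarrow> (real \<Rightarrow> complex) \<Rightarrow> ereal" where
  "esssup_norm T f = esssup (restrict_space lborel {0<..<T}) (\<lambda>t. ereal (norm (f t)))"

definition in_Linf :: "real \<Rightarrow> (real \<Rightarrow> complex) \<Rightarrow> bool" where
  "in_Linf T f \<longleftrightarrow> set_borel_measurable lborel {0<..<T} f \<and> esssup_norm T f < \<infinity>"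

definition norm_Linf :: "real \<Rightarrow> (real \<Rightarrow> complex) \<Rightarrow> real" where
  "norm_Linf T f = real_of_ereal (esssup_norm T f)"

end

theory Submission
  imports Defs
begin

text \<open>
  Put \<open>f t = exp (- \<sigma> t) u t\<close>. On the line \<open>K\<^sup>-\<^sup>1 G\<close> is the Laplace transform \<open>U\<close> of \<open>u\<close>,
  i.e. the Fourier transform of \<open>f\<close>, so with \<open>h z = (z / N + 1)\<^bsup>-m\<^esup>\<close> the spectral error is
  \<open>U (h - 1)\<close> (bias) plus \<open>K\<^sup>-\<^sup>1 W h\<close> (noise, \<open>W\<close> the transform of \<open>g\<^sub>\<delta> - g\<close>). The noise is at most
  \<open>\<delta> N\<^bsup>a+1\<^esup>\<close> in \<open>L\<^sup>1\<close> and \<open>\<delta> N\<^bsup>a+1/2\<^esup>\<close> in \<open>L\<^sup>2\<close>, up to constants; the bias tends to 0 by dominated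
  convergence, and the decay assumption turns this into \<open>N\<^bsup>-d\<^esup>\<close>, \<open>N\<^bsup>-1\<^esup> ln N\<close> or \<open>N\<^bsup>-1\<^esup>\<close>.
  Balancing both terms gives \<open>N = \<delta>\<^bsup>-1/(a+2)\<^esup>\<close>, respectively \<open>N = \<delta>\<^bsup>-1/(a+d+1)\<^esup>\<close> when \<open>d < 1\<close>.

  Of Plancherel's theorem only the bound of the Fourier transform on \<open>L\<^sup>2\<close> is needed, which follows
  by inserting a Gaussian weight. That inverting \<open>U\<close> gives back \<open>f\<close> follows from Levy's inversion
  formula: it computes the integrals of \<open>f\<close> over intervals, and these determine \<open>f\<close>.
\<close>

section \<open>The Fourier integral on square integrable functions\<close>

text \<open>Three obstacles shape the proof. Outside the absolutely convergent case
  \<open>inversion\<close> returns an unspecified representative, so \<open>u_approx\<close> can be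
  compared with u only through \<open>is_L2_inversion\<close>; the L2 estimates are therefore made
  for arbitrary L2 limits. Pointwise inversion is out of reach because u may have no smoothness and,
  in part (i), U need not be integrable. Levy's formula asks only for integrability of f, but it
  speaks of probability distributions; linearity carries it over to complex f. Finally, N has to be
  fixed before the noise and before T. In parts (i) and (ii) the bias tends to 0 at an unknown
  speed, so any N tending to infinity with \<delta> N^(a+1) tending to 0 will do, and the choice
  made for the rates is reused. The sign of a is left open by the statement, but K is a bounded
  function on the line, which forces 0 \<le> a; hence a + 2 > 0 and all exponents make sense. When d
  = 1, both o(1) terms can be taken to be 0.\<close>

definition fourier :: "(real \<Rightarrow> complex) \<Rightarrow> real \<Rightarrow> complex" where
  "fourier F t = (LINT y|lborel. iexp (t * y) * F y)"

lemma integrable_fourier_integrand: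
  assumes "integrable lborel F"
  shows "integrable lborel (\<lambda>y. iexp (t * y) * F y)"
proof (rule Bochner_Integration.integrable_bound[OF assms])
  show "(\<lambda>y. iexp (t * y) * F y) \<in> borel_measurable lborel"
    using borel_measurable_integrable[OF assms] by measurable
qed (simp add: norm_mult)

lemma measurable_fourier [measurable]:
  assumes [measurable]: "F \<in> borel_measurable borel"
  shows "fourier F \<in> borel_measurable borel"
  unfolding fourier_def by measurable

lemma norm_fourier_le:
  assumes "integrable lborel F"
  shows "norm (fourier F t) \<le> (LINT y|lborel. norm (F y))"
  unfolding fourier_def
  using integral_norm_bound[of lborel "\<lambda>y. iexp (t * y) * F y"] by (simp add: norm_mult)

lemma integrable_tensor:
  fixes f g :: "real \<Rightarrow> complex"
  assumes f: "integrable lborel f" and g: "integrable lborel g"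
  shows "integrable (lborel \<Otimes>\<^sub>M lborel) (\<lambda>(x, y). f x * g y)"
proof (rule lborel_pair.Fubini_integrable)
  have [measurable]: "f \<in> borel_measurable borel" "g \<in> borel_measurable borel"
    using borel_measurable_integrable[OF f] borel_measurable_integrable[OF g] by simp_all
  show "(\<lambda>(x, y). f x * g y) \<in> borel_measurable (lborel \<Otimes>\<^sub>M lborel)"
    by measurable
  show "integrable lborel (\<lambda>x. LINT y|lborel. norm (case (x, y) of (x, y) \<Rightarrow> f x * g y))"
    using f by (simp add: norm_mult)
  show "AE x in lborel. integrable lborel (\<lambda>y. case (x, y) of (x, y) \<Rightarrow> f x * g y)"
    using g by simp
qed

text \<open>Serves the applications of Fubini in which b is an exponential of modulus 1 that couples
  the two variables.\<close>

lemma integrable_tensor_bounded: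
  fixes f g :: "real \<Rightarrow> complex" and b :: "real \<times> real \<Rightarrow> complex"
  assumes f: "integrable lborel f" and g: "integrable lborel g"
    and b [measurable]: "b \<in> borel_measurable (borel \<Otimes>\<^sub>M borel)" and B: "\<And>p. norm (b p) \<le> B"
  shows "integrable (lborel \<Otimes>\<^sub>M lborel) (\<lambda>(x, y). b (x, y) * (f x * g y))"
proof (rule Bochner_Integration.integrable_bound)
  have [measurable]: "f \<in> borel_measurable borel" "g \<in> borel_measurable borel"
    using borel_measurable_integrable[OF f] borel_measurable_integrable[OF g] by simp_all
  show "integrable (lborel \<Otimes>\<^sub>M lborel) (\<lambda>p. B *\<^sub>R (case p of (x, y) \<Rightarrow> f x * g y))"
    using integrable_tensor[OF f g] by (intro integrable_scaleR_right) 
  show "(\<lambda>(x, y). b (x, y) * (f x * g y)) \<in> borel_measurable (lborel \<Otimes>\<^sub>M lborel)"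
    by measurable
  have "0 \<le> B" using order_trans[OF norm_ge_zero B] .
  then show "AE x in lborel \<Otimes>\<^sub>M lborel.
       norm (case x of (x, y) \<Rightarrow> b (x, y) * (f x * g y))
       \<le> norm (B *\<^sub>R (case x of (x, y) \<Rightarrow> f x * g y))"
    by (intro AE_I2) (auto simp: norm_mult split: prod.splits intro!: mult_right_mono B)
qed

text \<open>The Fourier transform of \<open>\<lambda>t. std_normal_density (e * t)\<close>. That
  weight is dilated but not renormalised, so that it tends to the constant 1 / sqrt (2 pi) as e
  tends to 0.\<close>

definition gauss_kernel :: "real \<Rightarrow> real \<Rightarrow> real" where
  "gauss_kernel e x = exp (- ((x / e)\<^sup>2) / 2) / e"

lemma measurable_gauss_kernel [measurable]: "gauss_kernel e \<in> borel_measurable borel"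
  unfolding gauss_kernel_def by measurable

lemma gauss_kernel_nonneg: "0 < e \<Longrightarrow> 0 \<le> gauss_kernel e x"
  by (simp add: gauss_kernel_def)

lemma integrable_dilated_normal:
  "0 < e \<Longrightarrow> integrable lborel (\<lambda>t. std_normal_density (e * t))"
  using lborel_integrable_real_affine[OF integrable_normal_density[of 1 0], of e 0] by simp

text \<open>The substitution s = e t turns the integral into the characteristic function of the
  standard normal distribution at x / e.\<close>

lemma fourier_dilated_normal:
  assumes "0 < e"
  shows "(LINT t|lborel. iexp (t * x) * of_real (std_normal_density (e * t)))
    = of_real (gauss_kernel e x)"
proof -
  let ?f = "\<lambda>s. std_normal_density s *\<^sub>R iexp ((x / e) * s)"
  have "of_real (exp (- ((x / e)\<^sup>2) / 2)) = char std_normal_distribution (x / e)"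
    by (simp add: char_std_normal_distribution)
  also have "\<dots> = (LINT s|lborel. ?f s)"
    unfolding char_def by (subst integral_density) auto
  also have "\<dots> = \<bar>e\<bar> *\<^sub>R (LINT t|lborel. ?f (0 + e * t))"
    using assms by (intro lborel_integral_real_affine) auto
  also have "(LINT t|lborel. ?f (0 + e * t)) =
      (LINT t|lborel. iexp (t * x) * of_real (std_normal_density (e * t)))"
    using assms by (intro Bochner_Integration.integral_cong) (auto simp: scaleR_conv_of_real mult_ac)
  finally show ?thesis
    using assms by (simp add: gauss_kernel_def scaleR_conv_of_real field_simps)
qed

text \<open>The mass depends neither on e nor on y. This makes the Schur bound uniform in e, so that
  e can tend to 0 afterwards.\<close>

lemma nn_integral_gauss_kernel:
  assumes "0 < e"
  shows "(\<integral>\<^sup>+x. ennreal (gauss_kernel e (x - y)) \<partial>lborel) = ennreal (sqrt (2 * pi))"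
proof -
  have "(\<integral>\<^sup>+x. ennreal (gauss_kernel e (x - y)) \<partial>lborel)
      = ennreal \<bar>e\<bar> * (\<integral>\<^sup>+x. ennreal (gauss_kernel e (y + e * x - y)) \<partial>lborel)"
    using assms by (intro nn_integral_real_affine) auto
  also have "(\<integral>\<^sup>+x. ennreal (gauss_kernel e (y + e * x - y)) \<partial>lborel)
      = (\<integral>\<^sup>+x. ennreal (sqrt (2 * pi) / e) * ennreal (std_normal_density x) \<partial>lborel)"
    using assms by (intro nn_integral_cong)
      (simp add: gauss_kernel_def std_normal_density_def ennreal_mult[symmetric] field_simps)
  also have "\<dots> = ennreal (sqrt (2 * pi) / e) * ennreal 1"
    by (subst nn_integral_cmult) 
       (simp_all add: nn_integral_eq_integral integrable_normal_density integral_normal_density)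
  finally show ?thesis
    using assms by (simp add: ennreal_mult[symmetric])
qed

text \<open>Write the square as \<open>fourier F t\<close> times its conjugate, expand both
  integrals, and integrate over t first. Without the weight that integral would not converge
  absolutely; with it the result is exactly \<open>gauss_kernel\<close>.\<close>

lemma weighted_energy_fourier:
  assumes F: "integrable lborel F" and e: "0 < e"
  shows "(LINT t|lborel. of_real (std_normal_density (e * t) * (norm (fourier F t))\<^sup>2)) =
    (LINT y|lborel. LINT x|lborel. of_real (gauss_kernel e (x - y)) * (F x * cnj (F y)))"
proof -
  let ?w = "\<lambda>t. complex_of_real (std_normal_density (e * t))"
  have [measurable]: "F \<in> borel_measurable borel"
    using borel_measurable_integrable[OF F] by simp
  have w: "integrable lborel ?w"
    using integrable_dilated_normal[OF e] by (rule integrable_of_real)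
  have cF: "integrable lborel (\<lambda>y. cnj (F y))"
    using F by simp
  \<comment> \<open>\<open>fourier F\<close> is only known to be bounded by the L1 norm of F; the
    weight supplies the integrability in t that Fubini requires.\<close>
  have wF: "integrable lborel (\<lambda>t. ?w t * fourier F t)"
  proof (rule Bochner_Integration.integrable_bound)
    show "integrable lborel (\<lambda>t. (LINT y|lborel. norm (F y)) *\<^sub>R ?w t)"
      using w by (intro integrable_scaleR_right)
    show "(\<lambda>t. ?w t * fourier F t) \<in> borel_measurable lborel"
      by measurable
    show "AE t in lborel. norm (?w t * fourier F t) \<le> norm ((LINT y|lborel. norm (F y)) *\<^sub>R ?w t)"
      using mult_left_mono[OF norm_fourier_le[OF F], of "std_normal_density (e * t)" for t]
      by (intro AE_I2) (simp add: norm_mult mult.commute integral_nonneg_AE)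
  qed
  have "(LINT t|lborel. of_real (std_normal_density (e * t) * (norm (fourier F t))\<^sup>2))
      = (LINT t|lborel. LINT y|lborel. iexp (- (t * y)) * (?w t * fourier F t * cnj (F y)))"
  proof (intro Bochner_Integration.integral_cong refl)
    fix t
    have "cnj (fourier F t) = (LINT y|lborel. cnj (iexp (t * y) * F y))"
      unfolding fourier_def by (simp del: complex_cnj_mult)
    also have "\<dots> = (LINT y|lborel. iexp (- (t * y)) * cnj (F y))"
      by (simp add: exp_cnj)
    finally have "complex_of_real ((norm (fourier F t))\<^sup>2) =
        fourier F t * (LINT y|lborel. iexp (- (t * y)) * cnj (F y))"
      by (metis complex_norm_square)
    then have "complex_of_real (std_normal_density (e * t) * (norm (fourier F t))\<^sup>2) =
        (?w t * fourier F t) * (LINT y|lborel. iexp (- (t * y)) * cnj (F y))"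
      by (simp only: of_real_mult mult.assoc)
    also have "\<dots> = (LINT y|lborel. (?w t * fourier F t) * (iexp (- (t * y)) * cnj (F y)))"
      by simp
    finally show "complex_of_real (std_normal_density (e * t) * (norm (fourier F t))\<^sup>2) =
        (LINT y|lborel. iexp (- (t * y)) * (?w t * fourier F t * cnj (F y)))"
      by (simp only: mult_ac)
  qed
  also have "\<dots> = (LINT y|lborel. LINT t|lborel. iexp (- (t * y)) * (?w t * fourier F t * cnj (F y)))"
  proof -
    have "integrable (lborel \<Otimes>\<^sub>M lborel)
        (\<lambda>(t, y). (\<lambda>(t, y). iexp (- (t * y))) (t, y) * ((?w t * fourier F t) * cnj (F y)))"
      by (rule integrable_tensor_bounded[OF wF cF, where B = 1]) (measurable, auto)
    then show ?thesis
      by (intro lborel_pair.Fubini_integral[symmetric]) (simp add: split_beta)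
  qed
  also have "\<dots> = (LINT y|lborel. LINT x|lborel. of_real (gauss_kernel e (x - y)) * (F x * cnj (F y)))"
  proof (rule Bochner_Integration.integral_cong[OF refl])
    fix y
    have "(LINT t|lborel. iexp (- (t * y)) * (?w t * fourier F t * cnj (F y)))
        = (LINT t|lborel. cnj (F y) * (LINT x|lborel. iexp (t * (x - y)) * (?w t * F x)))"
    proof (intro Bochner_Integration.integral_cong refl)
      fix t
      have "iexp (- (t * y)) * (?w t * fourier F t * cnj (F y))
          = cnj (F y) * ((iexp (- (t * y)) * ?w t) * (LINT x|lborel. iexp (t * x) * F x))"
        by (simp add: fourier_def mult_ac)
      also have "(iexp (- (t * y)) * ?w t) * (LINT x|lborel. iexp (t * x) * F x)
          = (LINT x|lborel. (iexp (- (t * y)) * ?w t) * (iexp (t * x) * F x))"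
        by simp
      also have "\<dots> = (LINT x|lborel. iexp (t * (x - y)) * (?w t * F x))"
      proof (intro Bochner_Integration.integral_cong refl)
        fix x
        have "iexp (t * (x - y)) = iexp (- (t * y)) * iexp (t * x)"
          by (simp add: exp_add[symmetric] algebra_simps)
        then show "(iexp (- (t * y)) * ?w t) * (iexp (t * x) * F x) = iexp (t * (x - y)) * (?w t * F x)"
          by (simp only: mult_ac)
      qed
      finally show "iexp (- (t * y)) * (?w t * fourier F t * cnj (F y))
        = cnj (F y) * (LINT x|lborel. iexp (t * (x - y)) * (?w t * F x))" .
    qed
    also have "\<dots> = cnj (F y) * (LINT t|lborel. LINT x|lborel. iexp (t * (x - y)) * (?w t * F x))"
      by simp
    also have "(LINT t|lborel. LINT x|lborel. iexp (t * (x - y)) * (?w t * F x))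
        = (LINT x|lborel. LINT t|lborel. iexp (t * (x - y)) * (?w t * F x))"
    proof -
      have "integrable (lborel \<Otimes>\<^sub>M lborel)
        (\<lambda>(t, x). (\<lambda>(t, x). iexp (t * (x - y))) (t, x) * (?w t * F x))"
        by (rule integrable_tensor_bounded[OF w F, where B = 1])
           (measurable, simp add: split_beta del: of_real_diff of_real_mult)
      then show ?thesis
        by (intro lborel_pair.Fubini_integral[symmetric]) (simp add: split_beta)
    qed
    also have "\<dots> = (LINT x|lborel. of_real (gauss_kernel e (x - y)) * F x)"
    proof (intro Bochner_Integration.integral_cong refl)
      fix x
      have "(LINT t|lborel. iexp (t * (x - y)) * (?w t * F x))
          = (LINT t|lborel. (iexp (t * (x - y)) * ?w t) * F x)"
        by (simp only: mult.assoc)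
      also have "\<dots> = of_real (gauss_kernel e (x - y)) * F x"
        using fourier_dilated_normal[OF e, of "x - y"] by (simp only: integral_mult_left_zero)
      finally show "(LINT t|lborel. iexp (t * (x - y)) * (?w t * F x))
          = of_real (gauss_kernel e (x - y)) * F x" .
    qed
    also have "cnj (F y) * (LINT x|lborel. of_real (gauss_kernel e (x - y)) * F x)
        = (LINT x|lborel. cnj (F y) * (of_real (gauss_kernel e (x - y)) * F x))"
      by simp
    finally show "(LINT t|lborel. iexp (- (t * y)) * (?w t * fourier F t * cnj (F y)))
        = (LINT x|lborel. of_real (gauss_kernel e (x - y)) * (F x * cnj (F y)))"
      by (simp only: mult_ac)
  qed
  finally show ?thesis .
qed

text \<open>Holds for every f: a function that is not integrable has integral 0 by default. It can
  therefore be applied to iterated integrals without checking the inner ones.\<close>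

lemma ennreal_norm_integral_le:
  fixes f :: "'a \<Rightarrow> 'b::{banach, second_countable_topology}"
  shows "ennreal (norm (LINT x|M. f x)) \<le> (\<integral>\<^sup>+x. ennreal (norm (f x)) \<partial>M)"
  by (cases "integrable M f") (simp_all add: integral_norm_bound_ennreal not_integrable_integral_eq)

text \<open>Schur test: bound \<open>\<bar>F x\<bar> \<bar>F y\<bar>\<close> by half the sum of the squares and integrate out one variable.\<close>

lemma schur_gauss_kernel:
  assumes e: "0 < e" and [measurable]: "F \<in> borel_measurable borel"
  shows "(\<integral>\<^sup>+y. \<integral>\<^sup>+x. ennreal (gauss_kernel e (x - y) * (norm (F x) * norm (F y))) \<partial>lborel \<partial>lborel)
    \<le> ennreal (sqrt (2 * pi)) * (\<integral>\<^sup>+y. ennreal ((norm (F y))\<^sup>2) \<partial>lborel)"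
proof -
  let ?\<kappa> = "\<lambda>x y. ennreal (gauss_kernel e (x - y))"
  let ?q = "\<lambda>y. ennreal ((norm (F y))\<^sup>2 / 2)"
  note \<kappa> = gauss_kernel_nonneg[OF e]
  have sym: "?\<kappa> x y = ?\<kappa> y x" for x y
    by (simp add: gauss_kernel_def power2_commute power_divide)
  have mass: "(\<integral>\<^sup>+y. ?\<kappa> y x * c \<partial>lborel) = ennreal (sqrt (2 * pi)) * c" for x c
    by (simp add: nn_integral_multc nn_integral_gauss_kernel[OF e])
  have "(\<integral>\<^sup>+y. \<integral>\<^sup>+x. ennreal (gauss_kernel e (x - y) * (norm (F x) * norm (F y))) \<partial>lborel \<partial>lborel)
      \<le> (\<integral>\<^sup>+y. \<integral>\<^sup>+x. ?\<kappa> x y * ?q x + ?\<kappa> x y * ?q y \<partial>lborel \<partial>lborel)"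
  proof (intro nn_integral_mono)
    fix x y
    have "norm (F x) * norm (F y) \<le> (norm (F x))\<^sup>2 / 2 + (norm (F y))\<^sup>2 / 2"
      using sum_squares_bound[of "norm (F x)" "norm (F y)"] by simp
    from mult_left_mono[OF this \<kappa>, of "x - y"]
    show "ennreal (gauss_kernel e (x - y) * (norm (F x) * norm (F y))) \<le> ?\<kappa> x y * ?q x + ?\<kappa> x y * ?q y"
      by (simp add: ennreal_mult[symmetric] ennreal_plus[symmetric] \<kappa> distrib_left ennreal_leI del: ennreal_plus)
  qed
  also have "\<dots> = (\<integral>\<^sup>+y. \<integral>\<^sup>+x. ?\<kappa> x y * ?q x \<partial>lborel \<partial>lborel) + (\<integral>\<^sup>+y. \<integral>\<^sup>+x. ?\<kappa> x y * ?q y \<partial>lborel \<partial>lborel)"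
    by (simp add: nn_integral_add)
  also have "(\<integral>\<^sup>+y. \<integral>\<^sup>+x. ?\<kappa> x y * ?q x \<partial>lborel \<partial>lborel) = (\<integral>\<^sup>+x. \<integral>\<^sup>+y. ?\<kappa> y x * ?q x \<partial>lborel \<partial>lborel)"
    by (subst lborel_pair.Fubini') (auto simp: sym)
  also have "\<dots> + (\<integral>\<^sup>+y. \<integral>\<^sup>+x. ?\<kappa> x y * ?q y \<partial>lborel \<partial>lborel)
      = ennreal (sqrt (2 * pi)) * (\<integral>\<^sup>+y. ?q y \<partial>lborel) + ennreal (sqrt (2 * pi)) * (\<integral>\<^sup>+y. ?q y \<partial>lborel)"
    by (simp add: mass nn_integral_cmult)
  also have "\<dots> = ennreal (sqrt (2 * pi)) * (\<integral>\<^sup>+y. ?q y + ?q y \<partial>lborel)"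
    by (subst nn_integral_add) (simp_all add: distrib_left)
  also have "(\<integral>\<^sup>+y. ?q y + ?q y \<partial>lborel) = (\<integral>\<^sup>+y. ennreal ((norm (F y))\<^sup>2) \<partial>lborel)"
    by (intro nn_integral_cong) (simp add: ennreal_plus[symmetric] del: ennreal_plus)
  finally show ?thesis .
qed

text \<open>The weighted energies are bounded uniformly in e, so Fatou's lemma removes the weight.
  The constant 2 pi is sqrt (2 pi) from the mass of \<open>gauss_kernel\<close> times sqrt (2 pi)
  from the value 1 / sqrt (2 pi) of the weight at 0.\<close>

lemma nn_integral_fourier_square_le:
  assumes F: "integrable lborel F"
  shows "(\<integral>\<^sup>+t. ennreal ((norm (fourier F t))\<^sup>2) \<partial>lborel)
    \<le> ennreal (2 * pi) * (\<integral>\<^sup>+y. ennreal ((norm (F y))\<^sup>2) \<partial>lborel)"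
proof -
  have [measurable]: "F \<in> borel_measurable borel"
    using borel_measurable_integrable[OF F] by simp
  define J where "J = (\<integral>\<^sup>+y. ennreal ((norm (F y))\<^sup>2) \<partial>lborel)"
  have weighted: "(\<integral>\<^sup>+t. ennreal (std_normal_density (e * t) * (norm (fourier F t))\<^sup>2) \<partial>lborel)
      \<le> ennreal (sqrt (2 * pi)) * J" if e: "0 < e" for e
  proof -
    let ?g = "\<lambda>t. std_normal_density (e * t) * (norm (fourier F t))\<^sup>2"
    have g: "integrable lborel ?g"
    proof (rule Bochner_Integration.integrable_bound)
      show "integrable lborel (\<lambda>t. std_normal_density (e * t) * (LINT y|lborel. norm (F y))\<^sup>2)"
        using integrable_dilated_normal[OF e] by simp
      show "AE t in lborel. norm (?g t) \<le> norm (std_normal_density (e * t) * (LINT y|lborel. norm (F y))\<^sup>2)"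
        using norm_fourier_le[OF F] by (intro AE_I2) (simp add: abs_mult mult_left_mono power_mono)
    qed measurable
    have "(\<integral>\<^sup>+t. ennreal (?g t) \<partial>lborel) = ennreal (LINT t|lborel. ?g t)"
      using g by (intro nn_integral_eq_integral) auto
    also have "(LINT t|lborel. ?g t) = norm (complex_of_real (LINT t|lborel. ?g t))"
      by (simp add: integral_nonneg_AE)
    also have "complex_of_real (LINT t|lborel. ?g t) =
        (LINT y|lborel. LINT x|lborel. of_real (gauss_kernel e (x - y)) * (F x * cnj (F y)))"
      using weighted_energy_fourier[OF F e] by (simp only: integral_complex_of_real)
    also have "ennreal (norm \<dots>)
      \<le> (\<integral>\<^sup>+y. \<integral>\<^sup>+x. ennreal (norm (of_real (gauss_kernel e (x - y)) * (F x * cnj (F y)))) \<partial>lborel \<partial>lborel)"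
      by (intro order_trans[OF ennreal_norm_integral_le] nn_integral_mono ennreal_norm_integral_le)
    also have "\<dots> = (\<integral>\<^sup>+y. \<integral>\<^sup>+x. ennreal (gauss_kernel e (x - y) * (norm (F x) * norm (F y))) \<partial>lborel \<partial>lborel)"
      using gauss_kernel_nonneg[OF e] by (simp add: norm_mult)
    also have "\<dots> \<le> ennreal (sqrt (2 * pi)) * J"
      unfolding J_def by (intro schur_gauss_kernel e) measurable
    finally show ?thesis .
  qed
  let ?h = "\<lambda>n t. std_normal_density (inverse (real (Suc n)) * t) * (norm (fourier F t))\<^sup>2"
  have "(\<integral>\<^sup>+t. ennreal (1 / sqrt (2 * pi) * (norm (fourier F t))\<^sup>2) \<partial>lborel)
      = (\<integral>\<^sup>+t. liminf (\<lambda>n. ennreal (?h n t)) \<partial>lborel)"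
  proof (intro nn_integral_cong)
    fix t
    have "(\<lambda>n. ?h n t) \<longlonglongrightarrow> 1 / sqrt (2 * pi) * exp (- ((0 * t)\<^sup>2) / 2) * (norm (fourier F t))\<^sup>2"
      unfolding std_normal_density_def by (intro tendsto_intros LIMSEQ_inverse_real_of_nat) auto
    then have "(\<lambda>n. ?h n t) \<longlonglongrightarrow> 1 / sqrt (2 * pi) * (norm (fourier F t))\<^sup>2"
      by simp
    then have "(\<lambda>n. ennreal (?h n t)) \<longlonglongrightarrow> ennreal (1 / sqrt (2 * pi) * (norm (fourier F t))\<^sup>2)"
      by (rule tendsto_ennrealI)
    then show "ennreal (1 / sqrt (2 * pi) * (norm (fourier F t))\<^sup>2) = liminf (\<lambda>n. ennreal (?h n t))"
      by (intro lim_imp_Liminf[symmetric]) simp_all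
  qed
  also have "\<dots> \<le> liminf (\<lambda>n. \<integral>\<^sup>+t. ennreal (?h n t) \<partial>lborel)"
    by (intro nn_integral_liminf) measurable
  also have "\<dots> \<le> ennreal (sqrt (2 * pi)) * J"
    by (intro order_trans[OF Liminf_le_Limsup] Limsup_bounded always_eventually allI weighted) auto
  finally have le: "(\<integral>\<^sup>+t. ennreal (1 / sqrt (2 * pi) * (norm (fourier F t))\<^sup>2) \<partial>lborel)
      \<le> ennreal (sqrt (2 * pi)) * J" .
  have "(\<integral>\<^sup>+t. ennreal ((norm (fourier F t))\<^sup>2) \<partial>lborel)
      = (\<integral>\<^sup>+t. ennreal (sqrt (2 * pi)) * ennreal (1 / sqrt (2 * pi) * (norm (fourier F t))\<^sup>2) \<partial>lborel)"
    by (intro nn_integral_cong) (simp add: ennreal_mult[symmetric])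
  also have "\<dots> = ennreal (sqrt (2 * pi)) * (\<integral>\<^sup>+t. ennreal (1 / sqrt (2 * pi) * (norm (fourier F t))\<^sup>2) \<partial>lborel)"
    by (intro nn_integral_cmult) measurable
  also have "\<dots> \<le> ennreal (sqrt (2 * pi)) * (ennreal (sqrt (2 * pi)) * J)"
    by (intro mult_left_mono le) simp
  also have "\<dots> = ennreal (2 * pi) * J"
    by (simp add: mult.assoc[symmetric] ennreal_mult[symmetric])
  finally show ?thesis
    unfolding J_def .
qed

section \<open>Completeness of L2\<close>

text \<open>Riesz-Fischer with only differences in play: the f n need not be square integrable
  themselves. A subsequence with almost everywhere summable increments has a pointwise limit, and
  Fatou along this subsequence gives convergence of the full sequence.\<close>

lemma L2_complete:
  fixes f :: "nat \<Rightarrow> 'a \<Rightarrow> complex"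
  assumes [measurable]: "\<And>n. f n \<in> borel_measurable M"
    and cauchy: "\<And>e. 0 < e \<Longrightarrow> \<exists>N. \<forall>m\<ge>N. \<forall>n\<ge>N.
      (\<integral>\<^sup>+x. ennreal ((norm (f m x - f n x))\<^sup>2) \<partial>M) \<le> ennreal e"
  shows "\<exists>v \<in> borel_measurable M. (\<lambda>n. \<integral>\<^sup>+x. ennreal ((norm (v x - f n x))\<^sup>2) \<partial>M) \<longlonglongrightarrow> 0"
proof -
  \<comment> \<open>Squared distances of at most 8^-k leave the convergent series of 4^-k after
    multiplication by the weights 2^k below.\<close>
  have "\<exists>N. \<forall>m\<ge>N. \<forall>n\<ge>N. (\<integral>\<^sup>+x. ennreal ((norm (f m x - f n x))\<^sup>2) \<partial>M) \<le> ennreal ((1/8) ^ k)" for k :: nat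
    by (intro cauchy) simp
  then obtain N where N: "\<And>k m n. N k \<le> m \<Longrightarrow> N k \<le> n \<Longrightarrow>
      (\<integral>\<^sup>+x. ennreal ((norm (f m x - f n x))\<^sup>2) \<partial>M) \<le> ennreal ((1/8) ^ k)"
    by metis
  \<comment> \<open>Partial sums are monotone, so r k and r (Suc k) both lie beyond N k.\<close>
  define r where "r k = (\<Sum>j\<le>k. N j)" for k
  have Nr: "N j \<le> r k" if "j \<le> k" for j k
    unfolding r_def using that by (intro member_le_sum) auto
  define D where "D k x = (norm (f (r (Suc k)) x - f (r k) x))\<^sup>2" for k x
  have [measurable]: "D k \<in> borel_measurable M" for k
    unfolding D_def by measurable
  have "(\<integral>\<^sup>+x. (\<Sum>k. ennreal (2 ^ k * D k x)) \<partial>M) = (\<Sum>k. \<integral>\<^sup>+x. ennreal (2 ^ k * D k x) \<partial>M)"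
    by (intro nn_integral_suminf) measurable
  also have "\<dots> \<le> (\<Sum>k. ennreal ((1/4) ^ k))"
  proof (intro suminf_le allI)
    fix k
    have "(\<integral>\<^sup>+x. ennreal (2 ^ k * D k x) \<partial>M) = ennreal (2 ^ k) * (\<integral>\<^sup>+x. ennreal (D k x) \<partial>M)"
      by (simp add: ennreal_mult' nn_integral_cmult)
    also have "\<dots> \<le> ennreal (2 ^ k) * ennreal ((1/8) ^ k)"
      unfolding D_def by (intro mult_left_mono N Nr) auto
    also have "\<dots> = ennreal ((1/4) ^ k)"
      by (simp add: ennreal_mult[symmetric] power_mult_distrib[symmetric])
    finally show "(\<integral>\<^sup>+x. ennreal (2 ^ k * D k x) \<partial>M) \<le> ennreal ((1/4) ^ k)" .
  qed auto
  also have "\<dots> = ennreal (\<Sum>k. (1/4) ^ k)"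
    by (intro suminf_ennreal2) (auto intro: summable_geometric)
  finally have "(\<integral>\<^sup>+x. (\<Sum>k. ennreal (2 ^ k * D k x)) \<partial>M) \<noteq> \<infinity>"
    by (auto simp: top_unique)
  then have "AE x in M. (\<Sum>k. ennreal (2 ^ k * D k x)) \<noteq> \<infinity>"
    by (intro nn_integral_noteq_infinite) measurable
  then have conv: "AE x in M. convergent (\<lambda>k. f (r k) x)"
  proof eventually_elim
    case (elim x)
    have D0: "0 \<le> D k x" for k
      by (simp add: D_def)
    have s1: "summable (\<lambda>k. 2 ^ k * D k x)"
      using elim D0 by (intro summable_suminf_not_top) auto
    have s: "summable (\<lambda>k. f (r (Suc k)) x - f (r k) x)"
    proof (rule summable_comparison_test')
      show "summable (\<lambda>k. (1/2) ^ k + 2 ^ k * D k x)"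
        using s1 by (intro summable_add summable_geometric) auto
      fix k :: nat assume "0 \<le> k"
      let ?d = "norm (f (r (Suc k)) x - f (r k) x)"
      \<comment> \<open>Expanding this square bounds the increment itself by its weighted square
        plus a geometric term, so that summability of 2^k D k passes to absolute summability of the
        increments.\<close>
      have "0 \<le> (2 ^ k * ?d - 1)\<^sup>2 / 2 ^ k" by simp
      also have "\<dots> = 2 ^ k * D k x - 2 * ?d + (1/2) ^ k"
        by (simp add: D_def power2_eq_square field_simps)
      finally show "?d \<le> (1/2) ^ k + 2 ^ k * D k x"
        using norm_ge_zero[of "f (r (Suc k)) x - f (r k) x"] by linarith
    qed
    have "(\<lambda>n. f (r n) x) = (\<lambda>n. f (r 0) x + (\<Sum>k<n. f (r (Suc k)) x - f (r k) x))"
      by (simp add: sum_lessThan_telescope[of "\<lambda>k. f (r k) x"])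
    moreover have "convergent \<dots>"
      using s by (intro convergent_add convergent_const) (simp add: summable_iff_convergent)
    ultimately show ?case by simp
  qed
  define v where "v x = lim (\<lambda>k. f (r k) x)" for x
  have v [measurable]: "v \<in> borel_measurable M"
    unfolding v_def by measurable
  have lim: "AE x in M. (\<lambda>k. f (r k) x) \<longlonglongrightarrow> v x"
    using conv by eventually_elim (simp add: v_def convergent_LIMSEQ_iff)
  have bound: "(\<integral>\<^sup>+x. ennreal ((norm (v x - f n x))\<^sup>2) \<partial>M) \<le> ennreal ((1/8) ^ j)" if n: "N j \<le> n" for n j
  proof -
    have "(\<integral>\<^sup>+x. ennreal ((norm (v x - f n x))\<^sup>2) \<partial>M)
        = (\<integral>\<^sup>+x. liminf (\<lambda>k. ennreal ((norm (f (r k) x - f n x))\<^sup>2)) \<partial>M)"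
    proof (intro nn_integral_cong_AE)
      show "AE x in M. ennreal ((norm (v x - f n x))\<^sup>2) = liminf (\<lambda>k. ennreal ((norm (f (r k) x - f n x))\<^sup>2))"
        using lim
      proof eventually_elim
        case (elim x)
        have "(\<lambda>k. ennreal ((norm (f (r k) x - f n x))\<^sup>2)) \<longlonglongrightarrow> ennreal ((norm (v x - f n x))\<^sup>2)"
          by (intro tendsto_ennrealI tendsto_intros elim)
        then show ?case by (intro lim_imp_Liminf[symmetric]) simp_all
      qed
    qed
    also have "\<dots> \<le> liminf (\<lambda>k. \<integral>\<^sup>+x. ennreal ((norm (f (r k) x - f n x))\<^sup>2) \<partial>M)"
      by (intro nn_integral_liminf) measurable
    also have "\<dots> \<le> limsup (\<lambda>k. \<integral>\<^sup>+x. ennreal ((norm (f (r k) x - f n x))\<^sup>2) \<partial>M)"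
      by (intro Liminf_le_Limsup) simp
    also have "\<dots> \<le> ennreal ((1/8) ^ j)"
      using N[OF order_trans[OF Nr] n] Nr
      by (intro Limsup_bounded eventually_sequentiallyI[of j]) (simp add: N n)
    finally show ?thesis .
  qed
  have "(\<lambda>n. \<integral>\<^sup>+x. ennreal ((norm (v x - f n x))\<^sup>2) \<partial>M) \<longlonglongrightarrow> 0"
  proof (rule tendsto_0_if_Limsup_eq_0_ennreal)
    let ?L = "limsup (\<lambda>n. \<integral>\<^sup>+x. ennreal ((norm (v x - f n x))\<^sup>2) \<partial>M)"
    have "?L \<le> ennreal ((1/8) ^ j)" for j
      by (intro Limsup_bounded eventually_sequentiallyI[of "N j"] bound) simp
    moreover have "(\<lambda>j. ennreal ((1/8) ^ j)) \<longlonglongrightarrow> ennreal 0"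
      by (intro tendsto_ennrealI LIMSEQ_power_zero) simp
    ultimately have "?L \<le> ennreal 0"
      by (intro LIMSEQ_le_const[where X = "\<lambda>j. ennreal ((1/8) ^ j)"]) auto
    then show "?L = 0" by simp
  qed
  with v show ?thesis by blast
qed

section \<open>Functions determined by their integrals over intervals\<close>

text \<open>The positive and the negative part of h are densities of two measures that agree on
  half-open intervals, an intersection-stable generator, and hence agree everywhere. Since
  \<open>ennreal\<close> maps negative numbers to 0, \<open>ennreal (h x)\<close> and
  \<open>ennreal (- h x)\<close> are these parts, and they can coincide only when both are
  0.\<close>

lemma AE_eq_0_if_Ioc_integrals_eq_0_real:
  fixes h :: "real \<Rightarrow> real"
  assumes int: "\<And>a b. set_integrable lborel {a<..b} h"
    and zero: "\<And>a b. a \<le> b \<Longrightarrow> (LINT x:{a<..b}|lborel. h x) = 0"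
    and [measurable]: "h \<in> borel_measurable borel"
  shows "AE x in lborel. h x = 0"
proof -
  have parts: "emeasure (density lborel (\<lambda>x. ennreal (q x))) {a<..b} = ennreal (LINT x:{a<..b}|lborel. max 0 (q x))"
    if "set_integrable lborel {a<..b} q" and [measurable]: "q \<in> borel_measurable borel" for q :: "real \<Rightarrow> real" and a b
  proof -
    have "emeasure (density lborel (\<lambda>x. ennreal (q x))) {a<..b} = (\<integral>\<^sup>+x. ennreal (indicator {a<..b} x * max 0 (q x)) \<partial>lborel)"
      by (subst emeasure_density) (auto intro!: nn_integral_cong split: split_indicator simp: max_def ennreal_neg)
    also have "\<dots> = ennreal (LINT x|lborel. indicator {a<..b} x * max 0 (q x))"
    proof (intro nn_integral_eq_integral AE_I2)
      show "integrable lborel (\<lambda>x. indicator {a<..b} x * max 0 (q x))"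
        using that(1) unfolding set_integrable_def
        by (rule Bochner_Integration.integrable_bound) (auto split: split_indicator)
    qed simp
    finally show ?thesis by (simp add: set_lebesgue_integral_def)
  qed
  have "density lborel (\<lambda>x. ennreal (h x)) = density lborel (\<lambda>x. ennreal (- h x))"
  proof (rule measure_eqI_generator_eq[where E = "range (\<lambda>(a, b). {a <.. b::real})"
        and \<Omega> = UNIV and A = "\<lambda>n. {- real n <.. real n}"])
    show "Int_stable (range (\<lambda>(a, b). {a <.. b::real}))"
      by (auto simp: Int_stable_def)
    have sets: "sets borel = sigma_sets UNIV (range (\<lambda>(a, b). {a <.. b::real}))"
      by (subst borel_sigma_sets_Ioc) simp
    show "sets (density lborel (\<lambda>x. ennreal (h x))) = sigma_sets UNIV (range (\<lambda>(a, b). {a <.. b::real}))"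
      "sets (density lborel (\<lambda>x. ennreal (- h x))) = sigma_sets UNIV (range (\<lambda>(a, b). {a <.. b::real}))"
      by (simp_all add: sets)
    show "(\<Union>n. {- real n <.. real n}) = UNIV"
    proof safe
      fix x :: real
      obtain n where "\<bar>x\<bar> < real n" using reals_Archimedean2 by blast
      then show "x \<in> (\<Union>n. {- real n <.. real n})" by (auto intro!: exI[of _ n])
    qed simp
    show "emeasure (density lborel (\<lambda>x. ennreal (h x))) {- real n<..real n} \<noteq> \<infinity>" for n
      by (subst parts[OF int]) auto
    fix X assume "X \<in> range (\<lambda>(a, b). {a <.. b::real})"
    then obtain a b where X: "X = {a<..b}" by auto
    show "emeasure (density lborel (\<lambda>x. ennreal (h x))) X = emeasure (density lborel (\<lambda>x. ennreal (- h x))) X"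
    proof (cases "a \<le> b")
      case True
      have int': "set_integrable lborel {a<..b} (\<lambda>x. max 0 (h x))" "set_integrable lborel {a<..b} (\<lambda>x. max 0 (- h x))"
        using int[of a b] unfolding set_integrable_def
        by (rule Bochner_Integration.integrable_bound; auto split: split_indicator)+
      have "0 = (LINT x:{a<..b}|lborel. max 0 (h x) - max 0 (- h x))"
        using zero[OF True] by (simp add: max_def if_distrib cong: if_cong)
      also have "\<dots> = (LINT x:{a<..b}|lborel. max 0 (h x)) - (LINT x:{a<..b}|lborel. max 0 (- h x))"
        by (intro set_integral_diff int')
      finally show ?thesis
        using int[of a b] unfolding X
        by (subst (1 2) parts) (simp_all add: set_integrable_def)
    qed (simp add: X)
  qed auto
  then have "AE x in lborel. ennreal (h x) = ennreal (- h x)"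
    by (intro sigma_finite_measure.density_unique[OF sigma_finite_lborel]) auto
  then show ?thesis
    by eventually_elim (metis ennreal_eq_0_iff ennreal_inj linear neg_le_0_iff_le order_antisym)
qed

lemma AE_eq_0_if_Ioc_integrals_eq_0:
  fixes h :: "real \<Rightarrow> complex"
  assumes int: "\<And>a b. set_integrable lborel {a<..b} h"
    and zero: "\<And>a b. a \<le> b \<Longrightarrow> (LINT x:{a<..b}|lborel. h x) = 0"
    and [measurable]: "h \<in> borel_measurable borel"
  shows "AE x in lborel. h x = 0"
proof -
  have ind: "indicator A x *\<^sub>R Re z = Re (indicator A x *\<^sub>R z)" "indicator A x *\<^sub>R Im z = Im (indicator A x *\<^sub>R z)" for A and x :: real and z
    by simp_all
  have "AE x in lborel. Re (h x) = 0"
    using int zero by (intro AE_eq_0_if_Ioc_integrals_eq_0_real)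
      (simp_all add: set_integrable_def set_lebesgue_integral_def ind del: scaleR_complex.simps real_scaleR_def)
  moreover have "AE x in lborel. Im (h x) = 0"
    using int zero by (intro AE_eq_0_if_Ioc_integrals_eq_0_real)
      (simp_all add: set_integrable_def set_lebesgue_integral_def ind del: scaleR_complex.simps real_scaleR_def)
  ultimately show ?thesis
    by eventually_elim (simp add: complex_eq_iff)
qed

section \<open>Fourier inversion\<close>

text \<open>The factor in Levy's formula, written as the Fourier integral of an interval instead of
  a quotient. It has no exception at t = 0, is bounded by the length of the interval, and lends
  itself to Fubini.\<close>

definition box_kernel :: "real \<Rightarrow> real \<Rightarrow> real \<Rightarrow> complex" where
  "box_kernel a b t = (LINT x:{a<..b}|lborel. iexp (- (t * x)))"

lemma measurable_box_kernel [measurable]: "box_kernel a b \<in> borel_measurable borel"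
  unfolding box_kernel_def set_lebesgue_integral_def by measurable

lemma norm_box_kernel_le: "norm (box_kernel a b t) \<le> \<bar>b - a\<bar>"
proof -
  have "norm (box_kernel a b t) \<le> (LINT x|lborel. norm (indicator {a<..b} x *\<^sub>R iexp (- (t * x))))"
    unfolding box_kernel_def set_lebesgue_integral_def by (rule integral_norm_bound)
  also have "\<dots> = (LINT x|lborel. indicator {a<..b} x)"
    by (intro Bochner_Integration.integral_cong) auto
  also have "\<dots> \<le> \<bar>b - a\<bar>"
    by (cases "a \<le> b") auto
  finally show ?thesis .
qed

lemma box_kernel_eq:
  assumes "a \<le> b" "t \<noteq> 0"
  shows "box_kernel a b t = (iexp (- (t * a)) - iexp (- (t * b))) / (\<i> * t)"
proof -
  have "box_kernel a b t = (CLBINT x=a..b. iexp (- (t * x)))"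
    unfolding box_kernel_def using assms(1) by (simp add: interval_integral_Ioc)
  also have "\<dots> = (\<i> / t) * iexp (- (t * b)) - (\<i> / t) * iexp (- (t * a))"
    using assms(2)
    by (intro interval_integral_FTC_finite continuous_intros)
       (auto intro!: derivative_eq_intros has_vector_derivative_real_field continuous_intros
         simp: field_simps)
  also have "\<dots> = (iexp (- (t * a)) - iexp (- (t * b))) / (\<i> * t)"
    using assms(2) by (simp add: field_simps)
  finally show ?thesis .
qed

text \<open>Levy's formula as a property of a complex function. Being linear in f, it can be carried
  from probability densities to all integrable functions.\<close>

definition levy_inverts :: "(real \<Rightarrow> complex) \<Rightarrow> bool" where
  "levy_inverts f \<longleftrightarrow> (\<forall>a b. a \<le> b \<longrightarrow>
     (\<lambda>T. 1 / (2 * pi) * (LINT t:{-real T..real T}|lborel. box_kernel a b t * fourier f t))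
       \<longlonglongrightarrow> (LINT x:{a<..b}|lborel. f x))"

lemma set_integrable_box_kernel_fourier:
  assumes f: "integrable lborel f"
  shows "set_integrable lborel {-T..T} (\<lambda>t. box_kernel a b t * fourier f t)"
  unfolding set_integrable_def
proof (rule Bochner_Integration.integrable_bound)
  let ?C = "\<bar>b - a\<bar> * (LINT y|lborel. norm (f y))"
  have [measurable]: "f \<in> borel_measurable borel"
    using borel_measurable_integrable[OF f] by simp
  show "integrable lborel (\<lambda>t. indicator {-T..T} t *\<^sub>R ?C)"
    by (intro integrable_scaleR_left) (simp add: emeasure_lborel_Icc_eq)
  show "(\<lambda>t. indicator {-T..T} t *\<^sub>R (box_kernel a b t * fourier f t)) \<in> borel_measurable lborel"
    by measurable
  show "AE t in lborel. norm (indicator {-T..T} t *\<^sub>R (box_kernel a b t * fourier f t))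
      \<le> norm (indicator {-T..T} t *\<^sub>R ?C)"
    by (intro AE_I2) (auto simp: norm_mult abs_mult integral_nonneg_AE intro!: mult_mono norm_box_kernel_le norm_fourier_le f
        split: split_indicator)
qed

lemma levy_inverts_density:
  fixes p :: "real \<Rightarrow> real"
  assumes p: "integrable lborel p" "\<And>x. 0 \<le> p x" and one: "(LINT x|lborel. p x) = 1"
  shows "levy_inverts (\<lambda>x. of_real (p x))"
  unfolding levy_inverts_def
proof (intro allI impI)
  fix a b :: real assume ab: "a \<le> b"
  have [measurable]: "p \<in> borel_measurable borel"
    using borel_measurable_integrable[OF p(1)] by simp
  let ?M = "density lborel (\<lambda>x. ennreal (p x))"
  have nn: "(\<integral>\<^sup>+x. ennreal (p x) \<partial>lborel) = 1"
    using p one by (simp add: nn_integral_eq_integral)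
  interpret M: real_distribution ?M
    by (intro real_distribution.intro prob_spaceI real_distribution_axioms.intro)
       (simp_all add: emeasure_density nn)
  \<comment> \<open>A density has no atoms, so every end point is admissible in
    \<open>Levy_Inversion\<close>.\<close>
  have null: "measure ?M {x} = 0" for x
  proof -
    have "emeasure ?M {x} = 0"
    proof -
      have "(\<integral>\<^sup>+y. ennreal (p y) * indicator {x} y \<partial>lborel) = 0"
        using AE_lborel_singleton[of x] by (subst nn_integral_0_iff_AE) (auto elim!: eventually_mono)
      then show ?thesis by (simp add: emeasure_density)
    qed
    then show ?thesis by (simp add: measure_def)
  qed
  have char: "char ?M t = fourier (\<lambda>x. of_real (p x)) t" for t
    unfolding char_def fourier_def using p(2)
    by (subst integral_density) (auto simp: scaleR_conv_of_real mult.commute)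
  have meas: "complex_of_real (measure ?M {a<..b}) = (LINT x:{a<..b}|lborel. of_real (p x))"
  proof -
    have "integrable lborel (\<lambda>x. indicator {a<..b} x * p x)"
      using p(1) by (rule Bochner_Integration.integrable_bound) (auto split: split_indicator)
    then have "emeasure ?M {a<..b} = ennreal (LINT x|lborel. indicator {a<..b} x * p x)"
      using p(2) by (subst nn_integral_eq_integral[symmetric])
        (auto simp: emeasure_density intro!: nn_integral_cong split: split_indicator)
    then have "measure ?M {a<..b} = (LINT x|lborel. indicator {a<..b} x * p x)"
      using p(2) by (simp add: measure_def integral_nonneg_AE)
    also have "complex_of_real \<dots> = (LINT x|lborel. of_real (indicator {a<..b} x * p x))"
      by (rule integral_complex_of_real[symmetric])
    finally show ?thesis
      by (simp add: set_lebesgue_integral_def scaleR_conv_of_real)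
  qed
  have kernel: "(CLBINT t=-real T..real T. (iexp (- (t * a)) - iexp (- (t * b))) / (\<i> * t) * char ?M t)
      = (LINT t:{-real T..real T}|lborel. box_kernel a b t * fourier (\<lambda>x. of_real (p x)) t)" for T :: nat
  proof -
    have "(CLBINT t=-real T..real T. (iexp (- (t * a)) - iexp (- (t * b))) / (\<i> * t) * char ?M t)
        = (LINT t:{-real T..real T}|lborel. (iexp (- (t * a)) - iexp (- (t * b))) / (\<i> * t) * char ?M t)"
      using interval_integral_Icc[of "- real T" "real T"] by simp
    also have "\<dots> = (LINT t:{-real T..real T}|lborel. box_kernel a b t * fourier (\<lambda>x. of_real (p x)) t)"
    proof (rule set_lebesgue_integral_cong_AE)
      \<comment> \<open>At t = 0 the quotient is 0 by convention while \<open>box_kernel\<close> is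
        b - a; a single point does not affect the integral.\<close>
      show "AE t\<in>{-real T..real T} in lborel. (iexp (- (t * a)) - iexp (- (t * b))) / (\<i> * t) * char ?M t
          = box_kernel a b t * fourier (\<lambda>x. of_real (p x)) t"
        using AE_lborel_singleton[of 0] by eventually_elim (simp add: box_kernel_eq[OF ab] char)
    qed simp_all
    finally show ?thesis .
  qed
  show "(\<lambda>T. 1 / (2 * pi) * (LINT t:{-real T..real T}|lborel. box_kernel a b t * fourier (\<lambda>x. of_real (p x)) t))
       \<longlonglongrightarrow> (LINT x:{a<..b}|lborel. of_real (p x))"
    using M.Levy_Inversion[OF ab null null] kernel meas by simp
qed

lemma levy_inverts_linear:
  assumes f: "integrable lborel f" "levy_inverts f" and g: "integrable lborel g" "levy_inverts g"
  shows "levy_inverts (\<lambda>x. c * f x + d * g x)"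
  unfolding levy_inverts_def
proof (intro allI impI)
  fix a b :: real assume ab: "a \<le> b"
  have four: "fourier (\<lambda>x. c * f x + d * g x) t = c * fourier f t + d * fourier g t" for t
  proof -
    have "fourier (\<lambda>x. c * f x + d * g x) t
        = (LINT y|lborel. c * (iexp (t * y) * f y) + d * (iexp (t * y) * g y))"
      by (simp add: fourier_def algebra_simps)
    also have "\<dots> = c * fourier f t + d * fourier g t"
      unfolding fourier_def using integrable_fourier_integrand[OF f(1)] integrable_fourier_integrand[OF g(1)]
      by (subst Bochner_Integration.integral_add) auto
    finally show ?thesis .
  qed
  have si: "set_integrable lborel {a<..b} f" "set_integrable lborel {a<..b} g"
    using f(1) g(1) by (auto simp: set_integrable_def intro!: integrable_mult_indicator)
  have lhs: "(LINT t:{-real T..real T}|lborel. box_kernel a b t * fourier (\<lambda>x. c * f x + d * g x) t)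
      = c * (LINT t:{-real T..real T}|lborel. box_kernel a b t * fourier f t)
      + d * (LINT t:{-real T..real T}|lborel. box_kernel a b t * fourier g t)" for T
  proof -
    have "(LINT t:{-real T..real T}|lborel. box_kernel a b t * fourier (\<lambda>x. c * f x + d * g x) t)
      = (LINT t:{-real T..real T}|lborel. c * (box_kernel a b t * fourier f t) + d * (box_kernel a b t * fourier g t))"
      by (intro set_lebesgue_integral_cong) (auto simp: four algebra_simps)
    also have "\<dots> = (LINT t:{-real T..real T}|lborel. c * (box_kernel a b t * fourier f t))
       + (LINT t:{-real T..real T}|lborel. d * (box_kernel a b t * fourier g t))"
      by (intro set_integral_add set_integrable_mult_right set_integrable_box_kernel_fourier f g)
    finally show ?thesis by simp
  qed
  have rhs: "(LINT x:{a<..b}|lborel. c * f x + d * g x)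
     = c * (LINT x:{a<..b}|lborel. f x) + d * (LINT x:{a<..b}|lborel. g x)"
    using si by (subst set_integral_add) auto
  have "(\<lambda>T. c * (1 / (2 * pi) * (LINT t:{-real T..real T}|lborel. box_kernel a b t * fourier f t))
      + d * (1 / (2 * pi) * (LINT t:{-real T..real T}|lborel. box_kernel a b t * fourier g t)))
       \<longlonglongrightarrow> c * (LINT x:{a<..b}|lborel. f x) + d * (LINT x:{a<..b}|lborel. g x)"
    using f(2) g(2) ab unfolding levy_inverts_def by (intro tendsto_intros) auto
  then show "(\<lambda>T. 1 / (2 * pi) * (LINT t:{-real T..real T}|lborel. box_kernel a b t * fourier (\<lambda>x. c * f x + d * g x) t))
       \<longlonglongrightarrow> (LINT x:{a<..b}|lborel. c * f x + d * g x)"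
    unfolding lhs rhs by (simp add: distrib_left mult_ac)
qed

lemma levy_inverts_AE_0:
  assumes "AE x in lborel. f x = 0" and [measurable]: "f \<in> borel_measurable borel"
  shows "levy_inverts f"
proof -
  have "fourier f t = 0" for t
  proof -
    show ?thesis
      unfolding fourier_def by (intro integral_eq_zero_AE eventually_mono[OF assms(1)]) simp
  qed
  moreover have "(LINT x:{a<..b}|lborel. f x) = 0" for a b
  proof -
    show ?thesis
      unfolding set_lebesgue_integral_def by (intro integral_eq_zero_AE eventually_mono[OF assms(1)]) simp
  qed
  ultimately show ?thesis
    by (simp add: levy_inverts_def)
qed

text \<open>Dividing by the total mass gives a probability density. This fails only for mass 0, and
  then p vanishes almost everywhere.\<close>

lemma levy_inverts_nonneg:
  fixes p :: "real \<Rightarrow> real"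
  assumes p: "integrable lborel p" "\<And>x. 0 \<le> p x"
  shows "levy_inverts (\<lambda>x. of_real (p x))"
proof (cases "(LINT x|lborel. p x) = 0")
  case True
  have [measurable]: "p \<in> borel_measurable borel"
    using borel_measurable_integrable[OF p(1)] by simp
  from True have "AE x in lborel. p x = 0"
    using p by (simp add: integral_nonneg_eq_0_iff_AE)
  then show ?thesis
    by (intro levy_inverts_AE_0) auto
next
  case False
  define s where "s = (LINT x|lborel. p x)"
  have s: "s > 0"
    using False p(2) by (simp add: s_def order_less_le integral_nonneg_AE)
  have q: "levy_inverts (\<lambda>x. of_real (p x / s))"
    using s p by (intro levy_inverts_density) (auto simp: s_def[symmetric])
  have "levy_inverts (\<lambda>x. of_real s * of_real (p x / s) + 0 * of_real (p x / s))"
    using p by (intro levy_inverts_linear q) auto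
  then show ?thesis
    using s by simp
qed

text \<open>f is a linear combination of four nonnegative functions: the positive and negative parts
  of its real and imaginary part.\<close>

lemma levy_inverts_integrable:
  assumes f: "integrable lborel f"
  shows "levy_inverts f"
proof -
  let ?p = "\<lambda>h x. complex_of_real (max 0 (h x))"
  have p: "integrable lborel (?p h)" "levy_inverts (?p h)" if "integrable lborel h" for h :: "real \<Rightarrow> real"
    using that by (auto intro!: levy_inverts_nonneg)
  have re: "integrable lborel (\<lambda>x. Re (f x))" "integrable lborel (\<lambda>x. - Re (f x))"
    and im: "integrable lborel (\<lambda>x. Im (f x))" "integrable lborel (\<lambda>x. - Im (f x))"
    using f by auto
  let ?R = "\<lambda>x. 1 * ?p (\<lambda>x. Re (f x)) x + (-1) * ?p (\<lambda>x. - Re (f x)) x"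
  let ?I = "\<lambda>x. 1 * ?p (\<lambda>x. Im (f x)) x + (-1) * ?p (\<lambda>x. - Im (f x)) x"
  have "levy_inverts (\<lambda>x. 1 * ?R x + \<i> * ?I x)"
    using re im by (intro levy_inverts_linear p) auto
  moreover have "(\<lambda>x. 1 * ?R x + \<i> * ?I x) = f"
    by (auto simp: fun_eq_iff complex_eq_iff max_def)
  ultimately show ?thesis by simp
qed

section \<open>Truncated Fourier integrals and their L2 limit\<close>

definition trunc :: "real \<Rightarrow> (real \<Rightarrow> complex) \<Rightarrow> real \<Rightarrow> complex" where
  "trunc R F y = indicator {-R..R} y *\<^sub>R F y"

lemma measurable_trunc [measurable]:
  "F \<in> borel_measurable borel \<Longrightarrow> trunc R F \<in> borel_measurable borel"
  unfolding trunc_def by measurable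

abbreviation energy :: "(real \<Rightarrow> complex) \<Rightarrow> ennreal" where
  "energy F \<equiv> \<integral>\<^sup>+y. ennreal ((norm (F y))\<^sup>2) \<partial>lborel"

text \<open>The inequality (x + y)^2 \<le> 2 x^2 + 2 y^2 stands in for Minkowski and keeps square
  roots out of \<open>ennreal\<close>. Its factor 2 is the reason why 4 pi replaces 2 pi in later
  bounds.\<close>

lemma energy_triangle:
  assumes [measurable]: "F \<in> borel_measurable borel" "G \<in> borel_measurable borel"
  shows "energy (\<lambda>y. F y + G y) \<le> 2 * energy F + 2 * energy G"
proof -
  have "energy (\<lambda>y. F y + G y) \<le> (\<integral>\<^sup>+y. 2 * ennreal ((norm (F y))\<^sup>2) + 2 * ennreal ((norm (G y))\<^sup>2) \<partial>lborel)"
  proof (intro nn_integral_mono)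
    fix y
    have "(norm (F y + G y))\<^sup>2 \<le> (norm (F y) + norm (G y))\<^sup>2"
      by (intro power_mono norm_triangle_ineq) simp
    also have "\<dots> \<le> 2 * (norm (F y))\<^sup>2 + 2 * (norm (G y))\<^sup>2"
      using sum_squares_bound[of "norm (F y)" "norm (G y)"] by (simp add: power2_sum)
    finally have "ennreal ((norm (F y + G y))\<^sup>2) \<le> ennreal (2 * (norm (F y))\<^sup>2 + 2 * (norm (G y))\<^sup>2)"
      by (rule ennreal_leI)
    then show "ennreal ((norm (F y + G y))\<^sup>2) \<le> 2 * ennreal ((norm (F y))\<^sup>2) + 2 * ennreal ((norm (G y))\<^sup>2)"
      by (simp add: ennreal_mult')
  qed
  also have "\<dots> = 2 * energy F + 2 * energy G"
    by (simp add: nn_integral_add nn_integral_cmult)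
  finally show ?thesis .
qed

text \<open>On a bounded interval L2 is contained in L1, by norm z \<le> 1 + (norm z)^2. So the
  truncations have absolutely convergent Fourier integrals even if F has none.\<close>

lemma integrable_trunc:
  assumes [measurable]: "F \<in> borel_measurable borel" and "energy F < \<infinity>"
  shows "integrable lborel (trunc R F)"
proof (rule Bochner_Integration.integrable_bound)
  have "integrable lborel (\<lambda>y. (norm (F y))\<^sup>2)"
    using assms by (intro integrableI_nonneg) auto
  moreover have "integrable lborel (indicator {-R..R} :: real \<Rightarrow> real)"
    by (simp add: emeasure_lborel_Icc_eq)
  ultimately show "integrable lborel (\<lambda>y. indicator {-R..R} y + (norm (F y))\<^sup>2)"
    by (intro Bochner_Integration.integrable_add)
  show "trunc R F \<in> borel_measurable lborel" by measurable
  have "norm z \<le> 1 + (norm z)\<^sup>2" for z :: complex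
  proof -
    have "2 * norm z \<le> 1 + (norm z)\<^sup>2"
      using sum_squares_bound[of 1 "norm z"] by simp
    moreover have "0 \<le> norm z" by simp
    ultimately show ?thesis by linarith
  qed
  then show "AE y in lborel. norm (trunc R F y) \<le> norm (indicator {-R..R} y + (norm (F y))\<^sup>2)"
    by (intro AE_I2) (simp add: trunc_def split: split_indicator)
qed

lemma fourier_diff:
  assumes "integrable lborel F" "integrable lborel G"
  shows "fourier F t - fourier G t = fourier (\<lambda>y. F y - G y) t"
  unfolding fourier_def
  using integrable_fourier_integrand[OF assms(1), of t] integrable_fourier_integrand[OF assms(2), of t]
  by (simp add: algebra_simps flip: Bochner_Integration.integral_diff)

definition tail_energy :: "(real \<Rightarrow> complex) \<Rightarrow> real \<Rightarrow> ennreal" where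
  "tail_energy F R = energy (\<lambda>y. indicator {y. R < \<bar>y\<bar>} y *\<^sub>R F y)"

lemma tail_energy_tendsto_0:
  assumes [measurable]: "F \<in> borel_measurable borel" and "energy F < \<infinity>"
  shows "(tail_energy F \<longlongrightarrow> 0) at_top"
proof -
  have int: "integrable lborel (\<lambda>y. (norm (F y))\<^sup>2)"
    using assms by (intro integrableI_nonneg) auto
  let ?f = "\<lambda>R y. (norm (indicator {y. R < \<bar>y\<bar>} y *\<^sub>R F y))\<^sup>2"
  have eq: "tail_energy F R = ennreal (LINT y|lborel. ?f R y)" for R
    unfolding tail_energy_def using int
    by (intro nn_integral_eq_integral Bochner_Integration.integrable_bound[OF int])
       (auto split: split_indicator)
  have "((\<lambda>R. LINT y|lborel. ?f R y) \<longlongrightarrow> (LINT (y::real)|lborel. 0)) at_top"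
  proof (rule integral_dominated_convergence_at_top)
    show "integrable lborel (\<lambda>y. (norm (F y))\<^sup>2)" by fact
    show "\<forall>\<^sub>F R in at_top. AE y in lborel. norm (?f R y) \<le> (norm (F y))\<^sup>2"
      by (auto split: split_indicator)
    show "AE y in lborel. ((\<lambda>R. ?f R y) \<longlongrightarrow> 0) at_top"
    proof (intro AE_I2 tendsto_eventually)
      fix y show "\<forall>\<^sub>F R in at_top. ?f R y = 0"
        using eventually_ge_at_top[of "\<bar>y\<bar>"] by eventually_elim auto
    qed
  qed measurable
  then have "((\<lambda>R. ennreal (LINT y|lborel. ?f R y)) \<longlongrightarrow> ennreal 0) at_top"
    by (intro tendsto_ennrealI) simp
  then show ?thesis
    by (simp add: eq[abs_def])
qed

lemma energy_fourier_trunc_diff: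
  assumes [measurable]: "F \<in> borel_measurable borel" and fin: "energy F < \<infinity>"
    and "R \<le> S" "R \<le> S'"
  shows "energy (\<lambda>t. fourier (trunc S F) t - fourier (trunc S' F) t) \<le> ennreal (2 * pi) * tail_energy F R"
proof -
  have "energy (\<lambda>t. fourier (trunc S F) t - fourier (trunc S' F) t)
      \<le> ennreal (2 * pi) * energy (\<lambda>y. trunc S F y - trunc S' F y)"
    by (simp only: fourier_diff[OF integrable_trunc integrable_trunc] assms)
       (intro nn_integral_fourier_square_le Bochner_Integration.integrable_diff integrable_trunc assms)
  also have "energy (\<lambda>y. trunc S F y - trunc S' F y) \<le> tail_energy F R"
    unfolding tail_energy_def using assms(3,4)
    by (intro nn_integral_mono ennreal_leI power_mono) (auto simp: trunc_def split: split_indicator)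
  finally show ?thesis by (simp add: mult_left_mono)
qed

text \<open>By the L2 bound the truncated integrals at integer cut-offs form a Cauchy sequence,
  controlled by \<open>tail_energy\<close>. Completeness yields z along integers;
  \<open>is_L2_inversion\<close>, however, lets R run through the reals.\<close>

lemma ex_L2_fourier_limit:
  assumes [measurable]: "F \<in> borel_measurable borel" and fin: "energy F < \<infinity>"
  shows "\<exists>z \<in> borel_measurable borel. ((\<lambda>R. energy (\<lambda>t. z t - fourier (trunc R F) t)) \<longlongrightarrow> 0) at_top"
proof -
  let ?f = "\<lambda>n t. fourier (trunc (real n) F) t"
  have lim: "((\<lambda>R. ennreal c * tail_energy F R) \<longlongrightarrow> 0) at_top" for c
    using ennreal_tendsto_cmult[OF _ tail_energy_tendsto_0[OF assms], of "ennreal c"] by simp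
  have "\<exists>z \<in> borel_measurable lborel. (\<lambda>n. energy (\<lambda>t. z t - ?f n t)) \<longlonglongrightarrow> 0"
  proof (rule L2_complete)
    fix e :: real assume "0 < e"
    then have "\<forall>\<^sub>F R in at_top. ennreal (2 * pi) * tail_energy F R < ennreal e"
      by (intro order_tendstoD(2)[OF lim]) simp
    then obtain R where R: "\<And>S. R \<le> S \<Longrightarrow> ennreal (2 * pi) * tail_energy F S < ennreal e"
      unfolding eventually_at_top_linorder by auto
    obtain N where N: "R \<le> real N" using real_arch_simple by blast
    show "\<exists>N. \<forall>m\<ge>N. \<forall>n\<ge>N. energy (\<lambda>t. ?f m t - ?f n t) \<le> ennreal e"
    proof (intro exI[of _ N] allI impI)
      fix m n assume "N \<le> m" "N \<le> n"
      then have "energy (\<lambda>t. ?f m t - ?f n t) \<le> ennreal (2 * pi) * tail_energy F (real N)"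
        by (intro energy_fourier_trunc_diff assms) auto
      also have "\<dots> \<le> ennreal e" using R[OF N] by simp
      finally show "energy (\<lambda>t. ?f m t - ?f n t) \<le> ennreal e" .
    qed
  qed measurable
  then obtain z where z [measurable]: "z \<in> borel_measurable borel" and zlim: "(\<lambda>n. energy (\<lambda>t. z t - ?f n t)) \<longlonglongrightarrow> 0"
    by auto
  \<comment> \<open>Insert an integer cut-off n \<ge> R and let n tend to infinity: the distance
    from z to the integer truncation vanishes, and the rest is bounded independently of n.\<close>
  have bound: "energy (\<lambda>t. z t - fourier (trunc R F) t) \<le> ennreal (4 * pi) * tail_energy F R" for R
  proof -
    let ?b = "\<lambda>n. 2 * energy (\<lambda>t. z t - ?f n t) + 2 * (ennreal (2 * pi) * tail_energy F R)"
    have ev: "\<forall>\<^sub>F n in sequentially. energy (\<lambda>t. z t - fourier (trunc R F) t) \<le> ?b n"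
    proof -
      obtain N where N: "R \<le> real N" using real_arch_simple by blast
      show ?thesis
      proof (intro eventually_sequentiallyI[of N])
        fix n assume "N \<le> n"
        then have n: "R \<le> real n" using N by linarith
        have "energy (\<lambda>t. z t - fourier (trunc R F) t)
            = energy (\<lambda>t. (z t - ?f n t) + (?f n t - fourier (trunc R F) t))"
          by simp
        also have "\<dots> \<le> 2 * energy (\<lambda>t. z t - ?f n t) + 2 * energy (\<lambda>t. ?f n t - fourier (trunc R F) t)"
          by (intro energy_triangle) measurable
        also have "\<dots> \<le> ?b n"
          by (intro add_left_mono mult_left_mono energy_fourier_trunc_diff assms n) auto
        finally show "energy (\<lambda>t. z t - fourier (trunc R F) t) \<le> ?b n" .
      qed
    qed
    have "?b \<longlonglongrightarrow> 2 * 0 + 2 * (ennreal (2 * pi) * tail_energy F R)"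
      by (intro tendsto_add ennreal_tendsto_cmult zlim tendsto_const) simp
    from tendsto_lowerbound[OF this ev]
    have "energy (\<lambda>t. z t - fourier (trunc R F) t) \<le> 2 * (ennreal (2 * pi) * tail_energy F R)"
      by simp
    also have "\<dots> = ennreal (4 * pi) * tail_energy F R"
      using ennreal_mult[of 2 "2 * pi"] by (simp add: mult.assoc[symmetric])
    finally show ?thesis .
  qed
  have "((\<lambda>R. energy (\<lambda>t. z t - fourier (trunc R F) t)) \<longlongrightarrow> 0) at_top"
    by (rule tendsto_sandwich[OF _ _ tendsto_const lim[of "4 * pi"]]) (simp_all add: bound)
  with z show ?thesis by blast
qed

text \<open>The bound survives the passage to the limit at the cost of the factor 2 of
  \<open>energy_triangle\<close>; the constant only enters statements of finiteness and of
  convergence to 0.\<close>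

lemma energy_L2_fourier_limit_le:
  assumes [measurable]: "F \<in> borel_measurable borel" "z \<in> borel_measurable borel" and fin: "energy F < \<infinity>"
    and lim: "((\<lambda>R. energy (\<lambda>t. z t - fourier (trunc R F) t)) \<longlongrightarrow> 0) at_top"
  shows "energy z \<le> ennreal (4 * pi) * energy F"
proof -
  let ?b = "\<lambda>R. 2 * energy (\<lambda>t. z t - fourier (trunc R F) t) + 2 * (ennreal (2 * pi) * energy F)"
  have "energy z \<le> ?b R" for R
  proof -
    have "energy z = energy (\<lambda>t. (z t - fourier (trunc R F) t) + fourier (trunc R F) t)"
      by simp
    also have "\<dots> \<le> 2 * energy (\<lambda>t. z t - fourier (trunc R F) t) + 2 * energy (fourier (trunc R F))"
      by (intro energy_triangle) measurable
    also have "energy (fourier (trunc R F)) \<le> ennreal (2 * pi) * energy (trunc R F)"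
      by (intro nn_integral_fourier_square_le integrable_trunc assms)
    also have "energy (trunc R F) \<le> energy F"
      by (intro nn_integral_mono ennreal_leI power_mono) (auto simp: trunc_def split: split_indicator)
    finally show ?thesis by (simp add: add_left_mono mult_left_mono)
  qed
  moreover have "(?b \<longlongrightarrow> 2 * 0 + 2 * (ennreal (2 * pi) * energy F)) at_top"
    by (intro tendsto_add ennreal_tendsto_cmult lim tendsto_const) simp
  ultimately have "energy z \<le> 2 * 0 + 2 * (ennreal (2 * pi) * energy F)"
    by (intro tendsto_lowerbound[of ?b _ at_top]) auto
  then show ?thesis
    using ennreal_mult[of 2 "2 * pi"] by (simp add: mult.assoc[symmetric])
qed


section \<open>Fourier inversion for integrable and for square integrable functions\<close>

text \<open>By Fubini, Levy's truncated integral against \<open>box_kernel\<close> is the integral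
  over the interval of a truncated inverse transform. The argument - y is the one under which
  Laplace transforms on the line appear.\<close>

lemma levy_fourier_trunc:
  assumes f: "integrable lborel f" and "a \<le> b"
  shows "(\<lambda>n. LINT x:{a<..b}|lborel. fourier (trunc (real n) (\<lambda>y. fourier f (- y))) x)
    \<longlonglongrightarrow> 2 * of_real pi * (LINT x:{a<..b}|lborel. f x)"
proof -
  have [measurable]: "f \<in> borel_measurable borel"
    using borel_measurable_integrable[OF f] by simp
  let ?F = "\<lambda>y. fourier f (- y)"
  have eq: "(LINT t:{-R..R}|lborel. box_kernel a b t * fourier f t)
      = (LINT x:{a<..b}|lborel. fourier (trunc R ?F) x)" for R
  proof -
    have int: "integrable lborel (trunc R ?F)"
    proof (rule Bochner_Integration.integrable_bound)
      show "integrable lborel (\<lambda>y. indicator {-R..R} y *\<^sub>R (LINT y|lborel. norm (f y)))"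
        by (intro integrable_scaleR_left) (simp add: emeasure_lborel_Icc_eq)
      show "AE y in lborel. norm (trunc R ?F y) \<le> norm (indicator {-R..R} y *\<^sub>R (LINT y|lborel. norm (f y)))"
        by (intro AE_I2) (auto simp: trunc_def integral_nonneg_AE intro!: norm_fourier_le f split: split_indicator)
    qed measurable
    have ind: "integrable lborel (\<lambda>x. complex_of_real (indicator {a<..b} x))"
      using \<open>a \<le> b\<close> by (intro integrable_of_real) simp
    have "integrable (lborel \<Otimes>\<^sub>M lborel)
        (\<lambda>(t, x). (\<lambda>(t, x). iexp (x * t)) (t, x) * (trunc R ?F t * of_real (indicator {a<..b} x)))"
      by (rule integrable_tensor_bounded[OF int ind, where B = 1]) (measurable, auto simp: split_beta)
    then have fub: "(LINT x|lborel. LINT t|lborel. iexp (x * t) * (trunc R ?F t * of_real (indicator {a<..b} x)))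
        = (LINT t|lborel. LINT x|lborel. iexp (x * t) * (trunc R ?F t * of_real (indicator {a<..b} x)))"
      by (intro lborel_pair.Fubini_integral) (simp add: split_beta)
    \<comment> \<open>The reflection of t preserves the symmetric range, produces \<open>?F\<close>,
      and reverses the sign of the phase in \<open>box_kernel\<close>.\<close>
    have "(LINT t:{-R..R}|lborel. box_kernel a b t * fourier f t)
        = \<bar>-1\<bar> *\<^sub>R (LINT t|lborel. indicator {-R..R} (0 + -1 * t) *\<^sub>R (box_kernel a b (0 + -1 * t) * fourier f (0 + -1 * t)))"
      unfolding set_lebesgue_integral_def by (rule lborel_integral_real_affine) simp
    also have "\<dots> = (LINT t|lborel. box_kernel a b (- t) * trunc R ?F t)"
      by (auto intro!: Bochner_Integration.integral_cong simp: trunc_def split: split_indicator)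
    also have "\<dots> = (LINT t|lborel. LINT x|lborel. iexp (x * t) * (trunc R ?F t * of_real (indicator {a<..b} x)))"
    proof (rule Bochner_Integration.integral_cong[OF refl])
      fix t
      have "box_kernel a b (- t) * trunc R ?F t
          = (LINT x|lborel. (indicator {a<..b} x *\<^sub>R iexp (- (- t * x))) * trunc R ?F t)"
        unfolding box_kernel_def set_lebesgue_integral_def by (rule integral_mult_left_zero[symmetric])
      also have "\<dots> = (LINT x|lborel. iexp (x * t) * (trunc R ?F t * of_real (indicator {a<..b} x)))"
        by (simp add: scaleR_conv_of_real mult_ac)
      finally show "box_kernel a b (- t) * trunc R ?F t
          = (LINT x|lborel. iexp (x * t) * (trunc R ?F t * of_real (indicator {a<..b} x)))" .
    qed
    also have "\<dots> = (LINT x|lborel. LINT t|lborel. iexp (x * t) * (trunc R ?F t * of_real (indicator {a<..b} x)))"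
      by (rule fub[symmetric])
    also have "\<dots> = (LINT x:{a<..b}|lborel. fourier (trunc R ?F) x)"
      unfolding set_lebesgue_integral_def
    proof (rule Bochner_Integration.integral_cong[OF refl])
      fix x
      have "(LINT t|lborel. iexp (x * t) * (trunc R ?F t * of_real (indicator {a<..b} x)))
          = (LINT t|lborel. (iexp (x * t) * trunc R ?F t) * of_real (indicator {a<..b} x))"
        by (simp only: mult.assoc)
      also have "\<dots> = fourier (trunc R ?F) x * of_real (indicator {a<..b} x)"
        unfolding fourier_def by (rule integral_mult_left_zero)
      finally show "(LINT t|lborel. iexp (x * t) * (trunc R ?F t * of_real (indicator {a<..b} x)))
          = indicator {a<..b} x *\<^sub>R fourier (trunc R ?F) x"
        by (simp add: scaleR_conv_of_real mult.commute)
    qed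
    finally show ?thesis .
  qed
  have "(\<lambda>n. 1 / (2 * pi) * (LINT x:{a<..b}|lborel. fourier (trunc (real n) ?F) x))
       \<longlonglongrightarrow> (LINT x:{a<..b}|lborel. f x)"
    using levy_inverts_integrable[OF f, unfolded levy_inverts_def, rule_format, OF \<open>a \<le> b\<close>]
    by (simp only: eq)
  from tendsto_mult[OF tendsto_const[of "2 * of_real pi"] this]
  show ?thesis by simp
qed

lemma set_integrable_Ioc_if_energy_finite:
  assumes [measurable]: "z \<in> borel_measurable borel" and "energy z < \<infinity>"
  shows "set_integrable lborel {a<..b} z"
proof -
  have "integrable lborel (trunc (max \<bar>a\<bar> \<bar>b\<bar>) z)"
    by (intro integrable_trunc assms)
  then have "set_integrable lborel {- max \<bar>a\<bar> \<bar>b\<bar>..max \<bar>a\<bar> \<bar>b\<bar>} z"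
    by (simp add: set_integrable_def trunc_def[abs_def])
  then show ?thesis
    by (rule set_integrable_subset) auto
qed

text \<open>In place of Cauchy-Schwarz on a bounded interval, the elementary bound
  \<open>?d \<le> s + ?d\<^sup>2 / s\<close> is integrated with a free parameter s > 0.\<close>

lemma Ioc_integral_tendsto_if_energy_tendsto:
  fixes z :: "real \<Rightarrow> complex"
  assumes [measurable]: "z \<in> borel_measurable borel" "\<And>n. g n \<in> borel_measurable borel"
    and fin: "energy z < \<infinity>" "\<And>n. energy (g n) < \<infinity>"
    and lim: "(\<lambda>n. energy (\<lambda>t. z t - g n t)) \<longlonglongrightarrow> 0"
  shows "(\<lambda>n. LINT x:{a<..b}|lborel. g n x) \<longlonglongrightarrow> (LINT x:{a<..b}|lborel. z x)"
proof (rule LIMSEQ_I)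
  fix e :: real assume e: "0 < e"
  \<comment> \<open>With this s the constant term integrates to at most e / 2; the threshold s e / 4
    below makes the quadratic term at most e / 4. The summand 1 avoids a division by 0 when a =
    b.\<close>
  define s where "s = e / (2 * (\<bar>b - a\<bar> + 1))"
  have s: "0 < s"
    unfolding s_def using e by (intro divide_pos_pos mult_pos_pos add_nonneg_pos) auto
  have "s * (\<bar>b - a\<bar> + 1) = e / 2"
    unfolding s_def by (simp add: add_nonneg_eq_0_iff field_simps)
  with s have sb: "s * \<bar>b - a\<bar> \<le> e / 2"
    by (simp add: distrib_left)
  have "\<forall>\<^sub>F n in sequentially. energy (\<lambda>t. z t - g n t) < ennreal (s * e / 4)"
    using e s by (intro order_tendstoD(2)[OF lim]) simp
  then obtain N where N: "\<And>n. N \<le> n \<Longrightarrow> energy (\<lambda>t. z t - g n t) < ennreal (s * e / 4)"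
    unfolding eventually_sequentially by auto
  show "\<exists>no. \<forall>n\<ge>no. norm ((LINT x:{a<..b}|lborel. g n x) - (LINT x:{a<..b}|lborel. z x)) < e"
  proof (intro exI[of _ N] allI impI)
    fix n assume n: "N \<le> n"
    have si: "set_integrable lborel {a<..b} z" "set_integrable lborel {a<..b} (g n)"
      using fin by (auto intro!: set_integrable_Ioc_if_energy_finite)
    have "ennreal (norm ((LINT x:{a<..b}|lborel. g n x) - (LINT x:{a<..b}|lborel. z x)))
        = ennreal (norm (LINT x:{a<..b}|lborel. z x - g n x))"
      using si by (simp add: norm_minus_commute)
    also have "\<dots> \<le> (\<integral>\<^sup>+x. ennreal (norm (indicator {a<..b} x *\<^sub>R (z x - g n x))) \<partial>lborel)"
      unfolding set_lebesgue_integral_def by (rule ennreal_norm_integral_le)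
    also have "\<dots> \<le> (\<integral>\<^sup>+x. ennreal s * indicator {a<..b} x + ennreal (1 / s) * ennreal ((norm (z x - g n x))\<^sup>2) \<partial>lborel)"
    proof (intro nn_integral_mono)
      fix x
      let ?d = "norm (z x - g n x)"
      have "2 * (?d * s) \<le> ?d\<^sup>2 + s * s"
        using sum_squares_bound[of ?d s] by (simp add: power2_eq_square)
      moreover have "0 \<le> ?d * s"
        using s by simp
      ultimately have "?d * s \<le> s * s + ?d\<^sup>2"
        by linarith
      then have "?d \<le> s + 1 / s * ?d\<^sup>2"
        using s by (simp add: field_simps)
      moreover have "ennreal s + ennreal (1 / s) * ennreal (?d\<^sup>2) = ennreal (s + 1 / s * ?d\<^sup>2)"
        using s by (simp add: ennreal_mult[symmetric] ennreal_plus[symmetric] del: ennreal_plus)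
      ultimately show "ennreal (norm (indicator {a<..b} x *\<^sub>R (z x - g n x)))
          \<le> ennreal s * indicator {a<..b} x + ennreal (1 / s) * ennreal (?d\<^sup>2)"
        by (auto intro!: ennreal_leI split: split_indicator)
    qed
    also have "\<dots> = ennreal s * emeasure lborel {a<..b} + ennreal (1 / s) * energy (\<lambda>t. z t - g n t)"
      by (simp add: nn_integral_add nn_integral_cmult)
    also have "\<dots> \<le> ennreal (s * \<bar>b - a\<bar>) + ennreal (1 / s) * energy (\<lambda>t. z t - g n t)"
      using s by (intro add_right_mono) (cases "a \<le> b"; simp add: ennreal_mult')
    also have "\<dots> \<le> ennreal (e / 2) + ennreal (1 / s) * ennreal (s * e / 4)"
      using sb N[OF n] by (intro add_mono mult_left_mono ennreal_leI) auto
    also have "\<dots> = ennreal (3 / 4 * e)"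
      using s e by (simp add: ennreal_mult[symmetric] ennreal_plus[symmetric] del: ennreal_plus)
    finally have "norm ((LINT x:{a<..b}|lborel. g n x) - (LINT x:{a<..b}|lborel. z x)) \<le> 3 / 4 * e"
      using e by (subst (asm) ennreal_le_iff) auto
    then show "norm ((LINT x:{a<..b}|lborel. g n x) - (LINT x:{a<..b}|lborel. z x)) < e"
      using e by linarith
  qed
qed

text \<open>The common end of both inversion theorems: Levy's formula identifies the same limit as 2
  pi times the integral of f, so z and 2 pi f have equal integrals over all intervals.\<close>

lemma AE_eq_if_Ioc_limits:
  assumes f: "integrable lborel f" and [measurable]: "z \<in> borel_measurable borel"
    and z: "\<And>a b. set_integrable lborel {a<..b} z"
    and lim: "\<And>a b. a \<le> b \<Longrightarrow> (\<lambda>n. LINT x:{a<..b}|lborel. fourier (trunc (real n) (\<lambda>y. fourier f (- y))) x)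
       \<longlonglongrightarrow> (LINT x:{a<..b}|lborel. z x)"
  shows "AE x in lborel. z x = 2 * of_real pi * f x"
proof -
  have [measurable]: "f \<in> borel_measurable borel"
    using borel_measurable_integrable[OF f] by simp
  have fi: "set_integrable lborel {a<..b} (\<lambda>x. 2 * of_real pi * f x)" for a b
    using f by (auto simp: set_integrable_def intro!: integrable_mult_indicator)
  have "AE x in lborel. z x - 2 * of_real pi * f x = 0"
  proof (rule AE_eq_0_if_Ioc_integrals_eq_0)
    fix a b :: real
    show "set_integrable lborel {a<..b} (\<lambda>x. z x - 2 * of_real pi * f x)"
      by (intro set_integral_diff z fi)
    assume ab: "a \<le> b"
    have "(LINT x:{a<..b}|lborel. z x) = 2 * of_real pi * (LINT x:{a<..b}|lborel. f x)"
      by (rule LIMSEQ_unique[OF lim[OF ab] levy_fourier_trunc[OF f ab]])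
    then show "(LINT x:{a<..b}|lborel. z x - 2 * of_real pi * f x) = 0"
      using z fi by (subst set_integral_diff) auto
  qed measurable
  then show ?thesis by simp
qed

text \<open>With an integrable transform the truncated integrals converge pointwise, bounded by its
  L1 norm; dominated convergence on each interval then gives the limit required by
  \<open>AE_eq_if_Ioc_limits\<close>.\<close>

lemma fourier_inversion_L1:
  assumes f: "integrable lborel f" and F: "integrable lborel (\<lambda>y. fourier f (- y))"
  shows "AE x in lborel. fourier (\<lambda>y. fourier f (- y)) x = 2 * of_real pi * f x"
proof (rule AE_eq_if_Ioc_limits[OF f])
  let ?F = "\<lambda>y. fourier f (- y)"
  have [measurable]: "f \<in> borel_measurable borel" "?F \<in> borel_measurable borel"
    using borel_measurable_integrable[OF f] borel_measurable_integrable[OF F] by simp_all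
  show "fourier ?F \<in> borel_measurable borel" by measurable
  let ?C = "LINT y|lborel. norm (?F y)"
  have C: "integrable lborel (\<lambda>x. indicator {a<..b} x *\<^sub>R ?C)" for a b :: real
    by (intro integrable_scaleR_left) (cases "a \<le> b"; simp)
  have tr: "integrable lborel (trunc R ?F)" for R
    using F by (rule Bochner_Integration.integrable_bound) (auto simp: trunc_def split: split_indicator)
  have bd: "norm (fourier (trunc R ?F) x) \<le> ?C" for R x
  proof -
    have "norm (fourier (trunc R ?F) x) \<le> (LINT y|lborel. norm (trunc R ?F y))"
      by (intro norm_fourier_le tr)
    also have "\<dots> \<le> ?C"
      by (intro integral_mono integrable_norm tr F) (auto simp: trunc_def split: split_indicator)
    finally show ?thesis .
  qed
  fix a b :: real
  show "set_integrable lborel {a<..b} (fourier ?F)"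
    unfolding set_integrable_def
    by (rule Bochner_Integration.integrable_bound[OF C[of a b]])
       (auto intro!: AE_I2 norm_fourier_le F simp: integral_nonneg_AE split: split_indicator)
  show "(\<lambda>n. LINT x:{a<..b}|lborel. fourier (trunc (real n) ?F) x)
       \<longlonglongrightarrow> (LINT x:{a<..b}|lborel. fourier ?F x)"
    unfolding set_lebesgue_integral_def
  proof (rule integral_dominated_convergence[OF _ _ C[of a b]])
    show "AE x in lborel. norm (indicator {a<..b} x *\<^sub>R fourier (trunc (real n) ?F) x)
        \<le> indicator {a<..b} x *\<^sub>R ?C" for n
      by (intro AE_I2) (auto intro!: bd split: split_indicator)
    have "(\<lambda>n. fourier (trunc (real n) ?F) x) \<longlonglongrightarrow> fourier ?F x" for x
      unfolding fourier_def[of "trunc R F" for R F] fourier_def[of ?F]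
    proof (rule integral_dominated_convergence)
      show "integrable lborel (\<lambda>y. norm (?F y))" using F by simp
      show "AE y in lborel. norm (iexp (x * y) * trunc (real n) ?F y) \<le> norm (?F y)" for n
        by (intro AE_I2) (auto simp: trunc_def norm_mult split: split_indicator)
      show "AE y in lborel. (\<lambda>n. iexp (x * y) * trunc (real n) ?F y) \<longlonglongrightarrow> iexp (x * y) * ?F y"
      proof (intro AE_I2 tendsto_eventually)
        fix y
        obtain N where "\<bar>y\<bar> \<le> real N" using real_arch_simple by blast
        then show "\<forall>\<^sub>F n in sequentially. iexp (x * y) * trunc (real n) ?F y = iexp (x * y) * ?F y"
          by (intro eventually_sequentiallyI[of N]) (auto simp: trunc_def split: split_indicator)
      qed
    qed measurable
    then show "AE x in lborel. (\<lambda>n. indicator {a<..b} x *\<^sub>R fourier (trunc (real n) ?F) x)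
        \<longlonglongrightarrow> indicator {a<..b} x *\<^sub>R fourier ?F x"
      by (intro AE_I2 tendsto_scaleR tendsto_const)
  qed measurable
qed

text \<open>Square integrability of f makes the transform, its truncations and z square integrable,
  hence L2 convergence passes to integrals over intervals. Levy's formula, through integrability of
  f, then says what z is.\<close>

lemma fourier_inversion_L2:
  assumes f: "integrable lborel f" and fin: "energy f < \<infinity>" and [measurable]: "z \<in> borel_measurable borel"
    and lim: "((\<lambda>R. energy (\<lambda>t. z t - fourier (trunc R (\<lambda>y. fourier f (- y))) t)) \<longlongrightarrow> 0) at_top"
  shows "AE x in lborel. z x = 2 * of_real pi * f x"
proof -
  let ?F = "\<lambda>y. fourier f (- y)"
  have [measurable]: "f \<in> borel_measurable borel"
    using borel_measurable_integrable[OF f] by simp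
  have Ffin: "energy ?F < \<infinity>"
  proof -
    have "energy ?F = energy (fourier f)"
      using nn_integral_real_affine[of "\<lambda>y. ennreal ((norm (fourier f y))\<^sup>2)" "-1" 0] by simp
    also have "\<dots> \<le> ennreal (2 * pi) * energy f"
      by (intro nn_integral_fourier_square_le f)
    also have "\<dots> < \<infinity>"
      using fin by (simp add: ennreal_mult_less_top)
    finally show ?thesis .
  qed
  have zfin: "energy z < \<infinity>"
  proof -
    have "energy z \<le> ennreal (4 * pi) * energy ?F"
      by (intro energy_L2_fourier_limit_le lim Ffin) measurable
    also have "\<dots> < \<infinity>"
      using Ffin by (simp add: ennreal_mult_less_top)
    finally show ?thesis .
  qed
  have gfin: "energy (fourier (trunc R ?F)) < \<infinity>" for R
  proof -
    have "energy (fourier (trunc R ?F)) \<le> ennreal (2 * pi) * energy (trunc R ?F)"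
      by (intro nn_integral_fourier_square_le integrable_trunc Ffin) measurable
    also have "\<dots> \<le> ennreal (2 * pi) * energy ?F"
      by (intro mult_left_mono nn_integral_mono ennreal_leI power_mono)
         (auto simp: trunc_def split: split_indicator)
    also have "\<dots> < \<infinity>"
      using Ffin by (simp add: ennreal_mult_less_top)
    finally show ?thesis .
  qed
  have lim': "(\<lambda>n. energy (\<lambda>t. z t - fourier (trunc (real n) ?F) t)) \<longlonglongrightarrow> 0"
    by (rule filterlim_compose[OF lim filterlim_real_sequentially])
  show ?thesis
  proof (rule AE_eq_if_Ioc_limits[OF f])
    fix a b :: real
    show "set_integrable lborel {a<..b} z"
      by (intro set_integrable_Ioc_if_energy_finite zfin) measurable
    show "(\<lambda>n. LINT x:{a<..b}|lborel. fourier (trunc (real n) ?F) x)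
       \<longlonglongrightarrow> (LINT x:{a<..b}|lborel. z x)"
      by (intro Ioc_integral_tendsto_if_energy_tendsto zfin gfin lim') measurable
  qed measurable
qed

section \<open>Inversion along a vertical line\<close>

lemma exp_Complex_mult:
  "exp (Complex \<sigma> y * of_real t) = of_real (exp (\<sigma> * t)) * iexp (t * y)"
proof -
  have "Complex \<sigma> y * of_real t = of_real (\<sigma> * t) + \<i> * of_real (t * y)"
    by (simp add: complex_eq_iff)
  then show ?thesis
    by (simp only: exp_add exp_of_real)
qed

lemma inv_full_eq:
  "inv_full \<sigma> F t = of_real (exp (\<sigma> * t) / (2 * pi)) * fourier (\<lambda>y. F (Complex \<sigma> y)) t"
proof -
  have "(LINT y|lborel. exp (Complex \<sigma> y * of_real t) * F (Complex \<sigma> y) * \<i>)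
      = (LINT y|lborel. (of_real (exp (\<sigma> * t)) * \<i>) * (iexp (t * y) * F (Complex \<sigma> y)))"
    unfolding exp_Complex_mult by (simp only: mult_ac)
  also have "\<dots> = (of_real (exp (\<sigma> * t)) * \<i>) * fourier (\<lambda>y. F (Complex \<sigma> y)) t"
    unfolding fourier_def by (rule integral_mult_right_zero)
  finally show ?thesis
    by (simp add: inv_full_def)
qed

lemma inv_trunc_eq:
  "inv_trunc \<sigma> F R t = of_real (exp (\<sigma> * t) / (2 * pi)) * fourier (trunc R (\<lambda>y. F (Complex \<sigma> y))) t"
proof -
  have "(LINT y:{-R..R}|lborel. exp (Complex \<sigma> y * of_real t) * F (Complex \<sigma> y) * \<i>)
      = (LINT y|lborel. (of_real (exp (\<sigma> * t)) * \<i>) * (iexp (t * y) * trunc R (\<lambda>y. F (Complex \<sigma> y)) y))"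
    unfolding set_lebesgue_integral_def trunc_def exp_Complex_mult scaleR_conv_of_real
    by (simp only: mult_ac)
  also have "\<dots> = (of_real (exp (\<sigma> * t)) * \<i>) * fourier (trunc R (\<lambda>y. F (Complex \<sigma> y))) t"
    unfolding fourier_def by (rule integral_mult_right_zero)
  finally show ?thesis
    by (simp add: inv_trunc_def)
qed

text \<open>Up to the factor \<open>exp (\<sigma> t) / (2 \<pi>)\<close>, removed here, the inversion integral is a Fourier integral.\<close>

definition unweight :: "real \<Rightarrow> (real \<Rightarrow> complex) \<Rightarrow> real \<Rightarrow> complex" where
  "unweight \<sigma> v t = of_real (2 * pi * exp (- \<sigma> * t)) * v t"

lemma measurable_unweight [measurable]:
  "v \<in> borel_measurable borel \<Longrightarrow> unweight \<sigma> v \<in> borel_measurable borel"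
  unfolding unweight_def by measurable

lemma weighted_norm_eq:
  "(norm (v t))\<^sup>2 * exp (-2 * \<sigma> * t) = (norm (unweight \<sigma> v t))\<^sup>2 / (4 * pi\<^sup>2)"
proof -
  have "exp (-2 * \<sigma> * t) = (exp (- \<sigma> * t))\<^sup>2"
    by (simp add: exp_double[symmetric])
  then show ?thesis
    by (simp add: unweight_def norm_mult power_mult_distrib)
qed

lemma weighted_nn_integral_eq:
  assumes [measurable]: "v \<in> borel_measurable borel"
  shows "(\<integral>\<^sup>+t. ennreal ((norm (v t))\<^sup>2 * exp (-2 * \<sigma> * t)) \<partial>lborel)
    = ennreal (1 / (4 * pi\<^sup>2)) * energy (unweight \<sigma> v)"
proof -
  have "(\<integral>\<^sup>+t. ennreal ((norm (v t))\<^sup>2 * exp (-2 * \<sigma> * t)) \<partial>lborel)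
      = (\<integral>\<^sup>+t. ennreal (1 / (4 * pi\<^sup>2)) * ennreal ((norm (unweight \<sigma> v t))\<^sup>2) \<partial>lborel)"
    unfolding weighted_norm_eq by (simp add: ennreal_mult[symmetric])
  also have "\<dots> = ennreal (1 / (4 * pi\<^sup>2)) * energy (unweight \<sigma> v)"
    by (rule nn_integral_cmult) measurable
  finally show ?thesis .
qed

lemma unweight_diff_inv_trunc:
  "unweight \<sigma> (\<lambda>t. v t - inv_trunc \<sigma> F R t) t
    = unweight \<sigma> v t - fourier (trunc R (\<lambda>y. F (Complex \<sigma> y))) t"
  by (simp add: unweight_def inv_trunc_eq exp_minus field_simps)

text \<open>The weight exp (-2 \<sigma> t) cancels the growth exp (\<sigma> t) of the inversion
  integral, which leaves an unweighted L2 limit of truncated Fourier integrals.\<close>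

lemma is_L2_inversion_iff:
  assumes [measurable]: "(\<lambda>y. F (Complex \<sigma> y)) \<in> borel_measurable borel"
  shows "is_L2_inversion \<sigma> F v \<longleftrightarrow> v \<in> borel_measurable borel \<and>
    ((\<lambda>R. energy (\<lambda>t. unweight \<sigma> v t - fourier (trunc R (\<lambda>y. F (Complex \<sigma> y))) t)) \<longlongrightarrow> 0) at_top"
proof (cases "v \<in> borel_measurable borel")
  case True
  then have [measurable]: "v \<in> borel_measurable borel" .
  have [measurable]: "inv_trunc \<sigma> F R \<in> borel_measurable borel" for R
    unfolding inv_trunc_eq[abs_def] by measurable
  let ?E = "\<lambda>R. energy (\<lambda>t. unweight \<sigma> v t - fourier (trunc R (\<lambda>y. F (Complex \<sigma> y))) t)"
  have eq: "(\<integral>\<^sup>+t. ennreal ((norm (v t - inv_trunc \<sigma> F R t))\<^sup>2 * exp (-2 * \<sigma> * t)) \<partial>lborel)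
      = ennreal (1 / (4 * pi\<^sup>2)) * ?E R" for R
    by (subst weighted_nn_integral_eq) (measurable, simp only: unweight_diff_inv_trunc)
  have eq': "?E R = ennreal (4 * pi\<^sup>2) * (ennreal (1 / (4 * pi\<^sup>2)) * ?E R)" for R
    by (simp add: mult.assoc[symmetric] ennreal_mult[symmetric])
  have "((\<lambda>R. ennreal (1 / (4 * pi\<^sup>2)) * ?E R) \<longlongrightarrow> 0) at_top \<longleftrightarrow> (?E \<longlongrightarrow> 0) at_top"
  proof
    assume "((\<lambda>R. ennreal (1 / (4 * pi\<^sup>2)) * ?E R) \<longlongrightarrow> 0) at_top"
    from ennreal_tendsto_cmult[OF _ this, of "ennreal (4 * pi\<^sup>2)"]
    show "(?E \<longlongrightarrow> 0) at_top"
      unfolding eq'[symmetric] by simp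
  next
    assume "(?E \<longlongrightarrow> 0) at_top"
    from ennreal_tendsto_cmult[OF _ this, of "ennreal (1 / (4 * pi\<^sup>2))"]
    show "((\<lambda>R. ennreal (1 / (4 * pi\<^sup>2)) * ?E R) \<longlongrightarrow> 0) at_top"
      by simp
  qed
  then show ?thesis
    using True unfolding is_L2_inversion_def eq by simp
qed (simp add: is_L2_inversion_def)

text \<open>Both branches of \<open>inversion\<close> are covered: an absolutely convergent integral
  is also the L2 limit of its truncations when F is square integrable, and otherwise the existence
  of an L2 limit gives the choice operator a witness.\<close>

lemma is_L2_inversion_inversion:
  assumes [measurable]: "(\<lambda>y. F (Complex \<sigma> y)) \<in> borel_measurable borel"
    and fin: "energy (\<lambda>y. F (Complex \<sigma> y)) < \<infinity>"
  shows "is_L2_inversion \<sigma> F (inversion \<sigma> F)"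
proof (cases "integrable_Cline \<sigma> F")
  case True
  let ?F = "\<lambda>y. F (Complex \<sigma> y)"
  have int: "integrable lborel ?F"
    using True by (simp add: integrable_Cline_def)
  have un: "unweight \<sigma> (inv_full \<sigma> F) t = fourier ?F t" for t
    by (simp add: unweight_def inv_full_eq exp_minus field_simps)
  have bound: "energy (\<lambda>t. fourier ?F t - fourier (trunc R ?F) t) \<le> ennreal (2 * pi) * tail_energy ?F R" for R
  proof -
    have "energy (\<lambda>t. fourier ?F t - fourier (trunc R ?F) t)
        \<le> ennreal (2 * pi) * energy (\<lambda>y. ?F y - trunc R ?F y)"
      by (simp only: fourier_diff[OF int integrable_trunc] assms)
         (intro nn_integral_fourier_square_le Bochner_Integration.integrable_diff integrable_trunc assms int)
    also have "energy (\<lambda>y. ?F y - trunc R ?F y) = tail_energy ?F R"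
      unfolding tail_energy_def
      by (intro nn_integral_cong) (auto simp: trunc_def split: split_indicator)
    finally show ?thesis .
  qed
  have lim: "((\<lambda>R. ennreal (2 * pi) * tail_energy ?F R) \<longlongrightarrow> 0) at_top"
    using ennreal_tendsto_cmult[OF _ tail_energy_tendsto_0[OF assms], of "ennreal (2 * pi)"] by simp
  have "((\<lambda>R. energy (\<lambda>t. fourier ?F t - fourier (trunc R ?F) t)) \<longlongrightarrow> 0) at_top"
    by (rule tendsto_sandwich[OF _ _ tendsto_const lim]) (simp_all add: bound)
  moreover have "inv_full \<sigma> F \<in> borel_measurable borel"
    unfolding inv_full_eq[abs_def] by measurable
  ultimately show ?thesis
    using True by (simp add: inversion_def is_L2_inversion_iff un)
next
  case False
  obtain z where z [measurable]: "z \<in> borel_measurable borel"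
    and lim: "((\<lambda>R. energy (\<lambda>t. z t - fourier (trunc R (\<lambda>y. F (Complex \<sigma> y))) t)) \<longlongrightarrow> 0) at_top"
    using ex_L2_fourier_limit[OF assms] by blast
  have un: "unweight \<sigma> (\<lambda>t. of_real (exp (\<sigma> * t) / (2 * pi)) * z t) = z"
    by (auto simp: fun_eq_iff unweight_def exp_minus field_simps)
  have "is_L2_inversion \<sigma> F (\<lambda>t. of_real (exp (\<sigma> * t) / (2 * pi)) * z t)"
    using lim by (simp add: is_L2_inversion_iff un del: of_real_divide)
  then show ?thesis
    using False by (simp add: inversion_def someI)
qed

text \<open>v and w are arbitrary L2 limits, so the bound applies to whatever representative was
  chosen. The constant is 4 pi from the limit bound divided by 4 pi^2 from
  \<open>unweight\<close>.\<close>

lemma is_L2_inversion_diff: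
  assumes F [measurable]: "(\<lambda>y. F (Complex \<sigma> y)) \<in> borel_measurable borel"
    and G [measurable]: "(\<lambda>y. G (Complex \<sigma> y)) \<in> borel_measurable borel"
    and fin: "energy (\<lambda>y. F (Complex \<sigma> y)) < \<infinity>" "energy (\<lambda>y. G (Complex \<sigma> y)) < \<infinity>"
    and v: "is_L2_inversion \<sigma> F v" and w: "is_L2_inversion \<sigma> G w"
  shows "(\<integral>\<^sup>+t. ennreal ((norm (v t - w t))\<^sup>2 * exp (-2 * \<sigma> * t)) \<partial>lborel)
    \<le> ennreal (1 / pi) * energy (\<lambda>y. F (Complex \<sigma> y) - G (Complex \<sigma> y))"
proof -
  let ?F = "\<lambda>y. F (Complex \<sigma> y)" and ?G = "\<lambda>y. G (Complex \<sigma> y)"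
  have [measurable]: "v \<in> borel_measurable borel" "w \<in> borel_measurable borel"
    and lim: "((\<lambda>R. energy (\<lambda>t. unweight \<sigma> v t - fourier (trunc R ?F) t)) \<longlongrightarrow> 0) at_top"
      "((\<lambda>R. energy (\<lambda>t. unweight \<sigma> w t - fourier (trunc R ?G) t)) \<longlongrightarrow> 0) at_top"
    using v w by (simp_all add: is_L2_inversion_iff F G)
  let ?z = "unweight \<sigma> (\<lambda>t. v t - w t)"
  have dfin: "energy (\<lambda>y. ?F y - ?G y) < \<infinity>"
  proof -
    have "energy (\<lambda>y. ?F y + (- ?G y)) \<le> 2 * energy ?F + 2 * energy (\<lambda>y. - ?G y)"
      by (intro energy_triangle) measurable
    also have "\<dots> < \<infinity>"
      using fin by (simp add: ennreal_mult_less_top)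
    finally show ?thesis by simp
  qed
  have bound: "energy (\<lambda>t. ?z t - fourier (trunc R (\<lambda>y. ?F y - ?G y)) t)
      \<le> 2 * energy (\<lambda>t. unweight \<sigma> v t - fourier (trunc R ?F) t)
        + 2 * energy (\<lambda>t. unweight \<sigma> w t - fourier (trunc R ?G) t)" (is "_ \<le> ?b R") for R
  proof -
    have tr: "trunc R (\<lambda>y. ?F y - ?G y) = (\<lambda>y. trunc R ?F y - trunc R ?G y)"
      by (auto simp: trunc_def scaleR_diff_right)
    have "fourier (trunc R (\<lambda>y. ?F y - ?G y)) t = fourier (trunc R ?F) t - fourier (trunc R ?G) t" for t
      unfolding tr by (rule fourier_diff[symmetric]) (intro integrable_trunc assms)+
    then have "?z t - fourier (trunc R (\<lambda>y. ?F y - ?G y)) t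
        = (unweight \<sigma> v t - fourier (trunc R ?F) t) + (- (unweight \<sigma> w t - fourier (trunc R ?G) t))" for t
      by (simp add: unweight_def right_diff_distrib)
    then have "energy (\<lambda>t. ?z t - fourier (trunc R (\<lambda>y. ?F y - ?G y)) t)
        = energy (\<lambda>t. (unweight \<sigma> v t - fourier (trunc R ?F) t) + (- (unweight \<sigma> w t - fourier (trunc R ?G) t)))"
      by (simp only:)
    also have "\<dots> \<le> 2 * energy (\<lambda>t. unweight \<sigma> v t - fourier (trunc R ?F) t)
        + 2 * energy (\<lambda>t. - (unweight \<sigma> w t - fourier (trunc R ?G) t))"
      by (intro energy_triangle) measurable
    finally show ?thesis by (simp only: norm_minus_cancel)
  qed
  have "(?b \<longlongrightarrow> 2 * 0 + 2 * 0) at_top"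
    by (intro tendsto_add ennreal_tendsto_cmult lim) simp_all
  then have b: "(?b \<longlongrightarrow> 0) at_top"
    by (simp only: mult_zero_right add_0)
  have "((\<lambda>R. energy (\<lambda>t. ?z t - fourier (trunc R (\<lambda>y. ?F y - ?G y)) t)) \<longlongrightarrow> 0) at_top"
    by (rule tendsto_sandwich[OF always_eventually always_eventually tendsto_const b]) (intro allI zero_le bound)+
  then have "energy ?z \<le> ennreal (4 * pi) * energy (\<lambda>y. ?F y - ?G y)"
    by (intro energy_L2_fourier_limit_le dfin) measurable
  then have "ennreal (1 / (4 * pi\<^sup>2)) * energy ?z
      \<le> ennreal (1 / (4 * pi\<^sup>2)) * (ennreal (4 * pi) * energy (\<lambda>y. ?F y - ?G y))"
    by (intro mult_left_mono) simp_all
  also have "\<dots> = ennreal (1 / pi) * energy (\<lambda>y. ?F y - ?G y)"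
    by (simp add: mult.assoc[symmetric] ennreal_mult[symmetric] power2_eq_square)
  also have "ennreal (1 / (4 * pi\<^sup>2)) * energy ?z
      = (\<integral>\<^sup>+t. ennreal ((norm (v t - w t))\<^sup>2 * exp (-2 * \<sigma> * t)) \<partial>lborel)"
    by (intro weighted_nn_integral_eq[symmetric]) measurable
  finally show ?thesis .
qed

subsection \<open>Laplace transforms as Fourier integrals\<close>

text \<open>The indicator reflects that \<open>laplace\<close> sees only \<open>{0..}\<close>: data
  and noise are controlled only there.\<close>

definition damp :: "real \<Rightarrow> (real \<Rightarrow> complex) \<Rightarrow> real \<Rightarrow> complex" where
  "damp \<sigma> h t = indicator {0..} t *\<^sub>R (of_real (exp (- \<sigma> * t)) * h t)"

lemma laplace_eq_fourier_damp: "laplace h (Complex \<sigma> y) = fourier (damp \<sigma> h) (- y)"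
  unfolding laplace_def fourier_def set_lebesgue_integral_def
proof (rule Bochner_Integration.integral_cong[OF refl])
  fix t
  have "exp (- Complex \<sigma> y * of_real t) = of_real (exp (- \<sigma> * t)) * iexp (- y * t)"
  proof -
    have "- Complex \<sigma> y = Complex (- \<sigma>) (- y)"
      by (simp add: complex_eq_iff)
    then show ?thesis
      by (simp only: exp_Complex_mult) (simp only: mult.commute)
  qed
  then show "indicator {0..} t *\<^sub>R (exp (- Complex \<sigma> y * of_real t) * h t) = iexp (- y * t) * damp \<sigma> h t"
    by (simp add: damp_def mult_ac)
qed

text \<open>The integral of exp (- \<sigma> t) over \<open>{0..}\<close> is 1 / \<sigma>. The bound
  is uniform along the line but does not decay with the frequency, so the filter has to compensate
  the growth of 1 / K.\<close>

lemma damp_noise: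
  assumes [measurable]: "damp \<sigma> h \<in> borel_measurable borel" and bd: "\<And>t. 0 \<le> t \<Longrightarrow> norm (h t) \<le> \<delta>"
    and "0 < \<sigma>" "0 \<le> \<delta>"
  shows "integrable lborel (damp \<sigma> h)" "norm (fourier (damp \<sigma> h) x) \<le> \<delta> / \<sigma>"
proof -
  have "((\<lambda>t. - \<delta> / \<sigma> * exp (- (\<sigma> * t))) \<longlongrightarrow> - \<delta> / \<sigma> * 0) at_top"
    using \<open>0 < \<sigma>\<close>
    by (intro tendsto_mult tendsto_const filterlim_compose[OF exp_at_bot]
          filterlim_compose[OF filterlim_uminus_at_bot_at_top] filterlim_tendsto_pos_mult_at_top[OF tendsto_const _ filterlim_ident])
  then have "(\<integral>\<^sup>+t. ennreal (\<delta> * exp (- (\<sigma> * t))) * indicator {0..} t \<partial>lborel)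
      = ennreal (0 - (- \<delta> / \<sigma> * exp (- (\<sigma> * 0))))"
    using assms(3,4)
    by (intro nn_integral_FTC_atLeast) (auto intro!: derivative_eq_intros)
  then have eq: "(\<integral>\<^sup>+t. ennreal (\<delta> * exp (- (\<sigma> * t))) * indicator {0..} t \<partial>lborel) = ennreal (\<delta> / \<sigma>)"
    by simp
  have le: "(\<integral>\<^sup>+t. ennreal (norm (damp \<sigma> h t)) \<partial>lborel) \<le> ennreal (\<delta> / \<sigma>)"
    unfolding eq[symmetric] using bd
    by (intro nn_integral_mono)
       (auto simp: damp_def norm_mult mult.commute intro!: ennreal_leI mult_left_mono split: split_indicator)
  then show int: "integrable lborel (damp \<sigma> h)"
    by (intro integrableI_bounded) (auto simp: less_top[symmetric] top_unique)
  have "ennreal (norm (fourier (damp \<sigma> h) x)) \<le> (\<integral>\<^sup>+t. ennreal (norm (iexp (x * t) * damp \<sigma> h t)) \<partial>lborel)"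
    unfolding fourier_def by (rule ennreal_norm_integral_le)
  also have "\<dots> \<le> ennreal (\<delta> / \<sigma>)"
    using le by (simp add: norm_mult)
  finally show "norm (fourier (damp \<sigma> h) x) \<le> \<delta> / \<sigma>"
    using assms(3,4) by (simp add: ennreal_le_iff)
qed

section \<open>Convolution and the transformed Volterra equation\<close>

lemma fourier_convolution:
  assumes p: "integrable lborel p" and q: "integrable lborel q"
  defines "r \<equiv> \<lambda>t. LINT s|lborel. p (t - s) * q s"
  shows "integrable lborel r" "fourier r x = fourier p x * fourier q x"
proof -
  have [measurable]: "p \<in> borel_measurable borel" "q \<in> borel_measurable borel"
    using borel_measurable_integrable[OF p] borel_measurable_integrable[OF q] by simp_all
  have shift: "integrable lborel (\<lambda>t. p (t - s))" for s
    using lborel_integrable_real_affine[OF p, of 1 "- s"] by simp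
  have shift_norm: "(LINT t|lborel. norm (p (t - s))) = (LINT t|lborel. norm (p t))" for s
    using lborel_integral_real_affine[of 1 "\<lambda>t. norm (p t)" "- s"] by simp
  have int: "integrable (lborel \<Otimes>\<^sub>M lborel) (\<lambda>(s, t). p (t - s) * q s)"
  proof (rule lborel_pair.Fubini_integrable)
    show "integrable lborel (\<lambda>s. LINT t|lborel. norm (case (s, t) of (s, t) \<Rightarrow> p (t - s) * q s))"
      using q by (simp add: norm_mult shift_norm)
    show "AE s in lborel. integrable lborel (\<lambda>t. case (s, t) of (s, t) \<Rightarrow> p (t - s) * q s)"
      using shift by simp
  qed measurable
  from lborel_pair.integrable_snd[OF this]
  show "integrable lborel r"
    by (simp add: r_def)
  have int': "integrable (lborel \<Otimes>\<^sub>M lborel) (\<lambda>(s, t). iexp (x * t) * (p (t - s) * q s))"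
    by (rule Bochner_Integration.integrable_bound[OF int]) (measurable, auto simp: norm_mult)
  have "fourier r x = (LINT t|lborel. LINT s|lborel. iexp (x * t) * (p (t - s) * q s))"
    unfolding fourier_def r_def by (simp only: integral_mult_right_zero)
  also have "\<dots> = (LINT s|lborel. LINT t|lborel. iexp (x * t) * (p (t - s) * q s))"
    by (rule lborel_pair.Fubini_integral[OF int'])
  also have "\<dots> = (LINT s|lborel. fourier p x * (iexp (x * s) * q s))"
  proof (rule Bochner_Integration.integral_cong[OF refl])
    fix s
    have "(LINT t|lborel. iexp (x * t) * p (t - s)) = (LINT t|lborel. iexp (x * (s + t)) * p t)"
      using lborel_integral_real_affine[of 1 "\<lambda>t. iexp (x * t) * p (t - s)" s] by simp
    also have "\<dots> = (LINT t|lborel. iexp (x * s) * (iexp (x * t) * p t))"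
      by (simp add: distrib_left exp_add mult.assoc)
    also have "\<dots> = iexp (x * s) * fourier p x"
      unfolding fourier_def by (rule integral_mult_right_zero)
    finally have "(LINT t|lborel. iexp (x * t) * p (t - s)) * q s = iexp (x * s) * fourier p x * q s"
      by simp
    moreover have "(LINT t|lborel. iexp (x * t) * (p (t - s) * q s)) = (LINT t|lborel. iexp (x * t) * p (t - s)) * q s"
      by (simp only: mult.assoc[symmetric] integral_mult_left_zero)
    ultimately show "(LINT t|lborel. iexp (x * t) * (p (t - s) * q s)) = fourier p x * (iexp (x * s) * q s)"
      by (simp only: mult_ac)
  qed
  also have "\<dots> = fourier p x * fourier q x"
    unfolding fourier_def[of q] by (rule integral_mult_right_zero)
  finally show "fourier r x = fourier p x * fourier q x" .
qed

text \<open>The exponential splits over s and t - s, and the two indicators confine s to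
  \<open>{0..t}\<close>. The identity holds at every t: where the convolution integral does not
  exist, both sides are 0 by default, because the integrands agree up to a nonzero constant.\<close>

lemma damp_volterra_conv:
  assumes g: "\<And>t. 0 \<le> t \<Longrightarrow> g t = volterra_conv k u t"
  shows "damp \<sigma> g = (\<lambda>t. LINT s|lborel. damp \<sigma> k (t - s) * damp \<sigma> u s)"
proof
  fix t
  show "damp \<sigma> g t = (LINT s|lborel. damp \<sigma> k (t - s) * damp \<sigma> u s)"
  proof (cases "0 \<le> t")
    case True
    have "damp \<sigma> g t = of_real (exp (- \<sigma> * t)) * (LINT s:{0..t}|lborel. k (t - s) * u s)"
      using True by (simp add: damp_def g volterra_conv_def)
    also have "\<dots> = (LINT s|lborel. of_real (exp (- \<sigma> * t)) * (indicator {0..t} s *\<^sub>R (k (t - s) * u s)))"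
      unfolding set_lebesgue_integral_def by (rule integral_mult_right_zero[symmetric])
    also have "\<dots> = (LINT s|lborel. damp \<sigma> k (t - s) * damp \<sigma> u s)"
    proof (rule Bochner_Integration.integral_cong[OF refl])
      fix s
      have "exp (- \<sigma> * t) = exp (- \<sigma> * (t - s)) * exp (- \<sigma> * s)"
        by (simp add: exp_add[symmetric] algebra_simps)
      then show "of_real (exp (- \<sigma> * t)) * (indicator {0..t} s *\<^sub>R (k (t - s) * u s))
          = damp \<sigma> k (t - s) * damp \<sigma> u s"
        by (simp only: damp_def of_real_mult) (auto split: split_indicator)
    qed
    finally show ?thesis .
  next
    case False
    then have "damp \<sigma> k (t - s) * damp \<sigma> u s = 0" for s
      by (auto simp: damp_def split: split_indicator)
    then have "(LINT s|lborel. damp \<sigma> k (t - s) * damp \<sigma> u s) = 0"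
      by (simp only: integral_zero)
    then show ?thesis
      using False by (simp add: damp_def)
  qed
qed

section \<open>The regularising factor\<close>

lemma nn_integral_abs_le:
  fixes \<phi> :: "real \<Rightarrow> ennreal"
  assumes [measurable]: "\<phi> \<in> borel_measurable borel"
  shows "(\<integral>\<^sup>+y. \<phi> \<bar>y\<bar> \<partial>lborel) \<le> 2 * (\<integral>\<^sup>+y. \<phi> y * indicator {0..} y \<partial>lborel)"
proof -
  have "(\<integral>\<^sup>+y. \<phi> \<bar>y\<bar> \<partial>lborel)
      \<le> (\<integral>\<^sup>+y. \<phi> y * indicator {0..} y + \<phi> (- y) * indicator {0..} (- y) \<partial>lborel)"
    by (intro nn_integral_mono) (auto split: split_indicator)
  also have "\<dots> = (\<integral>\<^sup>+y. \<phi> y * indicator {0..} y \<partial>lborel) + (\<integral>\<^sup>+y. \<phi> (- y) * indicator {0..} (- y) \<partial>lborel)"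
    by (intro nn_integral_add) measurable
  also have "(\<integral>\<^sup>+y. \<phi> (- y) * indicator {0..} (- y) \<partial>lborel) = (\<integral>\<^sup>+y. \<phi> y * indicator {0..} y \<partial>lborel)"
    using nn_integral_real_affine[of "\<lambda>y. \<phi> y * indicator {0..} y" "-1" 0] by simp
  finally show ?thesis by (simp add: mult_2)
qed

text \<open>The substitution y = N s extracts the factor N, which is the bandwidth that the filter
  lets through.\<close>

lemma nn_integral_one_plus_powr:
  assumes "p < -1" "0 < N"
  shows "(\<integral>\<^sup>+y. ennreal ((1 + \<bar>y\<bar> / N) powr p) \<partial>lborel) \<le> ennreal (2 * N / (- p - 1))"
proof -
  have "((\<lambda>s. (1 + s) powr (p + 1) / (p + 1)) \<longlongrightarrow> 0 / (p + 1)) at_top"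
    using assms(1)
    by (intro tendsto_divide tendsto_const tendsto_neg_powr filterlim_tendsto_add_at_top[OF tendsto_const filterlim_ident])
       auto
  then have "(\<integral>\<^sup>+s. ennreal ((1 + s) powr p) * indicator {0..} s \<partial>lborel) = ennreal (0 / (p + 1) - (1 + 0) powr (p + 1) / (p + 1))"
    using assms(1) by (intro nn_integral_FTC_atLeast) (auto intro!: derivative_eq_intros)
  then have half: "(\<integral>\<^sup>+s. ennreal ((1 + s) powr p) * indicator {0..} s \<partial>lborel) = ennreal (1 / (- p - 1))"
    using assms(1) by (simp add: divide_simps)
  have "(\<integral>\<^sup>+y. ennreal ((1 + \<bar>y\<bar> / N) powr p) \<partial>lborel)
      = ennreal \<bar>N\<bar> * (\<integral>\<^sup>+s. ennreal ((1 + \<bar>0 + N * s\<bar> / N) powr p) \<partial>lborel)"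
    using assms(2) by (intro nn_integral_real_affine) auto
  also have "(\<integral>\<^sup>+s. ennreal ((1 + \<bar>0 + N * s\<bar> / N) powr p) \<partial>lborel) = (\<integral>\<^sup>+s. ennreal ((1 + \<bar>s\<bar>) powr p) \<partial>lborel)"
    using assms(2) by (simp add: abs_mult)
  also have "\<dots> \<le> 2 * (\<integral>\<^sup>+s. ennreal ((1 + s) powr p) * indicator {0..} s \<partial>lborel)"
    by (rule nn_integral_abs_le) measurable
  also have "\<dots> = ennreal (2 / (- p - 1))"
    using ennreal_mult[of 2 "1 / (- p - 1)"] assms(1) by (simp add: half)
  finally have "(\<integral>\<^sup>+y. ennreal ((1 + \<bar>y\<bar> / N) powr p) \<partial>lborel) \<le> ennreal (N * (2 / (- p - 1)))"
    using assms by (simp add: mult_left_mono ennreal_mult[symmetric])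
  then show ?thesis
    by (simp add: mult.commute)
qed

text \<open>The profile of the rescaled bias for d < 1. It is compared with s^(-d) on
  \<open>{0..1}\<close>, where d < 1 is needed, and with s^(-d-1) beyond, where 0 < d is
  needed.\<close>

lemma nn_integral_powr_over_one_plus_finite:
  assumes "0 < d" "d < 1"
  shows "(\<integral>\<^sup>+s. ennreal (\<bar>s\<bar> powr (- d) / (1 + \<bar>s\<bar>)) \<partial>lborel) < \<infinity>"
proof -
  have lim: "((\<lambda>s. s powr (- d) / (- d)) \<longlongrightarrow> 0 / (- d)) at_top"
    using assms by (intro tendsto_divide tendsto_const tendsto_neg_powr filterlim_ident) auto
  have far: "(\<integral>\<^sup>+s. ennreal (s powr (- d - 1)) * indicator {1..} s \<partial>lborel) = ennreal (0 / (- d) - 1 powr (- d) / (- d))"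
    using assms by (intro nn_integral_FTC_atLeast[OF _ _ _ lim]) (auto intro!: derivative_eq_intros)
  have near: "(\<integral>\<^sup>+s. ennreal (s powr (- d) * indicator {0..1} s) \<partial>lborel) = ennreal (1 powr (- d + 1) / (- d + 1))"
  proof (rule nn_integral_has_integral_lborel)
    have "((\<lambda>s. if s \<in> {0..1} then s powr (- d) else 0) has_integral (1 powr (- d + 1) / (- d + 1))) UNIV"
      using assms by (subst has_integral_restrict_UNIV) (intro has_integral_powr_from_0, auto)
    then show "((\<lambda>s. s powr (- d) * indicator {0..1} s) has_integral (1 powr (- d + 1) / (- d + 1))) UNIV"
      by (rule has_integral_eq[rotated]) auto
  qed auto
  have double: "(\<integral>\<^sup>+s. ennreal (\<bar>s\<bar> powr (- d) / (1 + \<bar>s\<bar>)) \<partial>lborel)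
      \<le> 2 * (\<integral>\<^sup>+s. ennreal (s powr (- d) / (1 + s)) * indicator {0..} s \<partial>lborel)"
    by (rule nn_integral_abs_le) measurable
  have "(\<integral>\<^sup>+s. ennreal (s powr (- d) / (1 + s)) * indicator {0..} s \<partial>lborel)
      \<le> (\<integral>\<^sup>+s. ennreal (s powr (- d) * indicator {0..1} s) + ennreal (s powr (- d - 1)) * indicator {1..} s \<partial>lborel)"
  proof (intro nn_integral_mono)
    fix s :: real
    have 1: "s powr (- d) / (1 + s) \<le> s powr (- d)" if "0 \<le> s"
      using that by (simp add: divide_le_eq mult_le_cancel_left1)
    have 2: "s powr (- d) / (1 + s) \<le> s powr (- d - 1)" if "1 \<le> s"
    proof -
      have "s powr (- d) / (1 + s) \<le> s powr (- d) / s"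
        using that by (intro divide_left_mono) auto
      also have "\<dots> = s powr (- d - 1)"
        using that by (simp add: powr_diff)
      finally show ?thesis .
    qed
    show "ennreal (s powr (- d) / (1 + s)) * indicator {0..} s
        \<le> ennreal (s powr (- d) * indicator {0..1} s) + ennreal (s powr (- d - 1)) * indicator {1..} s"
    proof (cases "s < 1")
      case True
      then show ?thesis using 1 by (auto intro!: ennreal_leI split: split_indicator)
    next
      case False
      then have "ennreal (s powr (- d) / (1 + s)) * indicator {0..} s \<le> ennreal (s powr (- d - 1)) * indicator {1..} s"
        using 2 by (simp add: ennreal_leI)
      then show ?thesis
        by (rule order_trans) simp
    qed
  qed
  also have "\<dots> = (\<integral>\<^sup>+s. ennreal (s powr (- d) * indicator {0..1} s) \<partial>lborel)
      + (\<integral>\<^sup>+s. ennreal (s powr (- d - 1)) * indicator {1..} s \<partial>lborel)"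
    by (intro nn_integral_add) measurable
  also have "\<dots> < \<infinity>"
    unfolding near far by simp
  finally show ?thesis
    using double by (simp add: ennreal_mult_less_top order_le_less_trans)
qed

section \<open>Pointwise bounds for the filter on the line\<close>

definition filter_factor :: "nat \<Rightarrow> real \<Rightarrow> complex \<Rightarrow> complex" where
  "filter_factor m N z = 1 / (z / of_real N + 1) ^ m"

lemma measurable_Complex_line [measurable]: "(\<lambda>y. Complex \<sigma> y) \<in> borel_measurable borel"
  by (simp add: Complex_eq)

lemma norm_Complex_bounds:
  assumes "0 < \<sigma>"
  shows "\<bar>y\<bar> \<le> norm (Complex \<sigma> y)" "norm (Complex \<sigma> y) \<le> \<sigma> + \<bar>y\<bar>" "0 < norm (Complex \<sigma> y)"
  using abs_Im_le_cmod[of "Complex \<sigma> y"] cmod_le[of "Complex \<sigma> y"] assms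
  by (auto simp: complex_eq_iff)

text \<open>The real part is 1 + \<sigma> / N and the imaginary part is y / N; the modulus is at
  least the average of their absolute values. The resulting 1/2 becomes 2^m after taking
  powers.\<close>

lemma norm_filter_denominator:
  assumes "0 < \<sigma>" "0 < N"
  shows "1 \<le> norm (Complex \<sigma> y / of_real N + 1)"
    "(1 + \<bar>y\<bar> / N) / 2 \<le> norm (Complex \<sigma> y / of_real N + 1)"
proof -
  let ?w = "Complex \<sigma> y / of_real N + 1"
  have "1 \<le> Re ?w" "\<bar>y\<bar> / N = \<bar>Im ?w\<bar>"
    using assms by (auto simp: abs_divide)
  with complex_Re_le_cmod[of ?w] abs_Im_le_cmod[of ?w]
  have "1 \<le> norm ?w" "1 + \<bar>y\<bar> / N \<le> 2 * norm ?w"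
    by linarith+
  then show "1 \<le> norm ?w" "(1 + \<bar>y\<bar> / N) / 2 \<le> norm ?w"
    by simp_all
qed

lemma norm_filter_factor_le:
  assumes "0 < \<sigma>" "0 < N"
  shows "norm (filter_factor m N (Complex \<sigma> y)) \<le> 1"
    "norm (filter_factor m N (Complex \<sigma> y)) \<le> 2 ^ m * (1 + \<bar>y\<bar> / N) powr (- real m)"
proof -
  let ?w = "Complex \<sigma> y / of_real N + 1"
  note w = norm_filter_denominator[OF assms, of y]
  show "norm (filter_factor m N (Complex \<sigma> y)) \<le> 1"
    using one_le_power[OF w(1), of m] w(1) unfolding filter_factor_def norm_divide norm_power
    by (simp add: divide_le_eq)
  have pos: "0 < 1 + \<bar>y\<bar> / N"
    using assms by (intro add_pos_nonneg) auto
  have "1 / norm ?w ^ m \<le> 1 / ((1 + \<bar>y\<bar> / N) / 2) ^ m"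
    using pos w by (intro divide_left_mono power_mono mult_pos_pos zero_less_power) auto
  also have "\<dots> = 2 ^ m * (1 + \<bar>y\<bar> / N) powr (- real m)"
  proof -
    have "1 / (r / 2) ^ m = 2 ^ m * r powr (- real m)" if "0 < r" for r :: real
      using that by (simp add: power_divide powr_minus_divide powr_realpow)
    from this[OF pos] show ?thesis .
  qed
  finally show "norm (filter_factor m N (Complex \<sigma> y)) \<le> 2 ^ m * (1 + \<bar>y\<bar> / N) powr (- real m)"
    by (simp add: filter_factor_def norm_divide norm_power)
qed

text \<open>The second bound comes from the Lipschitz estimate for the m-th power on the unit disc.
  It is better for norm z small compared with N, the first one for norm z large; for d \<le> 1 the
  bias estimates combine the two.\<close>

lemma norm_filter_factor_minus_1_le:
  assumes "0 < \<sigma>" "0 < N"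
  shows "norm (filter_factor m N (Complex \<sigma> y) - 1) \<le> 2"
    "norm (filter_factor m N (Complex \<sigma> y) - 1) \<le> real m * (norm (Complex \<sigma> y) / N)"
proof -
  let ?z = "Complex \<sigma> y"
  let ?w = "?z / of_real N + 1"
  note w = norm_filter_denominator(1)[OF assms, of y]
  show "norm (filter_factor m N ?z - 1) \<le> 2"
    using norm_triangle_ineq4[of "filter_factor m N ?z" 1] norm_filter_factor_le(1)[OF assms, of m y]
    by simp
  have w0: "?w \<noteq> 0"
    using w by auto
  have "norm (filter_factor m N ?z - 1) = norm ((1 / ?w) ^ m - 1 ^ m)"
    by (simp add: filter_factor_def power_one_over)
  also have "\<dots> \<le> real m * norm (1 / ?w - 1)"
    using w by (intro norm_power_diff) (auto simp: norm_divide divide_le_eq)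
  also have "1 / ?w - 1 = - (?z / of_real N) / ?w"
  proof -
    have "1 / ?w - 1 = (1 - ?w) / ?w"
      by (simp only: diff_divide_distrib divide_self[OF w0])
    then show ?thesis by simp
  qed
  also have "norm \<dots> = norm ?z / N / norm ?w"
    using assms(2) by (simp only: norm_divide norm_minus_cancel norm_of_real abs_of_pos)
  also have "\<dots> \<le> norm ?z / N / 1"
    using w assms(2) by (intro divide_left_mono) auto
  also have "\<dots> = norm ?z / N"
    by simp
  finally show "norm (filter_factor m N ?z - 1) \<le> real m * (norm ?z / N)"
    by (simp add: mult_left_mono)
qed

text \<open>Since norm z \<le> \<sigma> + \<bar>y\<bar> \<le> max \<sigma> N (1 + \<bar>y\<bar> /
  N), the growth of 1 / K is expressed in the variable in which the filter decays. Once N exceeds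
  \<sigma>, the maximum is N.\<close>

lemma powr_norm_filter_factor_le:
  assumes "0 < \<sigma>" "0 < N" "0 \<le> a"
  shows "norm (Complex \<sigma> y) powr a * norm (filter_factor m N (Complex \<sigma> y))
    \<le> 2 ^ m * max \<sigma> N powr a * (1 + \<bar>y\<bar> / N) powr (a - real m)"
proof -
  have "norm (Complex \<sigma> y) \<le> \<sigma> + \<bar>y\<bar>"
    by (rule norm_Complex_bounds(2)[OF assms(1)])
  also have "\<dots> = \<sigma> + N * (\<bar>y\<bar> / N)"
    using assms by simp
  also have "\<dots> \<le> max \<sigma> N + max \<sigma> N * (\<bar>y\<bar> / N)"
    using assms by (intro add_mono mult_right_mono) auto
  finally have "norm (Complex \<sigma> y) \<le> max \<sigma> N * (1 + \<bar>y\<bar> / N)"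
    by (simp only: distrib_left mult_1_right)
  then have "norm (Complex \<sigma> y) powr a \<le> (max \<sigma> N * (1 + \<bar>y\<bar> / N)) powr a"
    using assms by (intro powr_mono2) auto
  also have "\<dots> = max \<sigma> N powr a * (1 + \<bar>y\<bar> / N) powr a"
    using assms by (intro powr_mult) 
  finally have "norm (Complex \<sigma> y) powr a * norm (filter_factor m N (Complex \<sigma> y))
      \<le> (max \<sigma> N powr a * (1 + \<bar>y\<bar> / N) powr a) * (2 ^ m * (1 + \<bar>y\<bar> / N) powr (- real m))"
    using assms by (intro mult_mono norm_filter_factor_le) auto
  also have "\<dots> = 2 ^ m * max \<sigma> N powr a * ((1 + \<bar>y\<bar> / N) powr a * (1 + \<bar>y\<bar> / N) powr (- real m))"
    by (simp only: mult_ac)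
  also have "(1 + \<bar>y\<bar> / N) powr a * (1 + \<bar>y\<bar> / N) powr (- real m) = (1 + \<bar>y\<bar> / N) powr (a - real m)"
    by (simp add: powr_add[symmetric])
  finally show ?thesis .
qed

text \<open>Trades norm z for 1 + \<bar>y\<bar>, whose powers integrate explicitly. For x \<le> 1
  the quotient is at most 1 and (1 + \<bar>y\<bar>) / 2 \<le> 1; for x > 1 the 1 in the denominator
  is dropped and (1 + \<bar>y\<bar>) / 2 \<le> x. The exponent on the right is nonpositive in both
  cases.\<close>

lemma powr_quotient_le:
  fixes x y s d :: real
  assumes x: "0 < x" "\<bar>y\<bar> \<le> x" and s: "0 \<le> s" "s \<le> 1 + d"
  shows "x powr s / (1 + x powr (1 + d)) \<le> 2 powr (1 + d - s) * (1 + \<bar>y\<bar>) powr (- (1 + d - s))"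
proof -
  let ?e = "1 + d - s"
  have rhs: "2 powr ?e * (1 + \<bar>y\<bar>) powr (- ?e) = ((1 + \<bar>y\<bar>) / 2) powr (- ?e)"
  proof -
    have "((1 + \<bar>y\<bar>) / 2) powr (- e) = 2 powr e * (1 + \<bar>y\<bar>) powr (- e)" for e
      by (simp add: powr_divide powr_minus_divide)
    from this[of ?e] show ?thesis by (rule sym)
  qed
  show ?thesis
  proof (cases "x \<le> 1")
    case True
    have "x powr s / (1 + x powr (1 + d)) \<le> 1 / 1"
      using x s True by (intro frac_le powr_le1) auto
    also have "1 / 1 \<le> ((1 + \<bar>y\<bar>) / 2) powr (- ?e)"
    proof -
      have "1 powr (- ?e) \<le> ((1 + \<bar>y\<bar>) / 2) powr (- ?e)"
        using x s True by (intro powr_mono2') auto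
      then show ?thesis by simp
    qed
    finally show ?thesis unfolding rhs .
  next
    case False
    have "x powr s / (1 + x powr (1 + d)) \<le> x powr s / x powr (1 + d)"
      using x by (intro divide_left_mono mult_pos_pos add_pos_pos) auto
    also have "\<dots> = x powr (- ?e)"
      by (simp add: powr_diff[symmetric])
    also have "\<dots> \<le> ((1 + \<bar>y\<bar>) / 2) powr (- ?e)"
      using x s False by (intro powr_mono2') auto
    finally show ?thesis unfolding rhs .
  qed
qed

section \<open>The bias under polynomial decay of the spectrum\<close>

text \<open>The L1 norm of U (h - 1) with U replaced by its majorant, up to the constant c' of the
  decay assumption.\<close>

definition bias :: "real \<Rightarrow> real \<Rightarrow> nat \<Rightarrow> real \<Rightarrow> ennreal" where
  "bias \<sigma> d m N = (\<integral>\<^sup>+y. ennreal (norm (filter_factor m N (Complex \<sigma> y) - 1) /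
     (1 + norm (Complex \<sigma> y) powr (1 + d))) \<partial>lborel)"

text \<open>The Lipschitz bound for the filter costs one power of norm z and leaves the integrable
  exponent - d. The rate saturates at 1 / N because this bound gains only one power of 1 / N,
  however large d is.\<close>

lemma bias_le_if_gt_1:
  assumes "0 < \<sigma>" "0 < N" "1 < d"
  shows "bias \<sigma> d m N \<le> ennreal (real m * 2 powr d * 2 / (d - 1) / N)"
proof -
  have "bias \<sigma> d m N \<le> (\<integral>\<^sup>+y. ennreal (real m * 2 powr d / N) * ennreal ((1 + \<bar>y\<bar> / 1) powr (- d)) \<partial>lborel)"
    unfolding bias_def
  proof (intro nn_integral_mono)
    fix y
    let ?n = "norm (Complex \<sigma> y)"
    have "norm (filter_factor m N (Complex \<sigma> y) - 1) / (1 + ?n powr (1 + d))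
        \<le> real m * (?n / N) / (1 + ?n powr (1 + d))"
      by (intro divide_right_mono norm_filter_factor_minus_1_le assms) (auto intro: add_nonneg_nonneg)
    also have "\<dots> = real m / N * (?n powr 1 / (1 + ?n powr (1 + d)))"
      by simp
    also have "\<dots> \<le> real m / N * (2 powr (1 + d - 1) * (1 + \<bar>y\<bar>) powr (- (1 + d - 1)))"
      using assms norm_Complex_bounds[OF assms(1)] by (intro mult_left_mono powr_quotient_le) auto
    finally show "ennreal (norm (filter_factor m N (Complex \<sigma> y) - 1) / (1 + ?n powr (1 + d)))
        \<le> ennreal (real m * 2 powr d / N) * ennreal ((1 + \<bar>y\<bar> / 1) powr (- d))"
      using assms by (simp add: ennreal_mult[symmetric] ennreal_leI)
  qed
  also have "\<dots> = ennreal (real m * 2 powr d / N) * (\<integral>\<^sup>+y. ennreal ((1 + \<bar>y\<bar> / 1) powr (- d)) \<partial>lborel)"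
    by (intro nn_integral_cmult) measurable
  also have "\<dots> \<le> ennreal (real m * 2 powr d / N) * ennreal (2 * 1 / (- (- d) - 1))"
    using assms by (intro mult_left_mono nn_integral_one_plus_powr) auto
  also have "\<dots> = ennreal (real m * 2 powr d * 2 / (d - 1) / N)"
    using assms by (simp add: ennreal_mult[symmetric] mult.commute)
  finally show ?thesis .
qed

text \<open>Here the Lipschitz bound alone leaves the exponent - 1, whose integral diverges
  logarithmically; the factor ln N is the price. The hypothesis on N makes the interpolation
  parameter at most 1.\<close>

lemma bias_le_if_eq_1:
  assumes "0 < \<sigma>" "exp 1 \<le> N"
  shows "bias \<sigma> 1 m N \<le> ennreal (real (max 2 m) * 8 * exp 1 * (ln N / N))"
proof -
  \<comment> \<open>Interpolating with exponent \<open>1 - \<theta>\<close> costs a factor \<open>1 / \<theta>\<close>, while \<open>N\<^bsup>\<theta>\<^esup> = exp 1\<close>.\<close>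
  define \<theta> where "\<theta> = 1 / ln N"
  have N: "1 \<le> N" "0 < N" and ln: "1 \<le> ln N"
    using assms(2) exp_ge_add_one_self[of 1] ln_ge_iff[of N 1] exp_gt_zero[of 1] by linarith+
  have \<theta>: "0 < \<theta>" "\<theta> \<le> 1"
    using ln by (auto simp: \<theta>_def)
  have N\<theta>: "N powr \<theta> = exp 1"
  proof -
    have "\<theta> * ln N = 1"
      using ln by (simp add: \<theta>_def)
    then show ?thesis
      using N by (simp add: powr_def)
  qed
  \<comment> \<open>Large enough for both bounds of the filter: m for norm z \<le> N and 2 for norm
    z > N.\<close>
  let ?M = "real (max 2 m)"
  have "bias \<sigma> 1 m N \<le> (\<integral>\<^sup>+y. ennreal (?M * 4 * exp 1 / N) * ennreal ((1 + \<bar>y\<bar> / 1) powr (- (1 + \<theta>))) \<partial>lborel)"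
    unfolding bias_def
  proof (intro nn_integral_mono)
    fix y
    let ?n = "norm (Complex \<sigma> y)"
    note n = norm_Complex_bounds[OF assms(1), of y]
    have "norm (filter_factor m N (Complex \<sigma> y) - 1) \<le> ?M * (?n / N) powr (1 - \<theta>)"
    proof (cases "?n / N \<le> 1")
      case True
      have "norm (filter_factor m N (Complex \<sigma> y) - 1) \<le> real m * (?n / N)"
        by (intro norm_filter_factor_minus_1_le assms N)
      also have "\<dots> \<le> ?M * (?n / N) powr (1 - \<theta>)"
        using powr_mono'[of "1 - \<theta>" 1 "?n / N"] True n N \<theta> by (intro mult_mono) auto
      finally show ?thesis .
    next
      case False
      have "norm (filter_factor m N (Complex \<sigma> y) - 1) \<le> 2 * 1"
        using norm_filter_factor_minus_1_le(1)[OF assms(1) N(2), of m y] by simp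
      also have "\<dots> \<le> ?M * (?n / N) powr (1 - \<theta>)"
        using False \<theta> by (intro mult_mono ge_one_powr_ge_zero) auto
      finally show ?thesis .
    qed
    also have "(?n / N) powr (1 - \<theta>) = exp 1 / N * ?n powr (1 - \<theta>)"
      using N n N\<theta> by (simp add: powr_divide powr_diff)
    finally have "norm (filter_factor m N (Complex \<sigma> y) - 1) / (1 + ?n powr (1 + 1))
        \<le> ?M * (exp 1 / N * ?n powr (1 - \<theta>)) / (1 + ?n powr (1 + 1))"
      by (intro divide_right_mono) (auto intro: add_nonneg_nonneg)
    also have "\<dots> = ?M * exp 1 / N * (?n powr (1 - \<theta>) / (1 + ?n powr (1 + 1)))"
      by simp
    also have "\<dots> \<le> ?M * exp 1 / N * (2 powr (1 + 1 - (1 - \<theta>)) * (1 + \<bar>y\<bar>) powr (- (1 + 1 - (1 - \<theta>))))"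
      using N \<theta> n by (intro mult_left_mono powr_quotient_le) auto
    also have "\<dots> \<le> ?M * exp 1 / N * (2 powr 2 * (1 + \<bar>y\<bar>) powr (- (1 + \<theta>)))"
      using N \<theta> by (intro mult_left_mono mult_mono powr_mono) auto
    finally show "ennreal (norm (filter_factor m N (Complex \<sigma> y) - 1) / (1 + ?n powr (1 + 1)))
        \<le> ennreal (?M * 4 * exp 1 / N) * ennreal ((1 + \<bar>y\<bar> / 1) powr (- (1 + \<theta>)))"
      using N by (simp add: ennreal_mult[symmetric] ennreal_leI mult_ac)
  qed
  also have "\<dots> = ennreal (?M * 4 * exp 1 / N) * (\<integral>\<^sup>+y. ennreal ((1 + \<bar>y\<bar> / 1) powr (- (1 + \<theta>))) \<partial>lborel)"
    by (intro nn_integral_cmult) measurable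
  also have "\<dots> \<le> ennreal (?M * 4 * exp 1 / N) * ennreal (2 * 1 / (- (- (1 + \<theta>)) - 1))"
    using \<theta> by (intro mult_left_mono nn_integral_one_plus_powr) auto
  also have "\<dots> = ennreal (?M * 4 * exp 1 / N * (2 * 1 / (- (- (1 + \<theta>)) - 1)))"
    using N \<theta> by (intro ennreal_mult[symmetric]) auto
  also have "?M * 4 * exp 1 / N * (2 * 1 / (- (- (1 + \<theta>)) - 1)) = ?M * 8 * exp 1 * (ln N / N)"
    using ln by (simp add: \<theta>_def)
  finally show ?thesis .
qed

text \<open>Dropping the 1 in the decay factor makes the majorant homogeneous apart from the filter.
  After y = N s the power N^(-d) comes out, and what remains is an integral independent of
  N.\<close>

lemma bias_le_if_less_1:
  assumes "0 < \<sigma>" "0 < d" "d < 1"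
  shows "\<exists>C\<ge>0. \<forall>N>0. bias \<sigma> d m N \<le> ennreal (C * N powr (- d))"
proof -
  let ?I = "\<integral>\<^sup>+s. ennreal (\<bar>s\<bar> powr (- d) / (1 + \<bar>s\<bar>)) \<partial>lborel"
  let ?M = "2 * real (max 2 m)"
  have I: "?I = ennreal (enn2real ?I)"
    using nn_integral_powr_over_one_plus_finite[OF assms(2,3)] by simp
  show ?thesis
  proof (intro exI[of _ "?M * enn2real ?I"] conjI allI impI)
    fix N :: real assume N: "0 < N"
    have "bias \<sigma> d m N \<le> (\<integral>\<^sup>+y. ennreal (?M * N powr (- d) / N) * ennreal (\<bar>y / N\<bar> powr (- d) / (1 + \<bar>y / N\<bar>)) \<partial>lborel)"
      unfolding bias_def
    proof (intro nn_integral_mono_AE)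
      \<comment> \<open>The point y = 0 has to be excluded: \<open>0 powr (- d)\<close> is 0, so the
        majorant vanishes there.\<close>
      show "AE y in lborel. ennreal (norm (filter_factor m N (Complex \<sigma> y) - 1) / (1 + norm (Complex \<sigma> y) powr (1 + d)))
        \<le> ennreal (?M * N powr (- d) / N) * ennreal (\<bar>y / N\<bar> powr (- d) / (1 + \<bar>y / N\<bar>))"
        using AE_lborel_singleton[of "0::real"]
      proof eventually_elim
        case (elim y)
        let ?n = "norm (Complex \<sigma> y)"
        note n = norm_Complex_bounds[OF assms(1), of y]
        \<comment> \<open>\<open>min 1 r \<le> 2 r / (1 + r)\<close> with \<open>r = ?n / N\<close>\<close>
        have "norm (filter_factor m N (Complex \<sigma> y) - 1) * (1 + ?n / N) \<le> ?M * (?n / N)"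
        proof (cases "?n / N \<le> 1")
          case True
          have "norm (filter_factor m N (Complex \<sigma> y) - 1) * (1 + ?n / N) \<le> (real m * (?n / N)) * 2"
            using True N by (intro mult_mono norm_filter_factor_minus_1_le assms) auto
          also have "\<dots> \<le> (real (max 2 m) * (?n / N)) * 2"
            using N by (intro mult_right_mono) auto
          finally show ?thesis by (simp only: mult_ac)
        next
          case False
          then have "1 + ?n / N \<le> 2 * (?n / N)"
            by linarith
          then have "norm (filter_factor m N (Complex \<sigma> y) - 1) * (1 + ?n / N) \<le> 2 * (2 * (?n / N))"
            using N n by (intro mult_mono norm_filter_factor_minus_1_le assms) auto
          also have "\<dots> \<le> real (max 2 m) * (2 * (?n / N))"
            using N by (intro mult_right_mono) auto
          finally show ?thesis by (simp only: mult_ac)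
        qed
        then have "norm (filter_factor m N (Complex \<sigma> y) - 1) \<le> ?M * (?n / N) / (1 + ?n / N)"
          using N n by (subst pos_le_divide_eq) (auto intro: add_pos_pos)
        then have "norm (filter_factor m N (Complex \<sigma> y) - 1) / (1 + ?n powr (1 + d))
            \<le> ?M * (?n / N) / (1 + ?n / N) / (?n powr (1 + d))"
          using n N by (intro frac_le) (auto intro: add_pos_pos divide_nonneg_nonneg add_nonneg_nonneg)
        also have "\<dots> = ?M / N * (?n powr (- d) / (1 + ?n / N))"
          using n by (simp add: powr_add powr_minus divide_simps)
        also have "\<dots> \<le> ?M / N * (\<bar>y\<bar> powr (- d) / (1 + \<bar>y\<bar> / N))"
          using n N elim assms
          by (intro mult_left_mono frac_le powr_mono2' add_left_mono divide_right_mono) (auto intro: add_pos_nonneg)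
        also have "\<bar>y\<bar> powr (- d) = N powr (- d) * \<bar>y / N\<bar> powr (- d)"
          using N by (simp add: powr_mult[symmetric] abs_divide)
        also have "?M / N * (N powr (- d) * \<bar>y / N\<bar> powr (- d) / (1 + \<bar>y\<bar> / N))
            = (?M * N powr (- d) / N) * (\<bar>y / N\<bar> powr (- d) / (1 + \<bar>y / N\<bar>))"
          using N by (simp add: abs_divide)
        finally show ?case
          using N by (subst ennreal_mult[symmetric]) (auto intro: ennreal_leI)
      qed
    qed
    also have "\<dots> = ennreal (?M * N powr (- d) / N) * (\<integral>\<^sup>+y. ennreal (\<bar>y / N\<bar> powr (- d) / (1 + \<bar>y / N\<bar>)) \<partial>lborel)"
      by (intro nn_integral_cmult) measurable
    also have "(\<integral>\<^sup>+y. ennreal (\<bar>y / N\<bar> powr (- d) / (1 + \<bar>y / N\<bar>)) \<partial>lborel)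
        = ennreal \<bar>N\<bar> * (\<integral>\<^sup>+s. ennreal (\<bar>(0 + N * s) / N\<bar> powr (- d) / (1 + \<bar>(0 + N * s) / N\<bar>)) \<partial>lborel)"
      using N by (intro nn_integral_real_affine) auto
    also have "\<dots> = ennreal N * ennreal (enn2real ?I)"
      using N by (subst I[symmetric]) simp
    also have "ennreal (?M * N powr (- d) / N) * (ennreal N * ennreal (enn2real ?I)) = ennreal (?M * enn2real ?I * N powr (- d))"
      using N by (simp add: ennreal_mult[symmetric] mult_ac)
    finally show "bias \<sigma> d m N \<le> ennreal (?M * enn2real ?I * N powr (- d))" .
  qed simp
qed

section \<open>Regularised solutions of the Volterra equation\<close>

lemma measurable_laplace_line:
  assumes "damp \<sigma> h \<in> borel_measurable borel"
  shows "(\<lambda>y. laplace h (Complex \<sigma> y)) \<in> borel_measurable borel"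
  unfolding laplace_eq_fourier_damp using measurable_fourier[OF assms] by measurable

text \<open>\<open>real_of_ereal\<close> would send an infinite essential supremum to 0, so it is
  bounded on both sides first. The lower bound uses T > 0: the interval has positive measure and the
  function 0 has essential supremum 0 on it.\<close>

lemma norm_LinfI:
  assumes "0 < T" and e [measurable]: "e \<in> borel_measurable borel"
    and bd: "AE t in lborel. 0 < t \<longrightarrow> t < T \<longrightarrow> norm (e t) \<le> B"
  shows "in_Linf T e" "0 \<le> norm_Linf T e" "norm_Linf T e \<le> B"
proof -
  let ?R = "restrict_space lborel {0<..<T}"
  have meas: "(\<lambda>t. ereal (norm (e t))) \<in> borel_measurable ?R"
    by (intro measurable_restrict_space1) measurable
  have "AE t in ?R. ereal (norm (e t)) \<le> ereal B"
    using bd by (subst AE_restrict_space_iff) (auto elim!: eventually_mono)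
  then have le: "esssup_norm T e \<le> ereal B"
    unfolding esssup_norm_def using meas by (intro esssup_I)
  have "emeasure ?R (space ?R) \<noteq> 0"
    using \<open>0 < T\<close> by (simp add: emeasure_restrict_space space_restrict_space)
  then have "esssup ?R (\<lambda>t. 0::ereal) = 0"
    by (rule esssup_const)
  moreover have "esssup ?R (\<lambda>t. 0::ereal) \<le> esssup_norm T e"
    unfolding esssup_norm_def by (intro esssup_mono) auto
  ultimately have ge: "0 \<le> esssup_norm T e"
    by simp
  show "in_Linf T e"
    unfolding in_Linf_def set_borel_measurable_def using le by (auto simp: less_le_trans)
  show "0 \<le> norm_Linf T e"
    unfolding norm_Linf_def using ge by (rule real_of_ereal_pos)
  show "norm_Linf T e \<le> B"
    unfolding norm_Linf_def using le ge by (cases "esssup_norm T e") auto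
qed

lemma norm_L2wI:
  assumes e [measurable]: "e \<in> borel_measurable borel" and "0 \<le> B"
    and bd: "(\<integral>\<^sup>+t. ennreal ((norm (e t))\<^sup>2 * exp (-2 * \<sigma> * t)) \<partial>lborel) \<le> ennreal B"
  shows "in_L2w \<sigma> e" "norm_L2w \<sigma> e \<le> sqrt B"
proof -
  let ?f = "\<lambda>t. indicator {0..} t *\<^sub>R ((norm (e t))\<^sup>2 * exp (-2 * \<sigma> * t))"
  have le: "(\<integral>\<^sup>+t. ennreal (?f t) \<partial>lborel) \<le> ennreal B"
    by (rule order_trans[OF nn_integral_mono bd]) (auto intro!: ennreal_leI split: split_indicator)
  then have int: "integrable lborel ?f"
    by (intro integrableI_nonneg) (auto simp: less_top[symmetric] top_unique)
  then show "in_L2w \<sigma> e"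
    by (simp add: in_L2w_def set_integrable_def set_borel_measurable_def)
  have "ennreal (LINT t|lborel. ?f t) \<le> ennreal B"
    using le int by (subst nn_integral_eq_integral[symmetric]) auto
  then have "(LINT t|lborel. ?f t) \<le> B"
    using \<open>0 \<le> B\<close> by (simp add: ennreal_le_iff)
  then show "norm_L2w \<sigma> e \<le> sqrt B"
    by (simp add: norm_L2w_def set_lebesgue_integral_def)
qed

text \<open>Hypotheses shared by the three parts. The space of u, the size of m and the decay of the
  spectrum vary from part to part and are stated with each lemma.\<close>

locale volterra_problem =
  fixes \<sigma> c a :: real and m :: nat and k u g :: "real \<Rightarrow> complex"
  assumes \<sigma>: "0 < \<sigma>" and c: "0 < c" and causal_u: "causal u"
    and k_meas [measurable]: "k \<in> borel_measurable borel"
    and k_int: "set_integrable lborel {0..} (\<lambda>t. exp (- \<sigma> * t) * norm (k t))"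
    and u_laplace: "\<And>z. z \<in> Cline \<sigma> \<Longrightarrow> has_laplace_at u z"
    and g_eq: "\<And>t. 0 \<le> t \<Longrightarrow> g t = volterra_conv k u t"
    and K_ge: "\<And>z. z \<in> Cline \<sigma> \<Longrightarrow> c * norm z powr (- a) \<le> norm (laplace k z)"
begin

abbreviation "h N y \<equiv> filter_factor m N (Complex \<sigma> y)"
abbreviation "U y \<equiv> laplace u (Complex \<sigma> y)"

lemma Cline_Complex [simp]: "Complex \<sigma> y \<in> Cline \<sigma>"
  by (simp add: Cline_def)

lemma integrable_damp_k: "integrable lborel (damp \<sigma> k)"
proof (rule Bochner_Integration.integrable_bound)
  show "integrable lborel (\<lambda>t. indicator {0..} t *\<^sub>R (exp (- \<sigma> * t) * norm (k t)))"
    using k_int by (simp add: set_integrable_def)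
  show "damp \<sigma> k \<in> borel_measurable lborel"
    unfolding damp_def[abs_def] by measurable
qed (auto simp: damp_def norm_mult split: split_indicator)

lemma integrable_damp_u: "integrable lborel (damp \<sigma> u)"
proof -
  have "exp (- Complex \<sigma> 0 * of_real t) = of_real (exp (- \<sigma> * t))" for t
  proof -
    have "- Complex \<sigma> 0 * of_real t = of_real (- \<sigma> * t)"
      by (simp add: complex_eq_iff)
    then show ?thesis by (simp only: exp_of_real)
  qed
  then show ?thesis
    using u_laplace[OF Cline_Complex[of 0]]
    by (simp only: has_laplace_at_def set_integrable_def damp_def[abs_def])
qed

text \<open>Causality supplies the negative axis. Measurability of u on the whole line is then
  inherited from the integrable function \<open>damp \<sigma> u\<close>.\<close>

lemma u_eq_damp: "u t = of_real (exp (\<sigma> * t)) * damp \<sigma> u t"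
proof (cases "0 \<le> t")
  case True
  have "of_real (exp (\<sigma> * t)) * (of_real (exp (- \<sigma> * t)) * u t) = of_real (exp (\<sigma> * t) * exp (- \<sigma> * t)) * u t"
    by (simp only: of_real_mult mult.assoc)
  also have "\<dots> = u t"
    by (simp add: exp_minus)
  finally show ?thesis
    using True by (simp add: damp_def)
next
  case False
  then show ?thesis
    using causal_u by (simp add: damp_def causal_def)
qed

lemma measurable_u [measurable]: "u \<in> borel_measurable borel"
proof -
  have [measurable]: "damp \<sigma> u \<in> borel_measurable borel"
    using borel_measurable_integrable[OF integrable_damp_u] by simp
  show ?thesis
    by (subst u_eq_damp[abs_def]) measurable
qed

lemma measurable_K [measurable]: "(\<lambda>y. laplace k (Complex \<sigma> y)) \<in> borel_measurable borel"
  using borel_measurable_integrable[OF integrable_damp_k] by (intro measurable_laplace_line) simp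

lemma measurable_U [measurable]: "(\<lambda>y. U y) \<in> borel_measurable borel"
  using borel_measurable_integrable[OF integrable_damp_u] by (intro measurable_laplace_line) simp

lemma measurable_h [measurable]: "(\<lambda>y. h N y) \<in> borel_measurable borel"
proof -
  have "Complex \<sigma> y = of_real \<sigma> + \<i> * of_real y" for y
    by (simp add: complex_eq_iff)
  then show ?thesis
    unfolding filter_factor_def by simp
qed

lemma
  shows integrable_damp_g: "integrable lborel (damp \<sigma> g)"
    and laplace_g: "laplace g (Complex \<sigma> y) = laplace k (Complex \<sigma> y) * U y"
  using fourier_convolution(1)[OF integrable_damp_k integrable_damp_u]
    fourier_convolution(2)[OF integrable_damp_k integrable_damp_u, of "- y"]
  by (simp_all only: laplace_eq_fourier_damp damp_volterra_conv[of g k u \<sigma>, OF g_eq])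

lemma laplace_k_nonzero: "laplace k (Complex \<sigma> y) \<noteq> 0"
proof
  assume "laplace k (Complex \<sigma> y) = 0"
  then have "c * norm (Complex \<sigma> y) powr (- a) \<le> 0"
    using K_ge[OF Cline_Complex[of y]] by simp
  moreover have "0 < c * norm (Complex \<sigma> y) powr (- a)"
    using c norm_Complex_bounds(3)[OF \<sigma>, of y] by simp
  ultimately show False by simp
qed

lemma inverse_laplace_k_g: "inverse (laplace k (Complex \<sigma> y)) * laplace g (Complex \<sigma> y) = U y"
  by (simp add: laplace_g laplace_k_nonzero)

lemma norm_inverse_laplace_k_le:
  "norm (inverse (laplace k (Complex \<sigma> y))) \<le> norm (Complex \<sigma> y) powr a / c"
proof -
  let ?n = "norm (Complex \<sigma> y)"
  have "0 < c * ?n powr (- a)"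
    using c norm_Complex_bounds(3)[OF \<sigma>, of y] by simp
  with K_ge[OF Cline_Complex[of y]]
  have "inverse (norm (laplace k (Complex \<sigma> y))) \<le> inverse (c * ?n powr (- a))"
    by (rule le_imp_inverse_le)
  also have "\<dots> = ?n powr a / c"
    by (simp add: powr_minus divide_inverse mult.commute)
  finally show ?thesis
    by (simp add: norm_inverse)
qed

text \<open>Makes powers with exponent a monotone in the modulus and the exponents a + 2 and a + d +
  1 positive.\<close>

lemma a_nonneg: "0 \<le> a"
proof (rule ccontr)
  \<comment> \<open>\<open>K\<close> is bounded on the line.\<close>
  assume "\<not> 0 \<le> a"
  then have a: "0 < - a" by simp
  define B where "B = (LINT t|lborel. norm (damp \<sigma> k t))"
  have B: "0 \<le> B"
    by (simp add: B_def)
  \<comment> \<open>Chosen such that y^(-a) = B / c + 1; the lower bound for K at this point is then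
    at least B + c, above its upper bound B.\<close>
  define y where "y = (B / c + 1) powr (1 / (- a))"
  have "0 < B / c + 1"
    using B c by (intro add_nonneg_pos) auto
  then have "y powr (- a) = B / c + 1"
    using a by (simp add: y_def powr_powr)
  moreover have "y powr (- a) \<le> norm (Complex \<sigma> y) powr (- a)"
    using a norm_Complex_bounds(1)[OF \<sigma>, of y] by (intro powr_mono2) (auto simp: y_def)
  ultimately have "c * (B / c + 1) \<le> c * norm (Complex \<sigma> y) powr (- a)"
    using c by (intro mult_left_mono) auto
  also have "\<dots> \<le> norm (laplace k (Complex \<sigma> y))"
    by (rule K_ge) simp
  also have "\<dots> \<le> B"
    unfolding B_def laplace_eq_fourier_damp by (rule norm_fourier_le[OF integrable_damp_k])
  finally show False
    using c by (simp add: distrib_left)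
qed

text \<open>Collects 2^m from the filter, the power from the growth of 1 / K, 1 / c from the lower
  bound for K, and 1 / \<sigma> from transforming bounded noise.\<close>

definition noise_gain :: "real \<Rightarrow> real" where
  "noise_gain N = 2 ^ m * max \<sigma> N powr a / (\<sigma> * c)"

lemma noise_gain_nonneg: "0 \<le> noise_gain N"
  using \<sigma> c by (simp add: noise_gain_def)

abbreviation "reg_spectrum N f z \<equiv> inverse (laplace k z) * laplace f z * filter_factor m N z"

lemma u_approx_eq: "u_approx \<sigma> k m N f = inversion \<sigma> (reg_spectrum N f)"
  by (simp add: u_approx_def filter_factor_def)

text \<open>E is the filtered noise \<open>K\<^sup>-\<^sup>1 W h\<close>. Its one pointwise bound
  serves both norms: integrated directly it gives the L1 estimate, squared first the L2
  estimate.\<close>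

lemma reg_spectrum_decomposition:
  assumes "noisy_data g gd" and \<delta>: "0 < \<delta>" and N: "0 < N"
  obtains E where "E \<in> borel_measurable borel"
    "\<And>y. reg_spectrum N (gd \<delta>) (Complex \<sigma> y) = U y * h N y + E y"
    "\<And>y. norm (E y) \<le> \<delta> * noise_gain N * (1 + \<bar>y\<bar> / N) powr (a - real m)"
proof -
  let ?w = "\<lambda>t. gd \<delta> t - g t"
  have gd: "set_borel_measurable lborel {0..} (gd \<delta>)" and bd: "\<And>t. 0 \<le> t \<Longrightarrow> norm (?w t) \<le> \<delta>"
    using assms by (auto simp: noisy_data_def)
  have "damp \<sigma> (gd \<delta>) = (\<lambda>t. of_real (exp (- \<sigma> * t)) * (indicator {0..} t *\<^sub>R gd \<delta> t))"
    by (auto simp: damp_def fun_eq_iff)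
  moreover have "(\<lambda>t. indicator {0..} t *\<^sub>R gd \<delta> t) \<in> borel_measurable borel"
    using gd by (simp add: set_borel_measurable_def)
  then have "(\<lambda>t. of_real (exp (- \<sigma> * t)) * (indicator {0..} t *\<^sub>R gd \<delta> t)) \<in> borel_measurable borel"
    by (rule borel_measurable_times[rotated]) measurable
  ultimately have [measurable]: "damp \<sigma> (gd \<delta>) \<in> borel_measurable borel"
    by (simp only:)
  have [measurable]: "damp \<sigma> g \<in> borel_measurable borel"
    using borel_measurable_integrable[OF integrable_damp_g] by simp
  have w_eq: "damp \<sigma> ?w = (\<lambda>t. damp \<sigma> (gd \<delta>) t - damp \<sigma> g t)"
    by (auto simp: damp_def fun_eq_iff algebra_simps)
  have w_meas [measurable]: "damp \<sigma> ?w \<in> borel_measurable borel"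
    unfolding w_eq by measurable
  have w_int: "integrable lborel (damp \<sigma> ?w)"
    and w_le: "norm (fourier (damp \<sigma> ?w) x) \<le> \<delta> / \<sigma>" for x
    using damp_noise[OF w_meas bd \<sigma>] \<delta> by auto
  \<comment> \<open>The noisy data carry no growth condition of their own; on \<open>{0..}\<close>
    they are a bounded perturbation of g.\<close>
  have gd_int: "integrable lborel (damp \<sigma> (gd \<delta>))"
    using Bochner_Integration.integrable_add[OF w_int integrable_damp_g] by (simp add: w_eq)
  define W where "W y = laplace ?w (Complex \<sigma> y)" for y
  have W: "laplace (gd \<delta>) (Complex \<sigma> y) = laplace g (Complex \<sigma> y) + W y" for y
    using fourier_diff[OF gd_int integrable_damp_g, of "- y"]
    by (simp add: W_def laplace_eq_fourier_damp w_eq diff_eq_eq add.commute)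
  have [measurable]: "W \<in> borel_measurable borel"
    unfolding W_def by (intro measurable_laplace_line) measurable
  define E where "E y = inverse (laplace k (Complex \<sigma> y)) * W y * h N y" for y
  show thesis
  proof
    show "E \<in> borel_measurable borel"
      unfolding E_def by measurable
    fix y
    have "reg_spectrum N (gd \<delta>) (Complex \<sigma> y)
        = (inverse (laplace k (Complex \<sigma> y)) * laplace g (Complex \<sigma> y)) * h N y + E y"
      by (simp add: W E_def algebra_simps)
    then show "reg_spectrum N (gd \<delta>) (Complex \<sigma> y) = U y * h N y + E y"
      by (simp only: inverse_laplace_k_g)
    have "norm (E y) \<le> (norm (Complex \<sigma> y) powr a / c) * (\<delta> / \<sigma>) * norm (h N y)"
      unfolding E_def norm_mult W_def laplace_eq_fourier_damp[of ?w]
      using \<sigma> c \<delta> by (intro mult_mono norm_inverse_laplace_k_le w_le mult_nonneg_nonneg) auto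
    also have "\<dots> = \<delta> / (\<sigma> * c) * (norm (Complex \<sigma> y) powr a * norm (h N y))"
      by (simp add: mult_ac)
    also have "\<dots> \<le> \<delta> / (\<sigma> * c) * (2 ^ m * max \<sigma> N powr a * (1 + \<bar>y\<bar> / N) powr (a - real m))"
      using \<sigma> c \<delta> by (intro mult_left_mono powr_norm_filter_factor_le N a_nonneg) auto
    finally show "norm (E y) \<le> \<delta> * noise_gain N * (1 + \<bar>y\<bar> / N) powr (a - real m)"
      by (simp add: noise_gain_def)
  qed
qed

section \<open>The error in the essential supremum norm\<close>

text \<open>On (0, T) the inversion integral is bounded by exp (\<sigma> T) / (2 pi) times the L1
  norm of the spectrum. J bounds the bias and the other summand the noise, whose majorant is
  integrable because a - m < -1.\<close>

lemma sup_error: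
  assumes U: "integrable lborel (\<lambda>y. U y)" and m: "a + 1 < real m"
    and gd: "noisy_data g gd" and \<delta>: "0 < \<delta>" and N: "0 < N" and T: "0 < T"
    and J: "0 \<le> J" "(\<integral>\<^sup>+y. ennreal (norm (U y) * norm (h N y - 1)) \<partial>lborel) \<le> ennreal J"
  defines "e \<equiv> \<lambda>t. u_approx \<sigma> k m N (gd \<delta>) t - u t"
  shows "in_Linf T e" "0 \<le> norm_Linf T e"
    "norm_Linf T e \<le> exp (\<sigma> * T) / (2 * pi) * (J + \<delta> * noise_gain N * (2 * N / (real m - a - 1)))"
proof -
  obtain E where [measurable]: "E \<in> borel_measurable borel"
    and F_eq: "\<And>y. reg_spectrum N (gd \<delta>) (Complex \<sigma> y) = U y * h N y + E y"
    and E_le: "\<And>y. norm (E y) \<le> \<delta> * noise_gain N * (1 + \<bar>y\<bar> / N) powr (a - real m)"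
    using reg_spectrum_decomposition[OF gd \<delta> N] by metis
  let ?F = "\<lambda>y. reg_spectrum N (gd \<delta>) (Complex \<sigma> y)"
  let ?Q = "\<delta> * noise_gain N * (2 * N / (real m - a - 1))"
  have Q: "0 \<le> ?Q"
    using m N \<delta> noise_gain_nonneg by simp
  have E_int: "(\<integral>\<^sup>+y. ennreal (norm (E y)) \<partial>lborel) \<le> ennreal ?Q"
  proof -
    have "(\<integral>\<^sup>+y. ennreal (norm (E y)) \<partial>lborel)
        \<le> (\<integral>\<^sup>+y. ennreal (\<delta> * noise_gain N) * ennreal ((1 + \<bar>y\<bar> / N) powr (a - real m)) \<partial>lborel)"
      using E_le \<delta> noise_gain_nonneg
      by (intro nn_integral_mono) (simp add: ennreal_mult[symmetric] ennreal_leI)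
    also have "\<dots> = ennreal (\<delta> * noise_gain N) * (\<integral>\<^sup>+y. ennreal ((1 + \<bar>y\<bar> / N) powr (a - real m)) \<partial>lborel)"
      by (intro nn_integral_cmult) measurable
    also have "\<dots> \<le> ennreal (\<delta> * noise_gain N) * ennreal (2 * N / (- (a - real m) - 1))"
      using m N by (intro mult_left_mono nn_integral_one_plus_powr) auto
    also have "\<dots> = ennreal ?Q"
      using m N \<delta> noise_gain_nonneg by (subst ennreal_mult[symmetric]) (auto simp: algebra_simps)
    finally show ?thesis .
  qed
  then have E: "integrable lborel E"
    by (intro integrableI_bounded) (auto simp: less_top[symmetric] top_unique)
  have Uh: "integrable lborel (\<lambda>y. U y * h N y)"
    using norm_filter_factor_le(1)[OF \<sigma> N]
    by (intro Bochner_Integration.integrable_bound[OF U])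
       (auto simp: norm_mult intro!: AE_I2 mult_left_le)
  have F: "integrable lborel ?F"
    unfolding F_eq using Uh E by (intro Bochner_Integration.integrable_add)
  have [measurable]: "?F \<in> borel_measurable borel"
    using borel_measurable_integrable[OF F] by simp
  \<comment> \<open>An integrable spectrum selects the branch \<open>inv_full\<close>, so the
    approximation is given pointwise.\<close>
  have approx: "u_approx \<sigma> k m N (gd \<delta>) t = of_real (exp (\<sigma> * t) / (2 * pi)) * fourier ?F t" for t
    using F by (simp add: u_approx_eq inversion_def integrable_Cline_def inv_full_eq)
  have diff_le: "ennreal (norm (fourier ?F t - fourier (\<lambda>y. U y) t)) \<le> ennreal (J + ?Q)" for t
  proof -
    have "ennreal (norm (fourier ?F t - fourier (\<lambda>y. U y) t))
        \<le> (\<integral>\<^sup>+y. ennreal (norm (iexp (t * y) * (?F y - U y))) \<partial>lborel)"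
      unfolding fourier_diff[OF F U] fourier_def[of "\<lambda>y. ?F y - U y"] by (rule ennreal_norm_integral_le)
    also have "\<dots> \<le> (\<integral>\<^sup>+y. ennreal (norm (U y) * norm (h N y - 1)) + ennreal (norm (E y)) \<partial>lborel)"
    proof (intro nn_integral_mono)
      fix y
      have "?F y - U y = U y * (h N y - 1) + E y"
        unfolding F_eq by (simp add: algebra_simps)
      then have "norm (?F y - U y) \<le> norm (U y) * norm (h N y - 1) + norm (E y)"
        using norm_triangle_ineq[of "U y * (h N y - 1)" "E y"] by (simp only: norm_mult)
      then show "ennreal (norm (iexp (t * y) * (?F y - U y))) \<le> ennreal (norm (U y) * norm (h N y - 1)) + ennreal (norm (E y))"
        by (subst ennreal_plus[symmetric]) (auto simp: norm_mult intro!: ennreal_leI simp del: ennreal_plus)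
    qed
    also have "\<dots> = (\<integral>\<^sup>+y. ennreal (norm (U y) * norm (h N y - 1)) \<partial>lborel) + (\<integral>\<^sup>+y. ennreal (norm (E y)) \<partial>lborel)"
      by (intro nn_integral_add) measurable
    also have "\<dots> \<le> ennreal J + ennreal ?Q"
      by (intro add_mono J E_int)
    also have "\<dots> = ennreal (J + ?Q)"
      using J Q by (subst ennreal_plus) auto
    finally show ?thesis .
  qed
  \<comment> \<open>Inversion recovers u only almost everywhere, which suffices for an essential
    supremum.\<close>
  have "AE t in lborel. fourier (\<lambda>y. U y) t = 2 * of_real pi * damp \<sigma> u t"
    using fourier_inversion_L1[OF integrable_damp_u] U by (simp add: laplace_eq_fourier_damp)
  then have AE_le: "AE t in lborel. 0 < t \<longrightarrow> t < T \<longrightarrow> norm (e t) \<le> exp (\<sigma> * T) / (2 * pi) * (J + ?Q)"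
  proof eventually_elim
    case (elim t)
    show ?case
    proof (intro impI)
      assume t: "0 < t" "t < T"
      have "u t = of_real (exp (\<sigma> * t) / (2 * pi)) * fourier (\<lambda>y. U y) t"
        by (subst u_eq_damp) (simp add: elim)
      then have "e t = of_real (exp (\<sigma> * t) / (2 * pi)) * (fourier ?F t - fourier (\<lambda>y. U y) t)"
        by (simp only: e_def approx right_diff_distrib)
      then have "norm (e t) = exp (\<sigma> * t) / (2 * pi) * norm (fourier ?F t - fourier (\<lambda>y. U y) t)"
        by (simp only: norm_mult norm_of_real) simp
      also have "\<dots> \<le> exp (\<sigma> * T) / (2 * pi) * (J + ?Q)"
        using t \<sigma> diff_le[of t] J Q
        by (intro mult_mono divide_right_mono) (auto simp: ennreal_le_iff simp del: ennreal_plus)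
      finally show "norm (e t) \<le> exp (\<sigma> * T) / (2 * pi) * (J + ?Q)" .
    qed
  qed
  have meas: "e \<in> borel_measurable borel"
    unfolding e_def approx[abs_def] by measurable
  show "in_Linf T e" "0 \<le> norm_Linf T e" "norm_Linf T e \<le> exp (\<sigma> * T) / (2 * pi) * (J + ?Q)"
    by (rule norm_LinfI[OF T meas AE_le])+
qed

section \<open>The error in the weighted L2 norm\<close>

lemma energy_damp_u:
  assumes "in_L2w \<sigma> u"
  shows "energy (damp \<sigma> u) < \<infinity>"
proof -
  have "indicator {0..} t *\<^sub>R ((norm (u t))\<^sup>2 * exp (-2 * \<sigma> * t)) = (norm (damp \<sigma> u t))\<^sup>2" for t
  proof -
    have "exp (-2 * \<sigma> * t) = (exp (- \<sigma> * t))\<^sup>2"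
      by (simp add: exp_double[symmetric])
    then show ?thesis
      by (simp add: damp_def norm_mult power_mult_distrib split: split_indicator)
  qed
  then have "integrable lborel (\<lambda>t. (norm (damp \<sigma> u t))\<^sup>2)"
    using assms by (simp add: in_L2w_def set_integrable_def)
  then show ?thesis
    by (simp add: nn_integral_eq_integral)
qed

lemma energy_U:
  assumes "in_L2w \<sigma> u"
  shows "energy (\<lambda>y. U y) < \<infinity>"
proof -
  have [measurable]: "damp \<sigma> u \<in> borel_measurable borel"
    using borel_measurable_integrable[OF integrable_damp_u] by simp
  have "energy (\<lambda>y. U y) = energy (fourier (damp \<sigma> u))"
    using nn_integral_real_affine[of "\<lambda>y. ennreal ((norm (fourier (damp \<sigma> u) y))\<^sup>2)" "-1" 0]
    by (simp add: laplace_eq_fourier_damp)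
  also have "\<dots> \<le> ennreal (2 * pi) * energy (damp \<sigma> u)"
    by (intro nn_integral_fourier_square_le integrable_damp_u)
  also have "\<dots> < \<infinity>"
    using energy_damp_u[OF assms] by (simp add: ennreal_mult_less_top)
  finally show ?thesis .
qed

text \<open>Some L2 limit z exists, and inversion identifies it with the unweighted u almost
  everywhere. Replacing z on a null set changes no energy.\<close>

lemma is_L2_inversion_u:
  assumes "in_L2w \<sigma> u"
  shows "is_L2_inversion \<sigma> (laplace u) u"
proof -
  obtain z where z [measurable]: "z \<in> borel_measurable borel"
    and lim: "((\<lambda>R. energy (\<lambda>t. z t - fourier (trunc R (\<lambda>y. U y)) t)) \<longlongrightarrow> 0) at_top"
    using ex_L2_fourier_limit[OF measurable_U energy_U[OF assms]] by blast
  have "AE t in lborel. z t = 2 * of_real pi * damp \<sigma> u t"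
    using lim by (intro fourier_inversion_L2 integrable_damp_u energy_damp_u assms z)
      (simp add: laplace_eq_fourier_damp)
  moreover have "unweight \<sigma> u t = 2 * of_real pi * damp \<sigma> u t" for t
    unfolding unweight_def by (subst u_eq_damp) (simp add: exp_minus)
  ultimately have "AE t in lborel. z t = unweight \<sigma> u t"
    by simp
  then have "energy (\<lambda>t. unweight \<sigma> u t - fourier (trunc R (\<lambda>y. U y)) t)
      = energy (\<lambda>t. z t - fourier (trunc R (\<lambda>y. U y)) t)" for R
    by (intro nn_integral_cong_AE) auto
  then show ?thesis
    using lim by (simp add: is_L2_inversion_iff)
qed

text \<open>The approximation and u are both L2 inversions, so their weighted distance is controlled
  by the energy of the difference of their spectra. The squared noise bound has the exponent 2 (a -
  m), which is below -1 exactly when m > a + 1/2.\<close>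

lemma L2w_error:
  assumes u: "in_L2w \<sigma> u" and m: "a + 1/2 < real m"
    and gd: "noisy_data g gd" and \<delta>: "0 < \<delta>" and N: "0 < N"
    and A: "0 \<le> A" "energy (\<lambda>y. U y * (h N y - 1)) \<le> ennreal A"
  defines "e \<equiv> \<lambda>t. u_approx \<sigma> k m N (gd \<delta>) t - u t"
  shows "in_L2w \<sigma> e"
    "norm_L2w \<sigma> e \<le> sqrt (2 / pi * (A + (\<delta> * noise_gain N)\<^sup>2 * (2 * N / (2 * (real m - a) - 1))))"
proof -
  obtain E where [measurable]: "E \<in> borel_measurable borel"
    and F_eq: "\<And>y. reg_spectrum N (gd \<delta>) (Complex \<sigma> y) = U y * h N y + E y"
    and E_le: "\<And>y. norm (E y) \<le> \<delta> * noise_gain N * (1 + \<bar>y\<bar> / N) powr (a - real m)"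
    using reg_spectrum_decomposition[OF gd \<delta> N] by metis
  let ?F = "\<lambda>y. reg_spectrum N (gd \<delta>) (Complex \<sigma> y)"
  let ?Q = "(\<delta> * noise_gain N)\<^sup>2 * (2 * N / (2 * (real m - a) - 1))"
  have Q: "0 \<le> ?Q"
    using m N by simp
  have E_fin: "energy E \<le> ennreal ?Q"
  proof -
    have "energy E \<le> (\<integral>\<^sup>+y. ennreal ((\<delta> * noise_gain N)\<^sup>2) * ennreal ((1 + \<bar>y\<bar> / N) powr (2 * (a - real m))) \<partial>lborel)"
    proof (intro nn_integral_mono)
      fix y
      have "(norm (E y))\<^sup>2 \<le> (\<delta> * noise_gain N * (1 + \<bar>y\<bar> / N) powr (a - real m))\<^sup>2"
        by (intro power_mono E_le) simp
      also have "\<dots> = (\<delta> * noise_gain N)\<^sup>2 * ((1 + \<bar>y\<bar> / N) powr (a - real m) * (1 + \<bar>y\<bar> / N) powr (a - real m))"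
        unfolding power_mult_distrib[of _ "(1 + \<bar>y\<bar> / N) powr (a - real m)"] by (simp only: power2_eq_square)
      also have "(1 + \<bar>y\<bar> / N) powr (a - real m) * (1 + \<bar>y\<bar> / N) powr (a - real m) = (1 + \<bar>y\<bar> / N) powr (2 * (a - real m))"
        by (simp only: powr_add[symmetric] mult_2)
      finally show "ennreal ((norm (E y))\<^sup>2) \<le> ennreal ((\<delta> * noise_gain N)\<^sup>2) * ennreal ((1 + \<bar>y\<bar> / N) powr (2 * (a - real m)))"
        by (simp add: ennreal_mult[symmetric] ennreal_leI)
    qed
    also have "\<dots> = ennreal ((\<delta> * noise_gain N)\<^sup>2) * (\<integral>\<^sup>+y. ennreal ((1 + \<bar>y\<bar> / N) powr (2 * (a - real m))) \<partial>lborel)"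
      by (intro nn_integral_cmult) measurable
    also have "\<dots> \<le> ennreal ((\<delta> * noise_gain N)\<^sup>2) * ennreal (2 * N / (- (2 * (a - real m)) - 1))"
      using m N by (intro mult_left_mono nn_integral_one_plus_powr) auto
    also have "\<dots> = ennreal ?Q"
      using m N by (subst ennreal_mult[symmetric]) (auto simp: algebra_simps)
    finally show ?thesis .
  qed
  then have E_fin': "energy E < \<infinity>"
    by (auto simp: less_top[symmetric] top_unique)
  have [measurable]: "?F \<in> borel_measurable borel"
    unfolding F_eq by measurable
  have F_fin: "energy ?F < \<infinity>"
  proof -
    have "energy ?F \<le> 2 * energy (\<lambda>y. U y * h N y) + 2 * energy E"
      unfolding F_eq by (intro energy_triangle) measurable
    also have "\<dots> \<le> 2 * energy (\<lambda>y. U y) + 2 * energy E"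
      using norm_filter_factor_le(1)[OF \<sigma> N]
      by (intro add_right_mono mult_left_mono nn_integral_mono ennreal_leI power_mono)
         (auto simp: norm_mult intro!: mult_left_le)
    also have "\<dots> < \<infinity>"
      using E_fin' energy_U[OF u] by (simp add: ennreal_mult_less_top)
    finally show ?thesis .
  qed
  have inv: "is_L2_inversion \<sigma> (reg_spectrum N (gd \<delta>)) (u_approx \<sigma> k m N (gd \<delta>))"
    unfolding u_approx_eq by (intro is_L2_inversion_inversion F_fin) measurable
  then have [measurable]: "u_approx \<sigma> k m N (gd \<delta>) \<in> borel_measurable borel"
    by (simp add: is_L2_inversion_def)
  have "(\<integral>\<^sup>+t. ennreal ((norm (e t))\<^sup>2 * exp (-2 * \<sigma> * t)) \<partial>lborel) \<le> ennreal (1 / pi) * energy (\<lambda>y. ?F y - U y)"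
    unfolding e_def by (intro is_L2_inversion_diff F_fin energy_U u inv is_L2_inversion_u) measurable
  also have "energy (\<lambda>y. ?F y - U y) = energy (\<lambda>y. U y * (h N y - 1) + E y)"
    unfolding F_eq by (simp add: algebra_simps)
  also have "\<dots> \<le> 2 * energy (\<lambda>y. U y * (h N y - 1)) + 2 * energy E"
    by (intro energy_triangle) measurable
  also have "\<dots> \<le> 2 * ennreal A + 2 * ennreal ?Q"
    by (intro add_mono mult_left_mono A E_fin) auto
  also have "ennreal (1 / pi) * (2 * ennreal A + 2 * ennreal ?Q) = ennreal (2 / pi * (A + ?Q))"
  proof -
    have "2 * ennreal x = ennreal (2 * x)" for x
      using ennreal_mult'[of 2 x] by simp
    then have "ennreal (1 / pi) * (2 * ennreal A + 2 * ennreal ?Q) = ennreal (1 / pi * (2 * A + 2 * ?Q))"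
      using A Q by (simp only: ennreal_plus[symmetric] ennreal_mult[symmetric] mult_nonneg_nonneg zero_le_numeral add_nonneg_nonneg
          zero_le_divide_1_iff pi_ge_zero)
    then show ?thesis
      by (simp add: field_simps)
  qed
  finally have bd: "(\<integral>\<^sup>+t. ennreal ((norm (e t))\<^sup>2 * exp (-2 * \<sigma> * t)) \<partial>lborel) \<le> ennreal (2 / pi * (A + ?Q))"
    by (simp add: mult_left_mono)
  have meas: "e \<in> borel_measurable borel"
    unfolding e_def by measurable
  have "0 \<le> 2 / pi * (A + ?Q)"
    using A Q by simp
  then show "in_L2w \<sigma> e" "norm_L2w \<sigma> e \<le> sqrt (2 / pi * (A + ?Q))"
    using norm_L2wI[OF meas _ bd] by auto
qed

end

lemma filterlim_powr_neg_at_right_0: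
  fixes r :: real
  assumes "r < 0"
  shows "filterlim (\<lambda>\<delta>. \<delta> powr r) at_top (at_right 0)"
proof -
  have "filterlim (\<lambda>\<delta>::real. (- r) * (- ln \<delta>)) at_top (at_right 0)"
    using assms by (intro filterlim_tendsto_pos_mult_at_top[OF tendsto_const]
        filterlim_compose[OF filterlim_uminus_at_top_at_bot ln_at_0]) auto
  then have "filterlim (\<lambda>\<delta>. exp ((- r) * (- ln \<delta>))) at_top (at_right 0)"
    by (rule filterlim_compose[OF exp_at_top])
  then show ?thesis
  proof (rule filterlim_mono_eventually)
    show "\<forall>\<^sub>F \<delta> in at_right 0. exp ((- r) * (- ln \<delta>)) = \<delta> powr r"
      using eventually_at_right_less[of 0] by eventually_elim (simp add: powr_def)
  qed auto
qed

lemma tendsto_powr_pos_at_right_0: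
  fixes r :: real
  assumes "0 < r"
  shows "((\<lambda>\<delta>. \<delta> powr r) \<longlongrightarrow> 0) (at_right 0)"
proof -
  have "((\<lambda>\<delta>. \<delta> powr r) \<longlongrightarrow> 0 powr r) (at_right (0::real))"
    using assms by (intro tendsto_powr2 tendsto_const tendsto_ident_at)
      (auto simp: eventually_at_filter)
  then show ?thesis by simp
qed

lemma filter_factor_minus_1_tendsto_0:
  assumes "0 < \<sigma>"
  shows "((\<lambda>N. filter_factor m N (Complex \<sigma> y) - 1) \<longlongrightarrow> 0) at_top"
proof (rule Lim_null_comparison)
  show "\<forall>\<^sub>F N in at_top. norm (filter_factor m N (Complex \<sigma> y) - 1) \<le> real m * (norm (Complex \<sigma> y) / N)"
    using eventually_gt_at_top[of 0] by eventually_elim (rule norm_filter_factor_minus_1_le[OF assms])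
  have "((\<lambda>N. real m * (norm (Complex \<sigma> y) / N)) \<longlongrightarrow> real m * 0) at_top"
    by (intro tendsto_mult tendsto_const tendsto_divide_0[OF tendsto_const] filterlim_at_top_imp_at_infinity filterlim_ident)
  then show "((\<lambda>N. real m * (norm (Complex \<sigma> y) / N)) \<longlongrightarrow> 0) at_top"
    by simp
qed

subsection \<open>Choice of the parameter\<close>

context volterra_problem
begin

text \<open>With N = \<delta>^(-1/p) the noise \<delta> N^(a+1) is \<delta>^(q/p), which equals
  N^(-q), the size of a bias of order q. Equality holds as soon as N \<ge> \<sigma>, when the
  maximum in \<open>noise_gain\<close> is N.\<close>

lemma noise_level:
  assumes q: "0 < q" and p_eq: "p = a + 1 + q"
  shows "\<forall>\<^sub>F \<delta> in at_right 0. \<delta> * noise_gain (\<delta> powr (- 1 / p)) * \<delta> powr (- 1 / p)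
    = 2 ^ m / (\<sigma> * c) * \<delta> powr (q / p)"
proof -
  have p: "0 < p"
    using a_nonneg assms by simp
  then have "filterlim (\<lambda>\<delta>. \<delta> powr (- 1 / p)) at_top (at_right 0)"
    by (intro filterlim_powr_neg_at_right_0) simp
  then have "\<forall>\<^sub>F \<delta> in at_right 0. \<sigma> \<le> \<delta> powr (- 1 / p)"
    by (simp add: filterlim_at_top)
  then show ?thesis
    using eventually_at_right_less[of 0]
  proof eventually_elim
    case (elim \<delta>)
    let ?N = "\<delta> powr (- 1 / p)"
    have "\<delta> * (?N powr a * ?N) = \<delta> powr 1 * (\<delta> powr (- 1 / p * a) * \<delta> powr (- 1 / p))"
      using elim by (simp add: powr_powr)
    also have "\<dots> = \<delta> powr (1 + (- 1 / p * a + - 1 / p))"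
      by (simp only: powr_add)
    also have "1 + (- 1 / p * a + - 1 / p) = q / p"
    proof -
      have "q = p - a - 1" using p_eq by simp
      then show ?thesis using p by (simp add: field_simps)
    qed
    finally have "\<delta> * (?N powr a * ?N) = \<delta> powr (q / p)" .
    moreover have "\<delta> * noise_gain ?N * ?N = 2 ^ m / (\<sigma> * c) * (\<delta> * (?N powr a * ?N))"
      using elim by (simp add: noise_gain_def max_absorb2)
    ultimately show ?case by simp
  qed
qed

lemma noise_level_tendsto_0:
  "((\<lambda>\<delta>. \<delta> * noise_gain (\<delta> powr (- 1 / (a + 2))) * \<delta> powr (- 1 / (a + 2))) \<longlongrightarrow> 0) (at_right 0)"
proof -
  have "((\<lambda>\<delta>. 2 ^ m / (\<sigma> * c) * \<delta> powr (1 / (a + 2))) \<longlongrightarrow> 2 ^ m / (\<sigma> * c) * 0) (at_right 0)"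
    using a_nonneg by (intro tendsto_mult tendsto_const tendsto_powr_pos_at_right_0) simp
  then show ?thesis
    using noise_level[of 1 "a + 2"] by (simp add: tendsto_cong)
qed

lemma N_at_top: "filterlim (\<lambda>\<delta>. \<delta> powr (- 1 / (a + 2))) at_top (at_right 0)"
  using a_nonneg by (intro filterlim_powr_neg_at_right_0) simp

section \<open>Convergence without rates\<close>

text \<open>The squared bias is dominated by 4 times the square of the spectrum and tends to 0
  pointwise, hence in the mean, with no rate; only the noise restricts the growth of N.\<close>

lemma convergence_L2w:
  assumes m: "a + 1/2 < real m" and u: "in_L2w \<sigma> u" and gd: "noisy_data g gd"
  defines "e \<equiv> \<lambda>\<delta> t. u_approx \<sigma> k m (\<delta> powr (- 1 / (a + 2))) (gd \<delta>) t - u t"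
  shows "0 < \<delta> \<Longrightarrow> in_L2w \<sigma> (e \<delta>)"
    and "((\<lambda>\<delta>. norm_L2w \<sigma> (e \<delta>)) \<longlongrightarrow> 0) (at_right 0)"
proof -
  define A where "A N = (LINT y|lborel. (norm (U y * (h N y - 1)))\<^sup>2)" for N
  have A0: "0 \<le> A N" for N
    by (simp add: A_def)
  have U2: "integrable lborel (\<lambda>y. 4 * (norm (U y))\<^sup>2)"
    using energy_U[OF u] by (intro integrable_mult_right integrableI_nonneg) auto
  have le: "(norm (U y * (h N y - 1)))\<^sup>2 \<le> 4 * (norm (U y))\<^sup>2" if "0 < N" for N y
  proof -
    have "(norm (U y * (h N y - 1)))\<^sup>2 \<le> (norm (U y) * 2)\<^sup>2"
      unfolding norm_mult using norm_filter_factor_minus_1_le(1)[OF \<sigma> that]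
      by (intro power_mono mult_left_mono) auto
    then show ?thesis by (simp add: power_mult_distrib)
  qed
  have A: "energy (\<lambda>y. U y * (h N y - 1)) \<le> ennreal (A N)" if "0 < N" for N
    unfolding A_def using le[OF that]
    by (subst nn_integral_eq_integral) (auto intro!: Bochner_Integration.integrable_bound[OF U2] AE_I2)
  have A_lim: "(A \<longlongrightarrow> 0) at_top"
  proof -
    have "((\<lambda>N. LINT y|lborel. (norm (U y * (h N y - 1)))\<^sup>2) \<longlongrightarrow> (LINT (y::real)|lborel. 0)) at_top"
    proof (rule integral_dominated_convergence_at_top[OF _ _ U2])
      show "\<forall>\<^sub>F N in at_top. AE y in lborel. norm ((norm (U y * (h N y - 1)))\<^sup>2) \<le> 4 * (norm (U y))\<^sup>2"
        using eventually_gt_at_top[of 0] by eventually_elim (auto intro: le)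
      have "((\<lambda>N. (norm (U y * (h N y - 1)))\<^sup>2) \<longlongrightarrow> (norm (U y * 0))\<^sup>2) at_top" for y
        by (intro tendsto_intros filter_factor_minus_1_tendsto_0 \<sigma>)
      then show "AE y in lborel. ((\<lambda>N. (norm (U y * (h N y - 1)))\<^sup>2) \<longlongrightarrow> 0) at_top"
        by simp
    qed measurable
    then show ?thesis by (simp add: A_def[abs_def])
  qed
  let ?N = "\<lambda>\<delta>. \<delta> powr (- 1 / (a + 2))"
  let ?b = "\<lambda>\<delta>. sqrt (2 / pi * (A (?N \<delta>) + (\<delta> * noise_gain (?N \<delta>))\<^sup>2 * (2 * ?N \<delta> / (2 * (real m - a) - 1))))"
  have main: "in_L2w \<sigma> (e \<delta>)" "norm_L2w \<sigma> (e \<delta>) \<le> ?b \<delta>" if "0 < \<delta>" for \<delta>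
    unfolding e_def using that by (intro L2w_error[OF u m gd that _ A0 A]; simp)+
  show "0 < \<delta> \<Longrightarrow> in_L2w \<sigma> (e \<delta>)"
    by (rule main(1))
  \<comment> \<open>Replaces N by N^2 in the noise term, harmless once N \<ge> 1. This overestimates
    \<delta> N^(a+1/2) by \<delta> N^(a+1), for which \<open>noise_level_tendsto_0\<close> is
    available.\<close>
  let ?B = "\<lambda>\<delta>. sqrt (2 / pi * (A (?N \<delta>) + (\<delta> * noise_gain (?N \<delta>) * ?N \<delta>)\<^sup>2 * (2 / (2 * (real m - a) - 1))))"
  have "(?B \<longlongrightarrow> sqrt (2 / pi * (0 + 0\<^sup>2 * (2 / (2 * (real m - a) - 1))))) (at_right 0)"
    by (rule tendsto_real_sqrt[OF tendsto_mult[OF tendsto_const tendsto_add[OF filterlim_compose[OF A_lim N_at_top]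
        tendsto_mult[OF tendsto_power[OF noise_level_tendsto_0] tendsto_const]]]])
  also have "sqrt (2 / pi * (0 + 0\<^sup>2 * (2 / (2 * (real m - a) - 1)))) = 0"
    by simp
  finally have B_lim: "(?B \<longlongrightarrow> 0) (at_right 0)" .
  have B_ge: "\<forall>\<^sub>F \<delta> in at_right 0. norm_L2w \<sigma> (e \<delta>) \<le> ?B \<delta>"
  proof -
    have "\<forall>\<^sub>F \<delta> in at_right 0. 1 \<le> ?N \<delta>"
      using N_at_top by (simp add: filterlim_at_top)
    then show ?thesis
      using eventually_at_right_less[of 0]
    proof eventually_elim
      case (elim \<delta>)
      have "?N \<delta> \<le> (?N \<delta>)\<^sup>2"
        using elim by (simp add: power2_eq_square)
      then have "(\<delta> * noise_gain (?N \<delta>))\<^sup>2 * ?N \<delta> \<le> (\<delta> * noise_gain (?N \<delta>) * ?N \<delta>)\<^sup>2"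
        unfolding power_mult_distrib[of _ "?N \<delta>"] by (intro mult_left_mono) auto
      then have "(\<delta> * noise_gain (?N \<delta>))\<^sup>2 * ?N \<delta> * (2 / (2 * (real m - a) - 1))
          \<le> (\<delta> * noise_gain (?N \<delta>) * ?N \<delta>)\<^sup>2 * (2 / (2 * (real m - a) - 1))"
        using m by (intro mult_right_mono) auto
      then have "?b \<delta> \<le> ?B \<delta>"
        by (intro real_sqrt_le_mono mult_left_mono add_left_mono) (simp_all add: mult_ac)
      with main(2)[OF elim(2)] show ?case by linarith
    qed
  qed
  have "0 \<le> norm_L2w \<sigma> (e \<delta>)" for \<delta>
    unfolding norm_L2w_def set_lebesgue_integral_def by (simp add: integral_nonneg_AE)
  then show "((\<lambda>\<delta>. norm_L2w \<sigma> (e \<delta>)) \<longlongrightarrow> 0) (at_right 0)"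
    by (intro tendsto_sandwich[OF always_eventually B_ge tendsto_const B_lim] allI)
qed

definition sup_bias :: "real \<Rightarrow> real" where
  "sup_bias N = (LINT y|lborel. norm (U y) * norm (h N y - 1))"

lemma sup_bias_nonneg: "0 \<le> sup_bias N"
  by (simp add: sup_bias_def)

lemma sup_bias_integrand_le:
  "0 < N \<Longrightarrow> norm (U y) * norm (h N y - 1) \<le> 2 * norm (U y)"
  using mult_left_mono[OF norm_filter_factor_minus_1_le(1)[OF \<sigma>, of N m y], of "norm (U y)"]
  by (simp add: mult.commute)

lemma nn_integral_sup_bias:
  assumes U: "integrable lborel (\<lambda>y. U y)" and N: "0 < N"
  shows "(\<integral>\<^sup>+y. ennreal (norm (U y) * norm (h N y - 1)) \<partial>lborel) = ennreal (sup_bias N)"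
  unfolding sup_bias_def using sup_bias_integrand_le[OF N]
  by (intro nn_integral_eq_integral
      Bochner_Integration.integrable_bound[OF integrable_mult_right[OF integrable_norm[OF U], of 2]])
     (auto simp: abs_mult intro!: AE_I2)

lemma sup_bias_tendsto_0:
  assumes U: "integrable lborel (\<lambda>y. U y)"
  shows "(sup_bias \<longlongrightarrow> 0) at_top"
proof -
  have "((\<lambda>N. LINT y|lborel. norm (U y) * norm (h N y - 1)) \<longlongrightarrow> (LINT (y::real)|lborel. 0)) at_top"
  proof (rule integral_dominated_convergence_at_top)
    show "integrable lborel (\<lambda>y. 2 * norm (U y))"
      using U by simp
    show "\<forall>\<^sub>F N in at_top. AE y in lborel. norm (norm (U y) * norm (h N y - 1)) \<le> 2 * norm (U y)"
      using eventually_gt_at_top[of 0] by eventually_elim (auto simp: abs_mult intro: sup_bias_integrand_le)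
    have "((\<lambda>N. norm (U y) * norm (h N y - 1)) \<longlongrightarrow> norm (U y) * norm (0::complex)) at_top" for y
      by (intro tendsto_mult tendsto_const tendsto_norm filter_factor_minus_1_tendsto_0 \<sigma>)
    then show "AE y in lborel. ((\<lambda>N. norm (U y) * norm (h N y - 1)) \<longlongrightarrow> 0) at_top"
      by simp
  qed measurable
  then show ?thesis by (simp add: sup_bias_def[abs_def])
qed

lemma convergence_Linf:
  assumes m: "a + 1 < real m" and U: "integrable lborel (\<lambda>y. U y)" and gd: "noisy_data g gd" and T: "0 < T"
  defines "e \<equiv> \<lambda>\<delta> t. u_approx \<sigma> k m (\<delta> powr (- 1 / (a + 2))) (gd \<delta>) t - u t"
  shows "0 < \<delta> \<Longrightarrow> in_Linf T (e \<delta>)"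
    and "((\<lambda>\<delta>. norm_Linf T (e \<delta>)) \<longlongrightarrow> 0) (at_right 0)"
proof -
  let ?N = "\<lambda>\<delta>. \<delta> powr (- 1 / (a + 2))"
  let ?b = "\<lambda>\<delta>. exp (\<sigma> * T) / (2 * pi) * (sup_bias (?N \<delta>) + \<delta> * noise_gain (?N \<delta>) * (2 * ?N \<delta> / (real m - a - 1)))"
  have main: "in_Linf T (e \<delta>)" "0 \<le> norm_Linf T (e \<delta>)" "norm_Linf T (e \<delta>) \<le> ?b \<delta>" if "0 < \<delta>" for \<delta>
  proof -
    have N: "0 < ?N \<delta>"
      using that by simp
    note err = sup_error[OF U m gd that N T sup_bias_nonneg eq_refl[OF nn_integral_sup_bias[OF U N]]]
    show "in_Linf T (e \<delta>)" "0 \<le> norm_Linf T (e \<delta>)" "norm_Linf T (e \<delta>) \<le> ?b \<delta>"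
      unfolding e_def by (fact err)+
  qed
  show "0 < \<delta> \<Longrightarrow> in_Linf T (e \<delta>)"
    by (rule main(1))
  have "((\<lambda>\<delta>. exp (\<sigma> * T) / (2 * pi) * (sup_bias (?N \<delta>) + \<delta> * noise_gain (?N \<delta>) * ?N \<delta> * (2 / (real m - a - 1))))
      \<longlongrightarrow> exp (\<sigma> * T) / (2 * pi) * (0 + 0 * (2 / (real m - a - 1)))) (at_right 0)"
    by (rule tendsto_mult[OF tendsto_const tendsto_add[OF filterlim_compose[OF sup_bias_tendsto_0[OF U] N_at_top]
        tendsto_mult[OF noise_level_tendsto_0 tendsto_const]]])
  moreover have "x * y * (2 / w) = x * (2 * y / w)" for x y w :: real
    by simp
  ultimately have b_lim: "(?b \<longlongrightarrow> 0) (at_right 0)"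
    by (simp only: mult_zero_left add_0 mult_zero_right)
  have "\<forall>\<^sub>F \<delta> in at_right 0. 0 \<le> norm_Linf T (e \<delta>)" "\<forall>\<^sub>F \<delta> in at_right 0. norm_Linf T (e \<delta>) \<le> ?b \<delta>"
    using eventually_at_right_less[of 0] by (eventually_elim, intro main, simp)+
  then show "((\<lambda>\<delta>. norm_Linf T (e \<delta>)) \<longlongrightarrow> 0) (at_right 0)"
    by (rule tendsto_sandwich[OF _ _ tendsto_const b_lim])
qed

section \<open>Convergence rates under decay of the spectrum\<close>

lemma integrable_U_if_decay:
  assumes d: "0 < d" and decay: "\<And>y. norm (U y) \<le> c' / (1 + norm (Complex \<sigma> y) powr (1 + d))" and c': "0 < c'"
  shows "integrable lborel (\<lambda>y. U y)"
proof (rule integrableI_bounded)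
  have "(\<integral>\<^sup>+y. ennreal (norm (U y)) \<partial>lborel) \<le> (\<integral>\<^sup>+y. ennreal (c' * 2 powr (1 + d)) * ennreal ((1 + \<bar>y\<bar> / 1) powr (- (1 + d))) \<partial>lborel)"
  proof (intro nn_integral_mono)
    fix y
    let ?n = "norm (Complex \<sigma> y)"
    note n = norm_Complex_bounds[OF \<sigma>, of y]
    have "norm (U y) \<le> c' * (?n powr 0 / (1 + ?n powr (1 + d)))"
      using decay[of y] n by simp
    also have "\<dots> \<le> c' * (2 powr (1 + d - 0) * (1 + \<bar>y\<bar>) powr (- (1 + d - 0)))"
      using n d c' by (intro mult_left_mono powr_quotient_le) auto
    also have "\<dots> = c' * 2 powr (1 + d) * (1 + \<bar>y\<bar> / 1) powr (- (1 + d))"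
      by (simp only: diff_0_right mult.assoc div_by_1)
    finally show "ennreal (norm (U y)) \<le> ennreal (c' * 2 powr (1 + d)) * ennreal ((1 + \<bar>y\<bar> / 1) powr (- (1 + d)))"
      using c' by (subst ennreal_mult[symmetric]) (auto intro: ennreal_leI)
  qed
  also have "\<dots> = ennreal (c' * 2 powr (1 + d)) * (\<integral>\<^sup>+y. ennreal ((1 + \<bar>y\<bar> / 1) powr (- (1 + d))) \<partial>lborel)"
    by (intro nn_integral_cmult) measurable
  also have "\<dots> \<le> ennreal (c' * 2 powr (1 + d)) * ennreal (2 * 1 / (- (- (1 + d)) - 1))"
    using d by (intro mult_left_mono nn_integral_one_plus_powr) auto
  also have "\<dots> < \<infinity>"
    by (simp add: ennreal_mult_less_top)
  finally show "(\<integral>\<^sup>+y. ennreal (norm (U y)) \<partial>lborel) < \<infinity>" .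
qed simp

lemma sup_bias_le:
  assumes d: "0 < d" and decay: "\<And>y. norm (U y) \<le> c' / (1 + norm (Complex \<sigma> y) powr (1 + d))" and c': "0 < c'"
    and N: "0 < N" and b: "bias \<sigma> d m N \<le> ennreal b" "0 \<le> b"
  shows "sup_bias N \<le> c' * b"
proof -
  have "ennreal (sup_bias N) = (\<integral>\<^sup>+y. ennreal (norm (U y) * norm (h N y - 1)) \<partial>lborel)"
    using nn_integral_sup_bias[OF integrable_U_if_decay[OF d decay c'] N] by simp
  also have "\<dots> \<le> (\<integral>\<^sup>+y. ennreal c' * ennreal (norm (h N y - 1) / (1 + norm (Complex \<sigma> y) powr (1 + d))) \<partial>lborel)"
  proof (intro nn_integral_mono)
    fix y
    have "norm (U y) * norm (h N y - 1) \<le> c' / (1 + norm (Complex \<sigma> y) powr (1 + d)) * norm (h N y - 1)"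
      by (intro mult_right_mono decay) simp
    then show "ennreal (norm (U y) * norm (h N y - 1))
        \<le> ennreal c' * ennreal (norm (h N y - 1) / (1 + norm (Complex \<sigma> y) powr (1 + d)))"
      using c' by (subst ennreal_mult[symmetric]) (auto intro: ennreal_leI divide_nonneg_nonneg add_nonneg_nonneg)
  qed
  also have "\<dots> = ennreal c' * bias \<sigma> d m N"
    unfolding bias_def by (intro nn_integral_cmult) measurable
  also have "\<dots> \<le> ennreal c' * ennreal b"
    by (intro mult_left_mono b) simp
  also have "\<dots> = ennreal (c' * b)"
    using c' b by (simp add: ennreal_mult)
  finally show ?thesis
    using c' b by (simp add: ennreal_le_iff)
qed

text \<open>The frame common to the three regimes: q is the order of the bias in 1 / N up to
  logarithms, and \<psi> is the claimed rate, which has to dominate the bias up to a constant and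
  the power \<delta>^(q/p) left over by the noise.\<close>

lemma sup_error_rate:
  assumes m: "a + 1 < real m" and d: "0 < d"
    and decay: "\<And>y. norm (U y) \<le> c' / (1 + norm (Complex \<sigma> y) powr (1 + d))" and c': "0 < c'"
    and gd: "noisy_data g gd" and T: "0 < T" and q: "0 < q" and p: "p = a + 1 + q" and C: "0 \<le> C"
    and bias: "\<forall>\<^sub>F \<delta> in at_right 0. bias \<sigma> d m (\<delta> powr (- 1 / p)) \<le> ennreal (C * \<psi> \<delta>)"
    and \<psi>: "\<forall>\<^sub>F \<delta> in at_right 0. \<delta> powr (q / p) \<le> \<psi> \<delta>"
  defines "e \<equiv> \<lambda>\<delta> t. u_approx \<sigma> k m (\<delta> powr (- 1 / p)) (gd \<delta>) t - u t"
  shows "0 < \<delta> \<Longrightarrow> in_Linf T (e \<delta>)"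
    and "(\<lambda>\<delta>. norm_Linf T (e \<delta>)) \<in> O[at_right 0](\<psi>)"
proof -
  note U = integrable_U_if_decay[OF d decay c']
  let ?N = "\<lambda>\<delta>. \<delta> powr (- 1 / p)"
  let ?b = "\<lambda>\<delta>. exp (\<sigma> * T) / (2 * pi) * (sup_bias (?N \<delta>) + \<delta> * noise_gain (?N \<delta>) * (2 * ?N \<delta> / (real m - a - 1)))"
  have main: "in_Linf T (e \<delta>)" "0 \<le> norm_Linf T (e \<delta>)" "norm_Linf T (e \<delta>) \<le> ?b \<delta>" if "0 < \<delta>" for \<delta>
  proof -
    have N: "0 < ?N \<delta>"
      using that by simp
    note err = sup_error[OF U m gd that N T sup_bias_nonneg eq_refl[OF nn_integral_sup_bias[OF U N]]]
    show "in_Linf T (e \<delta>)" "0 \<le> norm_Linf T (e \<delta>)" "norm_Linf T (e \<delta>) \<le> ?b \<delta>"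
      unfolding e_def by (fact err)+
  qed
  show "0 < \<delta> \<Longrightarrow> in_Linf T (e \<delta>)"
    by (rule main(1))
  let ?K = "2 ^ m / (\<sigma> * c) * (2 / (real m - a - 1))"
  have K: "0 \<le> ?K"
    using m \<sigma> c by simp
  show "(\<lambda>\<delta>. norm_Linf T (e \<delta>)) \<in> O[at_right 0](\<psi>)"
  proof (rule bigoI)
    show "\<forall>\<^sub>F \<delta> in at_right 0. norm (norm_Linf T (e \<delta>)) \<le> exp (\<sigma> * T) / (2 * pi) * (c' * C + ?K) * norm (\<psi> \<delta>)"
      using bias \<psi> noise_level[OF q p] eventually_at_right_less[of 0]
    proof eventually_elim
      case (elim \<delta>)
      have \<psi>0: "0 \<le> \<psi> \<delta>"
        using elim(2) order_trans[OF powr_ge_zero] by blast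
      have "\<delta> * noise_gain (?N \<delta>) * (2 * ?N \<delta> / (real m - a - 1)) = \<delta> * noise_gain (?N \<delta>) * ?N \<delta> * (2 / (real m - a - 1))"
        by simp
      also have "\<dots> = ?K * \<delta> powr (q / p)"
        unfolding elim(3) by simp
      also have "\<dots> \<le> ?K * \<psi> \<delta>"
        by (intro mult_left_mono elim K)
      finally have noise: "\<delta> * noise_gain (?N \<delta>) * (2 * ?N \<delta> / (real m - a - 1)) \<le> ?K * \<psi> \<delta>" .
      have "sup_bias (?N \<delta>) \<le> c' * (C * \<psi> \<delta>)"
        using elim C \<psi>0 by (intro sup_bias_le[OF d decay c']) auto
      with noise have "sup_bias (?N \<delta>) + \<delta> * noise_gain (?N \<delta>) * (2 * ?N \<delta> / (real m - a - 1)) \<le> (c' * C + ?K) * \<psi> \<delta>"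
        by (simp add: distrib_right mult.assoc)
      then have "?b \<delta> \<le> exp (\<sigma> * T) / (2 * pi) * ((c' * C + ?K) * \<psi> \<delta>)"
        by (intro mult_left_mono) auto
      then show ?case
        using main(2,3)[OF elim(4)] \<psi>0 by (simp add: mult.assoc)
    qed
  qed
qed

lemma rate_if_less_1:
  assumes m: "a + 1 < real m" and d: "0 < d" "d < 1"
    and decay: "\<And>y. norm (U y) \<le> c' / (1 + norm (Complex \<sigma> y) powr (1 + d))" and c': "0 < c'"
    and gd: "noisy_data g gd" and T: "0 < T"
  defines "e \<equiv> \<lambda>\<delta> t. u_approx \<sigma> k m (\<delta> powr (- 1 / (a + d + 1))) (gd \<delta>) t - u t"
  shows "0 < \<delta> \<Longrightarrow> in_Linf T (e \<delta>)"
    and "(\<lambda>\<delta>. norm_Linf T (e \<delta>)) \<in> O[at_right 0](\<lambda>\<delta>. \<delta> powr (d / (a + d + 1)))"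
proof -
  let ?p = "a + d + 1"
  obtain C where C: "0 \<le> C" and b: "\<And>N. 0 < N \<Longrightarrow> bias \<sigma> d m N \<le> ennreal (C * N powr (- d))"
    using bias_le_if_less_1[OF \<sigma> d] by blast
  have "\<forall>\<^sub>F \<delta> in at_right 0. bias \<sigma> d m (\<delta> powr (- 1 / ?p)) \<le> ennreal (C * \<delta> powr (d / ?p))"
    using eventually_at_right_less[of 0]
  proof eventually_elim
    case (elim \<delta>)
    then show ?case using b[of "\<delta> powr (- 1 / ?p)"] by (simp add: powr_powr)
  qed
  note rate = sup_error_rate[OF m d(1) decay c' gd T d(1) _ C this]
  show "0 < \<delta> \<Longrightarrow> in_Linf T (e \<delta>)"
    unfolding e_def by (rule rate(1)) auto
  show "(\<lambda>\<delta>. norm_Linf T (e \<delta>)) \<in> O[at_right 0](\<lambda>\<delta>. \<delta> powr (d / (a + d + 1)))"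
    unfolding e_def by (rule rate(2)) auto
qed

lemma rate_if_gt_1:
  assumes m: "a + 1 < real m" and d: "1 < d"
    and decay: "\<And>y. norm (U y) \<le> c' / (1 + norm (Complex \<sigma> y) powr (1 + d))" and c': "0 < c'"
    and gd: "noisy_data g gd" and T: "0 < T"
  defines "e \<equiv> \<lambda>\<delta> t. u_approx \<sigma> k m (\<delta> powr (- 1 / (a + 2))) (gd \<delta>) t - u t"
  shows "(\<lambda>\<delta>. norm_Linf T (e \<delta>)) \<in> O[at_right 0](\<lambda>\<delta>. \<delta> powr (1 / (a + 2)))"
proof -
  define C where "C = real m * 2 powr d * 2 / (d - 1)"
  have C: "0 \<le> C"
    using d by (simp add: C_def)
  have d0: "0 < d" using d by simp
  have "\<forall>\<^sub>F \<delta> in at_right 0. bias \<sigma> d m (\<delta> powr (- 1 / (a + 2))) \<le> ennreal (C * \<delta> powr (1 / (a + 2)))"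
    using eventually_at_right_less[of 0]
  proof eventually_elim
    case (elim \<delta>)
    then show ?case
      using bias_le_if_gt_1[OF \<sigma> _ d, of "\<delta> powr (- 1 / (a + 2))" m]
      by (simp add: C_def powr_minus divide_inverse)
  qed
  note rate = sup_error_rate[OF m d0 decay c' gd T zero_less_one _ C this]
  show ?thesis
    unfolding e_def by (rule rate(2)) auto
qed

text \<open>For \<delta> < 1 the exponential is \<delta>^(1/(a+2)), so this is the rate of the noise
  times a logarithm inherited from the bias.\<close>

lemma rate_if_eq_1:
  assumes m: "a + 1 < real m"
    and decay: "\<And>y. norm (U y) \<le> c' / (1 + norm (Complex \<sigma> y) powr (1 + 1))" and c': "0 < c'"
    and gd: "noisy_data g gd" and T: "0 < T"
  defines "e \<equiv> \<lambda>\<delta> t. u_approx \<sigma> k m (\<delta> powr (- 1 / (a + 2))) (gd \<delta>) t - u t"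
  shows "(\<lambda>\<delta>. norm_Linf T (e \<delta>)) \<in> O[at_right 0](\<lambda>\<delta>. \<bar>ln \<delta>\<bar> * exp (- (\<bar>ln \<delta>\<bar> / (a + 2))))"
proof -
  let ?\<psi> = "\<lambda>\<delta>. \<bar>ln \<delta>\<bar> * exp (- (\<bar>ln \<delta>\<bar> / (a + 2)))"
  let ?N = "\<lambda>\<delta>. \<delta> powr (- 1 / (a + 2))"
  \<comment> \<open>The constant of \<open>bias_le_if_eq_1\<close>, divided by a + 2 because ln N is
    \<bar>ln \<delta>\<bar> / (a + 2).\<close>
  define C where "C = real (max 2 m) * 8 * exp 1 / (a + 2)"
  have C: "0 \<le> C"
    using a_nonneg by (simp add: C_def)
  \<comment> \<open>Below exp (- 1) the logarithmic factor is at least 1, so the claimed rate also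
    dominates the noise.\<close>
  have small: "\<forall>\<^sub>F \<delta> in at_right 0. 0 < \<delta> \<and> \<delta> < exp (- 1 :: real)"
    by (auto simp: eventually_at_right_field intro: exI[of _ "exp (- 1)"])
  have \<psi>_eq: "?\<psi> \<delta> = (- ln \<delta>) * \<delta> powr (1 / (a + 2))" and ln: "1 \<le> - ln \<delta>"
    if "0 < \<delta> \<and> \<delta> < exp (- 1)" for \<delta>
  proof -
    have "ln \<delta> < ln (exp (- 1))"
      using that by (subst ln_less_cancel_iff) auto
    then show ln: "1 \<le> - ln \<delta>" by simp
    then have "\<bar>ln \<delta>\<bar> = - ln \<delta>" by simp
    then show "?\<psi> \<delta> = (- ln \<delta>) * \<delta> powr (1 / (a + 2))"
      using that by (simp add: powr_def)
  qed
  have large: "\<forall>\<^sub>F \<delta> in at_right 0. exp 1 \<le> ?N \<delta>"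
    using N_at_top by (simp add: filterlim_at_top)
  have "\<forall>\<^sub>F \<delta> in at_right 0. bias \<sigma> 1 m (?N \<delta>) \<le> ennreal (C * ?\<psi> \<delta>)"
    using small large
  proof eventually_elim
    case (elim \<delta>)
    have "ln (?N \<delta>) = (- 1 / (a + 2)) * ln \<delta>"
      using elim by (intro ln_powr)
    moreover have "?N \<delta> = inverse (\<delta> powr (1 / (a + 2)))"
      using powr_minus[of \<delta> "1 / (a + 2)"] by simp
    ultimately have "ln (?N \<delta>) / ?N \<delta> = (- 1 / (a + 2)) * ln \<delta> / inverse (\<delta> powr (1 / (a + 2)))"
      by (simp only:)
    then have "ln (?N \<delta>) / ?N \<delta> = (- ln \<delta>) * \<delta> powr (1 / (a + 2)) / (a + 2)"
      by (simp add: divide_inverse)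
    then have "C * ?\<psi> \<delta> = real (max 2 m) * 8 * exp 1 * (ln (?N \<delta>) / ?N \<delta>)"
      unfolding \<psi>_eq[OF elim(1)] C_def by simp
    then show ?case
      using bias_le_if_eq_1[OF \<sigma> elim(2), of m] by simp
  qed
  note rate = sup_error_rate[OF m zero_less_one decay c' gd T zero_less_one _ C this]
  have "\<forall>\<^sub>F \<delta> in at_right 0. \<delta> powr (1 / (a + 2)) \<le> ?\<psi> \<delta>"
    using small
  proof eventually_elim
    case (elim \<delta>)
    show ?case
      unfolding \<psi>_eq[OF elim] using mult_right_mono[OF ln[OF elim], of "\<delta> powr (1 / (a + 2))"] by simp
  qed
  then show ?thesis
    unfolding e_def by (intro rate(2)) auto
qed

end

section \<open>Assembly of the three parts\<close>

theorem theorem2p1: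
  fixes \<sigma> c a :: real and m :: nat and k u g :: "real \<Rightarrow> complex"
  assumes "\<sigma> > 0" and "m \<ge> 1" and "c > 0"
    and "causal k" and "causal u"
    and "k \<in> borel_measurable lborel"
    and "set_integrable lborel {0..} (\<lambda>t. exp (- \<sigma> * t) * norm (k t))"
    and "\<not> (AE t in lborel. k t = 0)"
    and "\<And>z. z \<in> Cline \<sigma> \<Longrightarrow> has_laplace_at u z"
    and "\<And>t. t \<ge> 0 \<Longrightarrow> g t = volterra_conv k u t"
    and "\<And>z. z \<in> Cline \<sigma> \<Longrightarrow> norm (laplace k z) \<ge> c * norm z powr (- a)"
  shows
    "(real m > a + 1/2 \<longrightarrow> in_L2w \<sigma> u \<longrightarrow>
      (\<exists>N :: real \<Rightarrow> real. (\<forall>\<delta>>0. N \<delta> > 0) \<and> filterlim N at_top (at_right 0) \<and>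
        (\<forall>gd. noisy_data g gd \<longrightarrow>
          (let e = (\<lambda>\<delta> t. u_approx \<sigma> k m (N \<delta>) (gd \<delta>) t - u t) in
            (\<forall>\<delta>>0. in_L2w \<sigma> (e \<delta>)) \<and>
            ((\<lambda>\<delta>. norm_L2w \<sigma> (e \<delta>)) \<longlongrightarrow> 0) (at_right 0))))) \<and>
    (integrable_Cline \<sigma> (\<lambda>z. inverse (laplace k z) * laplace g z) \<longrightarrow> real m > a + 1 \<longrightarrow>
      (\<exists>N :: real \<Rightarrow> real. (\<forall>\<delta>>0. N \<delta> > 0) \<and> filterlim N at_top (at_right 0) \<and>
        (\<forall>gd. noisy_data g gd \<longrightarrow> (\<forall>T>0. in_Linf T u \<longrightarrow>
          (let e = (\<lambda>\<delta> t. u_approx \<sigma> k m (N \<delta>) (gd \<delta>) t - u t) in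
            (\<forall>\<delta>>0. in_Linf T (e \<delta>)) \<and>
            ((\<lambda>\<delta>. norm_Linf T (e \<delta>)) \<longlongrightarrow> 0) (at_right 0)))))) \<and>
    (\<forall>d c' :: real. real m > a + 1 \<longrightarrow> d > 0 \<longrightarrow> c' > 0 \<longrightarrow>
      (\<forall>z\<in>Cline \<sigma>. norm (inverse (laplace k z) * laplace g z) \<le> c' / (1 + norm z powr (1 + d))) \<longrightarrow>
      (\<exists>N :: real \<Rightarrow> real. (\<forall>\<delta>>0. N \<delta> > 0) \<and> filterlim N at_top (at_right 0) \<and>
        (d < 1 \<longrightarrow> N \<in> O[at_right 0](\<lambda>\<delta>. \<delta> powr (- 1 / (a + d + 1)))) \<and>
        (d > 1 \<longrightarrow> N \<in> O[at_right 0](\<lambda>\<delta>. \<delta> powr (- 1 / (a + 2)))) \<and>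
        (d = 1 \<longrightarrow> (\<exists>\<epsilon> :: real \<Rightarrow> real. (\<epsilon> \<longlongrightarrow> 0) (at_right 0) \<and>
            N \<in> O[at_right 0](\<lambda>\<delta>. exp (\<bar>ln \<delta>\<bar> / (a + 2) * (1 + \<epsilon> \<delta>))))) \<and>
        (\<forall>gd. noisy_data g gd \<longrightarrow> (\<forall>T>0. in_Linf T u \<longrightarrow>
          (let e = (\<lambda>\<delta> t. u_approx \<sigma> k m (N \<delta>) (gd \<delta>) t - u t);
               \<eta> = (\<lambda>\<delta>. norm_Linf T (e \<delta>)) in
            (\<forall>\<delta>>0. in_Linf T (e \<delta>)) \<and>
            (d < 1 \<longrightarrow> \<eta> \<in> O[at_right 0](\<lambda>\<delta>. \<delta> powr (d / (a + d + 1)))) \<and>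
            (d > 1 \<longrightarrow> \<eta> \<in> O[at_right 0](\<lambda>\<delta>. \<delta> powr (1 / (a + 2)))) \<and>
            (d = 1 \<longrightarrow> (\<exists>\<epsilon> :: real \<Rightarrow> real. (\<epsilon> \<longlongrightarrow> 0) (at_right 0) \<and>
               \<eta> \<in> O[at_right 0](\<lambda>\<delta>. \<bar>ln \<delta>\<bar> * exp (- (\<bar>ln \<delta>\<bar> / (a + 2)) * (1 + \<epsilon> \<delta>))))))))))"
proof -
  interpret volterra_problem \<sigma> c a m k u g
    using assms by unfold_locales auto
  have U_eq: "inverse (laplace k (Complex \<sigma> y)) * laplace g (Complex \<sigma> y) = laplace u (Complex \<sigma> y)" for y
    by (rule inverse_laplace_k_g)
  let ?N = "\<lambda>\<delta>::real. \<delta> powr (- 1 / (a + 2))"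
  have N: "\<forall>\<delta>>0. ?N \<delta> > 0" "filterlim ?N at_top (at_right 0)"
    using N_at_top by auto
  show ?thesis
  proof (intro conjI allI impI)
    assume "real m > a + 1/2" "in_L2w \<sigma> u"
    then show "\<exists>N :: real \<Rightarrow> real. (\<forall>\<delta>>0. N \<delta> > 0) \<and> filterlim N at_top (at_right 0) \<and>
        (\<forall>gd. noisy_data g gd \<longrightarrow>
          (let e = (\<lambda>\<delta> t. u_approx \<sigma> k m (N \<delta>) (gd \<delta>) t - u t) in
            (\<forall>\<delta>>0. in_L2w \<sigma> (e \<delta>)) \<and>
            ((\<lambda>\<delta>. norm_L2w \<sigma> (e \<delta>)) \<longlongrightarrow> 0) (at_right 0)))"
      unfolding Let_def using N convergence_L2w by (intro exI[of _ ?N]) blast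
  next
    assume "integrable_Cline \<sigma> (\<lambda>z. inverse (laplace k z) * laplace g z)" "real m > a + 1"
    then show "\<exists>N :: real \<Rightarrow> real. (\<forall>\<delta>>0. N \<delta> > 0) \<and> filterlim N at_top (at_right 0) \<and>
        (\<forall>gd. noisy_data g gd \<longrightarrow> (\<forall>T>0. in_Linf T u \<longrightarrow>
          (let e = (\<lambda>\<delta> t. u_approx \<sigma> k m (N \<delta>) (gd \<delta>) t - u t) in
            (\<forall>\<delta>>0. in_Linf T (e \<delta>)) \<and>
            ((\<lambda>\<delta>. norm_Linf T (e \<delta>)) \<longlongrightarrow> 0) (at_right 0))))"
      unfolding Let_def integrable_Cline_def U_eq using N convergence_Linf by (intro exI[of _ ?N]) blast
  next
    fix d c' :: real
    assume m: "real m > a + 1" and d: "d > 0" and c': "c' > 0"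
      and "\<forall>z\<in>Cline \<sigma>. norm (inverse (laplace k z) * laplace g z) \<le> c' / (1 + norm z powr (1 + d))"
    then have decay: "norm (laplace u (Complex \<sigma> y)) \<le> c' / (1 + norm (Complex \<sigma> y) powr (1 + d))" for y
      using U_eq[of y] Cline_Complex[of y] by metis
    \<comment> \<open>Only d < 1 calls for another exponent; for d \<ge> 1 the choice is that of the
      first two parts.\<close>
    let ?M = "\<lambda>\<delta>::real. if d < 1 then \<delta> powr (- 1 / (a + d + 1)) else ?N \<delta>"
    have lim: "filterlim ?M at_top (at_right 0)"
      using N(2) filterlim_powr_neg_at_right_0[of "- 1 / (a + d + 1)"] a_nonneg d by (cases "d < 1") auto
    \<comment> \<open>For \<delta> < 1 the power is this exponential exactly, so the o(1) term is
      taken to be 0.\<close>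
    have N_eq: "\<forall>\<^sub>F \<delta> in at_right 0. ?N \<delta> = exp (\<bar>ln \<delta>\<bar> / (a + 2) * (1 + 0))"
    proof -
      have "\<forall>\<^sub>F \<delta> in at_right 0. 0 < \<delta> \<and> \<delta> < (1::real)"
        by (auto simp: eventually_at_right_field intro: exI[of _ 1])
      then show ?thesis
        by eventually_elim (simp add: powr_def)
    qed
    have O_eq: "?N \<in> O[at_right 0](\<lambda>\<delta>. exp (\<bar>ln \<delta>\<bar> / (a + 2) * (1 + 0)))"
      by (rule bigoI[of _ 1]) (use N_eq in eventually_elim, simp)
    have in_Linf: "in_Linf T (\<lambda>t. u_approx \<sigma> k m (?M \<delta>) (gd \<delta>) t - u t)"
      if "noisy_data g gd" "0 < T" "0 < \<delta>" for gd T \<delta>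
      using rate_if_less_1(1)[OF m d _ decay c' that] convergence_Linf(1)[OF m integrable_U_if_decay[OF d decay c'] that]
      by (cases "d < 1") auto
    show "\<exists>N :: real \<Rightarrow> real. (\<forall>\<delta>>0. N \<delta> > 0) \<and> filterlim N at_top (at_right 0) \<and>
        (d < 1 \<longrightarrow> N \<in> O[at_right 0](\<lambda>\<delta>. \<delta> powr (- 1 / (a + d + 1)))) \<and>
        (d > 1 \<longrightarrow> N \<in> O[at_right 0](\<lambda>\<delta>. \<delta> powr (- 1 / (a + 2)))) \<and>
        (d = 1 \<longrightarrow> (\<exists>\<epsilon> :: real \<Rightarrow> real. (\<epsilon> \<longlongrightarrow> 0) (at_right 0) \<and>
            N \<in> O[at_right 0](\<lambda>\<delta>. exp (\<bar>ln \<delta>\<bar> / (a + 2) * (1 + \<epsilon> \<delta>))))) \<and>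
        (\<forall>gd. noisy_data g gd \<longrightarrow> (\<forall>T>0. in_Linf T u \<longrightarrow>
          (let e = (\<lambda>\<delta> t. u_approx \<sigma> k m (N \<delta>) (gd \<delta>) t - u t);
               \<eta> = (\<lambda>\<delta>. norm_Linf T (e \<delta>)) in
            (\<forall>\<delta>>0. in_Linf T (e \<delta>)) \<and>
            (d < 1 \<longrightarrow> \<eta> \<in> O[at_right 0](\<lambda>\<delta>. \<delta> powr (d / (a + d + 1)))) \<and>
            (d > 1 \<longrightarrow> \<eta> \<in> O[at_right 0](\<lambda>\<delta>. \<delta> powr (1 / (a + 2)))) \<and>
            (d = 1 \<longrightarrow> (\<exists>\<epsilon> :: real \<Rightarrow> real. (\<epsilon> \<longlongrightarrow> 0) (at_right 0) \<and>
               \<eta> \<in> O[at_right 0](\<lambda>\<delta>. \<bar>ln \<delta>\<bar> * exp (- (\<bar>ln \<delta>\<bar> / (a + 2)) * (1 + \<epsilon> \<delta>)))))))) "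
      unfolding Let_def
    proof (rule exI[of _ ?M], intro conjI allI impI)
      show "0 < ?M \<delta>" if "0 < \<delta>" for \<delta>
        using that by simp
      show "filterlim ?M at_top (at_right 0)"
        by (rule lim)
      show "?M \<in> O[at_right 0](\<lambda>\<delta>. \<delta> powr (- 1 / (a + d + 1)))" if "d < 1"
        using that by simp
      show "?M \<in> O[at_right 0](\<lambda>\<delta>. \<delta> powr (- 1 / (a + 2)))" if "d > 1"
        using that by simp
      show "\<exists>\<epsilon> :: real \<Rightarrow> real. (\<epsilon> \<longlongrightarrow> 0) (at_right 0) \<and>
            ?M \<in> O[at_right 0](\<lambda>\<delta>. exp (\<bar>ln \<delta>\<bar> / (a + 2) * (1 + \<epsilon> \<delta>)))" if "d = 1"
        using that O_eq by (intro exI[of _ "\<lambda>_. 0"]) simp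
      fix gd :: "real \<Rightarrow> real \<Rightarrow> complex" and T :: real
      assume gd: "noisy_data g gd" and T: "T > 0"
      show "in_Linf T (\<lambda>t. u_approx \<sigma> k m (?M \<delta>) (gd \<delta>) t - u t)" if "0 < \<delta>" for \<delta>
        by (rule in_Linf[OF gd T that])
      show "(\<lambda>\<delta>. norm_Linf T (\<lambda>t. u_approx \<sigma> k m (?M \<delta>) (gd \<delta>) t - u t))
          \<in> O[at_right 0](\<lambda>\<delta>. \<delta> powr (d / (a + d + 1)))" if "d < 1"
        using rate_if_less_1(2)[OF m d that decay c' gd T] that by simp
      show "(\<lambda>\<delta>. norm_Linf T (\<lambda>t. u_approx \<sigma> k m (?M \<delta>) (gd \<delta>) t - u t))
          \<in> O[at_right 0](\<lambda>\<delta>. \<delta> powr (1 / (a + 2)))" if "d > 1"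
        using rate_if_gt_1[OF m that decay c' gd T] that by simp
      show "\<exists>\<epsilon> :: real \<Rightarrow> real. (\<epsilon> \<longlongrightarrow> 0) (at_right 0) \<and>
          (\<lambda>\<delta>. norm_Linf T (\<lambda>t. u_approx \<sigma> k m (?M \<delta>) (gd \<delta>) t - u t))
          \<in> O[at_right 0](\<lambda>\<delta>. \<bar>ln \<delta>\<bar> * exp (- (\<bar>ln \<delta>\<bar> / (a + 2)) * (1 + \<epsilon> \<delta>)))" if "d = 1"
        using rate_if_eq_1[OF m decay[unfolded that] c' gd T] that by (intro exI[of _ "\<lambda>_. 0"]) simp
    qed
  qed
qed

end
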